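(* For $n\geq1$, $$A_n^{(l)}(t,r,q)=\sum_{\pi\in C_l\wr\mathfrak{S}_n} t^{\mathrm{flec}(\pi)}r^{\mathrm{pix}(\pi)}q^{\mathrm{inv}(\pi)-\mathrm{lec}(\pi)}.$$
   Context: $C_l\wr\mathfrak{S}_n$ is the set of words $\pi=\pi_1\cdots\pi_n$ with $\pi_i=|\pi_i|^{\epsilon_i}$, $\epsilon_i\in\{0,\dots,l-1\}$, $|\pi|=|\pi_1|\cdots|\pi_n|\in\mathfrak{S}_n$. Order colored integers by $u^a<v^b$ iff $a>b$, or $a=b$ and $u<v$; $\mathrm{maj}(\pi)=\sum\{i\in[n-1]:\pi_i>\pi_{i+1}\}$; $\mathrm{exc}(\pi)$ is the number of $i$ with $\epsilon_i=0$ and $|\pi_i|>i$; $\mathrm{fexc}(\pi)=l\,\mathrm{exc}(\pi)+\sum_i\epsilon_i$; $\mathrm{fix}(\pi)=|\{i:\pi_i=i^0\}|$; $A_n^{(l)}(t,r,q)=\sum_{\pi}t^{\mathrm{fexc}(\pi)}r^{\mathrm{fix}(\pi)}q^{(\mathrm{maj}-\mathrm{exc})\pi}$. A word $w_1\cdots w_m$ over positive integers is a hook if $w_1>w_2$ and either $m=2$ or $w_2<w_3<\cdots<w_m$. A word $w=w_1\cdots w_m$ of colored integers is a colored hook if either ($m\ge2$, $|w|$ is a hook, and only $w_1$ may have positive color) or ($m\ge1$, $|w|$ is increasing, and $w_1$ has positive color while all other letters have color $0$). Each $\pi$ has a unique colored hook factorization $\pi=p\,\tau_1\tau_2\cdots\tau_r$,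 where $p$ consists of $0$-colored letters with $|p|$ increasing and each $\tau_i$ is a colored hook. For a word $w$ over integers, $\mathrm{inv}(w)=|\{(i,j):i<j,\ w_i>w_j\}|$. Set $\mathrm{inv}(\pi)=\mathrm{inv}(|\pi|)$, $\mathrm{lec}(\pi)=\sum_{i=1}^r\mathrm{inv}(|\tau_i|)$, $\mathrm{flec}(\pi)=l\cdot\mathrm{lec}(\pi)+\sum_{i=1}^n\epsilon_i$, $\mathrm{pix}(\pi)=\mathrm{length}(p)$. *)

theory Defs
  imports Main
begin

text \<open>A colored letter u^a is represented as the pair (u, a) :: nat \<times> nat.
  A colored permutation pi = pi_1 ... pi_n in C_l wr S_n is a list of length n
  whose underlying word is a permutation of 1..n and whose colors are < l.\<close>

definition colored_perms :: "nat \<Rightarrow> nat \<Rightarrow> (nat \<times> nat) list set" where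
  "colored_perms l n = {w. length w = n \<and> distinct (map fst w) \<and> set (map fst w) = {1..n}
                          \<and> (\<forall>x \<in> set w. snd x < l)}"

definition cless :: "nat \<times> nat \<Rightarrow> nat \<times> nat \<Rightarrow> bool" where
  "cless x y = (snd x > snd y \<or> (snd x = snd y \<and> fst x < fst y))"

text \<open>Positions are 1-based: pi_i = w ! (i - 1).\<close>
definition cmaj :: "(nat \<times> nat) list \<Rightarrow> nat" where
  "cmaj w = (\<Sum>i \<in> {i. 1 \<le> i \<and> i < length w \<and> cless (w ! i) (w ! (i - 1))}. i)"

definition cexc :: "(nat \<times> nat) list \<Rightarrow> nat" where
  "cexc w = card {i. 1 \<le> i \<and> i \<le> length w \<and> snd (w ! (i - 1)) = 0 \<and> fst (w ! (i - 1)) > i}"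

definition colsum :: "(nat \<times> nat) list \<Rightarrow> nat" where
  "colsum w = sum_list (map snd w)"

definition fexc :: "nat \<Rightarrow> (nat \<times> nat) list \<Rightarrow> nat" where
  "fexc l w = l * cexc w + colsum w"

definition cfix :: "(nat \<times> nat) list \<Rightarrow> nat" where
  "cfix w = card {i. 1 \<le> i \<and> i \<le> length w \<and> w ! (i - 1) = (i, 0)}"

definition is_hook :: "nat list \<Rightarrow> bool" where
  "is_hook v = (length v \<ge> 2 \<and> v ! 0 > v ! 1 \<and> sorted_wrt (<) (tl v))"

definition colored_hook :: "(nat \<times> nat) list \<Rightarrow> bool" where
  "colored_hook w =
     ((length w \<ge> 2 \<and> is_hook (map fst w) \<and> (\<forall>x \<in> set (tl w). snd x = 0))
      \<or> (length w \<ge> 1 \<and> sorted_wrt (<) (map fst w) \<and> snd (hd w) > 0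
          \<and> (\<forall>x \<in> set (tl w). snd x = 0)))"

definition hook_fact_rel :: "(nat \<times> nat) list \<Rightarrow> (nat \<times> nat) list \<Rightarrow> (nat \<times> nat) list list \<Rightarrow> bool" where
  "hook_fact_rel w p ts =
     (w = p @ concat ts \<and> (\<forall>x \<in> set p. snd x = 0) \<and> sorted_wrt (<) (map fst p)
      \<and> (\<forall>\<tau> \<in> set ts. colored_hook \<tau>))"

definition hook_fact :: "(nat \<times> nat) list \<Rightarrow> (nat \<times> nat) list \<times> (nat \<times> nat) list list" where
  "hook_fact w = (THE (p, ts). hook_fact_rel w p ts)"

definition inv_word :: "nat list \<Rightarrow> nat" where
  "inv_word v = card {(i, j). i < j \<and> j < length v \<and> v ! i > v ! j}"

definition cinv :: "(nat \<times> nat) list \<Rightarrow> nat" where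
  "cinv w = inv_word (map fst w)"

definition lec :: "(nat \<times> nat) list \<Rightarrow> nat" where
  "lec w = sum_list (map (\<lambda>\<tau>. inv_word (map fst \<tau>)) (snd (hook_fact w)))"

definition flec :: "nat \<Rightarrow> (nat \<times> nat) list \<Rightarrow> nat" where
  "flec l w = l * lec w + colsum w"

definition pix :: "(nat \<times> nat) list \<Rightarrow> nat" where
  "pix w = length (fst (hook_fact w))"

end

theory Submission
  imports Defs Complex_Main "HOL-Library.Poly_Mapping" "HOL-Library.Multiset" "HOL-Library.FuncSet"
    "HOL-Library.Product_Lexorder" "HOL-Computational_Algebra.Polynomial"
    "HOL-Computational_Algebra.Formal_Power_Series"
begin

text \<open>
  Both sides are shown to satisfy the recurrence: the sum over \<open>m\<close> of
  \<open>[n choose m]_q (t^(l m) - t) A_(n-m)\<close> equals \<open>(1 - t) r^n\<close>. For the right-hand side one splits off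
  the last colored hook: it starts at the last position that carries a positive color or a descent,
  and the hooks on a given set of \<open>m\<close> letters contribute \<open>t + t^2 + \<dots> + t^(l m - 1)\<close>.

  For the left-hand side, give every excedance the new color \<open>l\<close>. Then fexc becomes the sum of the
  colors and maj - exc becomes maj. Pair a permutation \<open>w\<close> with the weakly decreasing sequences \<open>c\<close>
  that drop strictly at the descents of \<open>w\<close>; in total they have weight \<open>q^maj / (q;q)_n\<close>.
  Standardization identifies the perm_seq_pairs \<open>(w, c)\<close> with words \<open>V\<close> in letters (value, color), and the
  condition tying color \<open>l\<close> to excedances becomes local: it compares a letter of \<open>V\<close> with the value
  at the same position of the sorted word \<open>c\<close>. So words of content \<open>M\<close> are counted by the
  coefficient of \<open>X^M\<close> in a product, over the blocks of \<open>c\<close>, of powers of linear forms \<open>L_y\<close>,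
  up to a factor \<open>(1 - x)(1 - t^l x) / (1 - r x)\<close> for each value, which accounts for the
  fixed points and for the first position of a block.

  The linear forms satisfy \<open>L_y - t^l X_y = L_z - X_z\<close> when \<open>z\<close> is the value following \<open>y\<close> in the
  content, and at the ends \<open>L_min - X_min = t (L_max - t^l X_max)\<close>. Hence the products of
  \<open>L_y - X_y\<close> and of \<open>L_y - t^l X_y\<close> over the content differ by the factor \<open>t\<close>, which evaluates
  the generating function without the MacMahon master theorem.

  This proves the identity for real \<open>t\<close>, \<open>r\<close> and \<open>0 < q < 1\<close>. Comparing coefficients turns it into an
  equidistribution, and so into an identity over every field.
\<close>

section \<open>Colored hook factorizations\<close>

text \<open>The last hook of a word begins at the last such position. An earlier one may also be the
  end of a hook, when the next hook begins with a smaller letter.\<close>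

definition hook_start :: "(nat \<times> nat) list \<Rightarrow> nat \<Rightarrow> bool" where
  "hook_start w i \<longleftrightarrow> i < length w \<and>
     (snd (w ! i) > 0 \<or> Suc i < length w \<and> fst (w ! Suc i) < fst (w ! i))"

lemma not_hook_start_increasing:
  assumes "\<forall>x \<in> set p. snd x = 0" "sorted_wrt (<) (map fst p)"
  shows "\<not> hook_start p i"
  using assms sorted_wrt_nth_less[of "(<)" "map fst p" i "Suc i"]
  by (auto simp: hook_start_def)

lemma colored_hook_ne: "colored_hook h \<Longrightarrow> h \<noteq> []"
  by (auto simp: colored_hook_def)

lemma colored_hook_tl:
  assumes "colored_hook h"
  shows "\<forall>x \<in> set (tl h). snd x = 0" "sorted_wrt (<) (map fst (tl h))"
proof -
  show "\<forall>x \<in> set (tl h). snd x = 0" using assms by (auto simp: colored_hook_def)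
  show "sorted_wrt (<) (map fst (tl h))"
    using assms by (cases h) (auto simp: colored_hook_def is_hook_def)
qed

lemma hook_start_head:
  assumes "colored_hook h"
  shows "hook_start (u @ h) (length u)"
  using assms by (cases h; cases "tl h") (auto simp: hook_start_def colored_hook_def is_hook_def nth_append)

lemma hook_start_tail:
  assumes "colored_hook h" "length u < i"
  shows "\<not> hook_start (u @ h) i"
proof
  assume h: "hook_start (u @ h) i"
  obtain a g where hg: "h = a # g" using colored_hook_ne[OF assms(1)] by (cases h) auto
  define j where "j = i - Suc (length u)"
  have i: "i = length u + Suc j" using assms(2) by (simp add: j_def)
  have "hook_start g j" using h unfolding i hook_start_def hg by (auto simp: nth_append)
  moreover have "\<not> hook_start g j"
    using colored_hook_tl[OF assms(1)] not_hook_start_increasing[of g j] by (simp add: hg)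
  ultimately show False by blast
qed

text \<open>The head of a colored hook that ends a word is a hook start and no later position is
  one, so both cuts are at the last hook start.\<close>

lemma last_hook_unique:
  assumes "colored_hook h" "colored_hook h'" "u @ h = u' @ h'"
  shows "u = u'" "h = h'"
proof -
  have "length u = length u'"
    using hook_start_head[OF assms(1), of u] hook_start_head[OF assms(2), of u']
      hook_start_tail[OF assms(1), of u] hook_start_tail[OF assms(2), of u'] assms(3)
    by (metis linorder_neqE_nat)
  with assms(3) show "u = u'" "h = h'" by auto
qed

lemma hook_fact_rel_snoc:
  "hook_fact_rel w p (ts @ [h]) \<longleftrightarrow> (\<exists>u. w = u @ h \<and> colored_hook h \<and> hook_fact_rel u p ts)"
  by (auto simp: hook_fact_rel_def)

lemma hook_fact_rel_Nil:
  "hook_fact_rel w p [] \<longleftrightarrow> w = p \<and> (\<forall>x \<in> set p. snd x = 0) \<and> sorted_wrt (<) (map fst p)"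
  by (auto simp: hook_fact_rel_def)

text \<open>Last hooks are peeled off one at a time; an uncolored increasing word has no hook start,
  so both lists run out together. This gives the \<open>THE\<close> in \<open>hook_fact\<close> its
  meaning.\<close>

lemma hook_fact_rel_unique:
  "hook_fact_rel w p ts \<Longrightarrow> hook_fact_rel w p' ts' \<Longrightarrow> p = p' \<and> ts = ts'"
proof (induction ts arbitrary: w ts' rule: rev_induct)
  case Nil
  have no: "\<not> hook_start w i" for i
    using Nil(1) not_hook_start_increasing by (auto simp: hook_fact_rel_Nil)
  show ?case
  proof (cases ts' rule: rev_cases)
    case Nil
    with \<open>hook_fact_rel w p []\<close> \<open>hook_fact_rel w p' ts'\<close> show ?thesis by (auto simp: hook_fact_rel_Nil)
  next
    case (snoc ys y)
    then show ?thesis using Nil(2) no hook_start_head by (auto simp: hook_fact_rel_snoc)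
  qed
next
  case (snoc h ts)
  obtain u where u: "w = u @ h" "colored_hook h" "hook_fact_rel u p ts"
    using snoc.prems(1) by (auto simp: hook_fact_rel_snoc)
  show ?case
  proof (cases ts' rule: rev_cases)
    case Nil
    then have "\<not> hook_start w (length u)"
      using snoc.prems(2) not_hook_start_increasing by (auto simp: hook_fact_rel_Nil)
    then show ?thesis using u hook_start_head by auto
  next
    case (snoc ys y)
    then obtain u' where u': "w = u' @ y" "colored_hook y" "hook_fact_rel u' p' ys"
      using snoc.prems(2) by (auto simp: hook_fact_rel_snoc)
    have "u = u'" "h = y" using last_hook_unique[of h y u u'] u u' by auto
    then show ?thesis using snoc.IH[of u ys] u u' snoc by auto
  qed
qed

lemma hook_fact_eq: "hook_fact_rel w p ts \<Longrightarrow> hook_fact w = (p, ts)"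
  unfolding hook_fact_def
  by (rule the_equality) (auto dest: hook_fact_rel_unique)

text \<open>The cut is made at the last hook start \<open>i\<close>: behind it all colors are 0 and
  the letters increase.\<close>

lemma last_hook_exists:
  assumes "distinct (map fst w)" "\<not> ((\<forall>x \<in> set w. snd x = 0) \<and> sorted_wrt (<) (map fst w))"
  shows "\<exists>u h. w = u @ h \<and> colored_hook h"
proof -
  let ?I = "{i. hook_start w i}"
  have fin: "finite ?I" by (rule finite_subset[of _ "{..<length w}"]) (auto simp: hook_start_def)
  \<comment> \<open>Distinct letters turn the absence of a descent into an ascent.\<close>
  have step: "fst (w ! j) < fst (w ! Suc j)" if "\<not> hook_start w j" "Suc j < length w" for j
    using that nth_eq_iff_index_eq[OF assms(1), of j "Suc j"] by (auto simp: hook_start_def)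
  have ne: "?I \<noteq> {}"
  proof
    assume "?I = {}"
    then have no: "\<not> hook_start w i" for i by auto
    have "\<forall>x \<in> set w. snd x = 0" using no unfolding hook_start_def by (metis in_set_conv_nth neq0_conv)
    moreover have "sorted_wrt (<) (map fst w)"
      using step no by (auto simp: sorted_wrt_iff_nth_Suc_transp)
    ultimately show False using assms(2) by blast
  qed
  define i where "i = Max ?I"
  have i: "hook_start w i" using Max_in[OF fin ne] by (simp add: i_def)
  have gt: "\<not> hook_start w j" if "j > i" for j
    using Max_ge[OF fin, of j] that by (auto simp: i_def)
  have il: "i < length w" using i by (simp add: hook_start_def)
  define g where "g = drop (Suc i) w"
  have dr: "drop i w = w ! i # g" using il by (simp add: g_def Cons_nth_drop_Suc)
  have g0: "\<forall>x \<in> set g. snd x = 0"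
  proof
    fix x assume "x \<in> set g"
    then obtain k where "k < length g" "x = g ! k" by (metis in_set_conv_nth)
    then show "snd x = 0" using gt[of "Suc i + k"] by (auto simp: hook_start_def g_def)
  qed
  have gs: "sorted_wrt (<) (map fst g)"
    using step gt by (auto simp: sorted_wrt_iff_nth_Suc_transp g_def)
  \<comment> \<open>A descent at \<open>i\<close> gives a hook of the first kind; without one, the
    color at \<open>i\<close> is positive and the whole word \<open>w ! i # g\<close>
    increases.\<close>
  have "colored_hook (w ! i # g)"
  proof (cases "Suc i < length w \<and> fst (w ! Suc i) < fst (w ! i)")
    case True
    then have "g = w ! Suc i # drop (Suc (Suc i)) w" by (simp add: g_def Cons_nth_drop_Suc)
    then show ?thesis using g0 gs True unfolding colored_hook_def is_hook_def by auto
  next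
    case False
    then have c: "snd (w ! i) > 0" using i by (auto simp: hook_start_def)
    have "fst (w ! i) < fst y" if "y \<in> set g" for y
    proof -
      obtain k where k: "k < length g" "y = g ! k" using \<open>y \<in> set g\<close> by (metis in_set_conv_nth)
      have "g \<noteq> []" using k by auto
      then have si: "Suc i < length w" by (auto simp: g_def)
      have a: "fst (w ! i) < fst (g ! 0)"
        using False si nth_eq_iff_index_eq[OF assms(1), of i "Suc i"] by (simp add: g_def)
      have "fst (g ! 0) \<le> fst (g ! k)"
        using sorted_wrt_nth_less[OF gs, of 0 k] k \<open>g \<noteq> []\<close> by (cases k) auto
      then show ?thesis using a k by simp
    qed
    then show ?thesis using c g0 gs by (auto simp: colored_hook_def)
  qed
  then show ?thesis using append_take_drop_id[of i w] dr by metis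
qed

lemma hook_fact_rel_exists:
  "distinct (map fst w) \<Longrightarrow> \<exists>p ts. hook_fact_rel w p ts"
proof (induction "length w" arbitrary: w rule: less_induct)
  case less
  show ?case
  proof (cases "(\<forall>x \<in> set w. snd x = 0) \<and> sorted_wrt (<) (map fst w)")
    case True
    then show ?thesis using hook_fact_rel_Nil by blast
  next
    case False
    then obtain u h where uh: "w = u @ h" "colored_hook h"
      using last_hook_exists less.prems by blast
    then obtain p ts where "hook_fact_rel u p ts"
      using less.hyps[of u] less.prems colored_hook_ne by auto
    then show ?thesis using hook_fact_rel_snoc uh by blast
  qed
qed

lemma hook_fact_increasing:
  assumes "\<forall>x \<in> set w. snd x = 0" "sorted_wrt (<) (map fst w)"
  shows "lec w = 0" "pix w = length w"
proof -
  have "hook_fact w = (w, [])" by (rule hook_fact_eq) (use assms hook_fact_rel_Nil in auto)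
  then show "lec w = 0" "pix w = length w" by (auto simp: lec_def pix_def)
qed

lemma hook_fact_append_hook:
  assumes "distinct (map fst u)" "colored_hook h"
  shows "lec (u @ h) = lec u + inv_word (map fst h)" "pix (u @ h) = pix u"
proof -
  obtain p ts where pts: "hook_fact_rel u p ts" using hook_fact_rel_exists assms by blast
  have "hook_fact u = (p, ts)" using pts by (rule hook_fact_eq)
  moreover have "hook_fact (u @ h) = (p, ts @ [h])"
    by (rule hook_fact_eq) (use pts assms hook_fact_rel_snoc in auto)
  ultimately show "lec (u @ h) = lec u + inv_word (map fst h)" "pix (u @ h) = pix u"
    by (auto simp: lec_def pix_def)
qed

section \<open>Inversions of words\<close>

lemma inv_word_Nil [simp]: "inv_word [] = 0"
  by (simp add: inv_word_def)

lemma inv_word_Cons: "inv_word (x # xs) = length (filter (\<lambda>y. y < x) xs) + inv_word xs"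
proof -
  let ?A = "{(i, j). i < j \<and> j < length xs \<and> xs ! i > xs ! j}"
  let ?B = "{j. j < length xs \<and> xs ! j < x}"
  have fin: "finite ?A" by (rule finite_subset[of _ "{..<length xs} \<times> {..<length xs}"]) auto
  have eq: "{(i, j). i < j \<and> j < length (x # xs) \<and> (x # xs) ! i > (x # xs) ! j}
      = (\<lambda>j. (0, Suc j)) ` ?B \<union> map_prod Suc Suc ` ?A" (is "?L = ?R")
  proof (rule set_eqI, clarify)
    fix i j
    show "((i, j) \<in> ?L) = ((i, j) \<in> ?R)"
      by (cases i; cases j) (auto simp: image_iff)
  qed
  have "inv_word (x # xs) = card ((\<lambda>j. (0::nat, Suc j)) ` ?B) + card (map_prod Suc Suc ` ?A)"
    unfolding inv_word_def eq by (rule card_Un_disjoint) (use fin in auto)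
  also have "card ((\<lambda>j. (0::nat, Suc j)) ` ?B) = card ?B" by (rule card_image) (auto simp: inj_on_def)
  also have "card (map_prod Suc Suc ` ?A) = card ?A" by (rule card_image) (auto simp: inj_on_def)
  also have "card ?B = length (filter (\<lambda>y. y < x) xs)" by (simp add: length_filter_conv_card)
  finally show ?thesis by (simp add: inv_word_def)
qed

lemma inv_word_append:
  "inv_word (xs @ ys) = inv_word xs + inv_word ys + (\<Sum>x\<leftarrow>xs. length (filter (\<lambda>y. y < x) ys))"
  by (induction xs) (auto simp: inv_word_Cons)

lemma inv_word_increasing: "sorted_wrt (<) xs \<Longrightarrow> inv_word xs = 0"
  by (induction xs) (auto simp: inv_word_Cons filter_empty_conv)

text \<open>Inversions between a block with letter set \<open>A\<close> and a later block with
  letter set \<open>B\<close>; the order inside the blocks does not matter.\<close>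

definition cross_inv :: "nat set \<Rightarrow> nat set \<Rightarrow> nat" where
  "cross_inv A B = (\<Sum>x\<in>A. card {y \<in> B. y < x})"

lemma inv_word_append_distinct:
  assumes "distinct xs" "distinct ys"
  shows "inv_word (xs @ ys) = inv_word xs + inv_word ys + cross_inv (set xs) (set ys)"
proof -
  have "length (filter (\<lambda>y. y < x) ys) = card {y \<in> set ys. y < x}" for x
    using distinct_card[of "filter (\<lambda>y. y < x) ys"] assms by (simp add: Collect_conj_eq Int_commute)
  then show ?thesis
    using assms by (simp add: inv_word_append cross_inv_def sum_list_distinct_conv_sum_set)
qed

text \<open>Inversions inside the hooks are inversions of the word. Hence the subtraction
  \<open>cinv w - lec w\<close> on natural numbers loses nothing.\<close>

lemma lec_le_cinv:
  "distinct (map fst w) \<Longrightarrow> lec w \<le> cinv w"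
proof (induction "length w" arbitrary: w rule: less_induct)
  case less
  show ?case
  proof (cases "(\<forall>x \<in> set w. snd x = 0) \<and> sorted_wrt (<) (map fst w)")
    case True
    then show ?thesis using hook_fact_increasing by simp
  next
    case False
    then obtain u h where uh: "w = u @ h" "colored_hook h"
      using last_hook_exists less.prems by blast
    have "lec u \<le> cinv u" using less.hyps[of u] less.prems colored_hook_ne uh by auto
    then show ?thesis
      using less.prems uh by (simp add: cinv_def inv_word_append_distinct hook_fact_append_hook)
  qed
qed

section \<open>Splitting off the last hook, for words on an arbitrary finite set of letters\<close>

definition colored_words :: "nat \<Rightarrow> nat set \<Rightarrow> (nat \<times> nat) list set" where
  "colored_words l S = {w. distinct (map fst w) \<and> set (map fst w) = S \<and> (\<forall>x \<in> set w. snd x < l)}"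

lemma colored_perms_eq_words: "colored_perms l n = colored_words l {1..n}"
proof -
  have "length w = n \<longleftrightarrow> distinct (map fst w)" if "set (map fst w) = {1..n}" for w :: "(nat \<times> nat) list"
  proof
    assume "length w = n"
    then show "distinct (map fst w)" using that by (intro card_distinct) simp
  next
    assume "distinct (map fst w)"
    then show "length w = n" using distinct_card[of "map fst w"] that by simp
  qed
  then show ?thesis unfolding colored_perms_def colored_words_def by auto
qed

lemma finite_colored_words: "finite S \<Longrightarrow> finite (colored_words l S)"
proof -
  assume fin: "finite S"
  have "colored_words l S \<subseteq> {w. set w \<subseteq> S \<times> {..<l} \<and> length w = card S}"
    unfolding colored_words_def
    by (auto dest!: distinct_card) (auto intro: image_eqI[rotated])
  then show ?thesis by (rule finite_subset) (use fin in \<open>auto intro: finite_lists_length_eq\<close>)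
qed

definition hook_weight :: "nat \<Rightarrow> real \<Rightarrow> real \<Rightarrow> real \<Rightarrow> (nat \<times> nat) list \<Rightarrow> real" where
  "hook_weight l t r q w = t ^ flec l w * r ^ pix w * q ^ (cinv w - lec w)"

definition hooks :: "nat \<Rightarrow> nat set \<Rightarrow> (nat \<times> nat) list set" where
  "hooks l T = {h \<in> colored_words l T. colored_hook h}"

text \<open>The inversions inside \<open>h\<close> count in both \<open>cinv\<close> and
  \<open>lec\<close> and cancel in the exponent of \<open>q\<close>, so the hook itself contributes
  only a power of \<open>t\<close>.\<close>

lemma hook_weight_append:
  assumes "u \<in> colored_words l A" "h \<in> hooks l T"
  shows "hook_weight l t r q (u @ h) =
    q ^ cross_inv A T * hook_weight l t r q u * t ^ (l * cinv h + colsum h)"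
proof -
  have d: "distinct (map fst u)" "distinct (map fst h)" "colored_hook h"
    and s: "set (map fst u) = A" "set (map fst h) = T"
    using assms by (auto simp: colored_words_def hooks_def)
  have "cinv (u @ h) - lec (u @ h) = cross_inv A T + (cinv u - lec u)"
    using lec_le_cinv[OF d(1)] inv_word_append_distinct[OF d(1,2)] s
    by (simp add: cinv_def hook_fact_append_hook[OF d(1,3)])
  moreover have "flec l (u @ h) = flec l u + (l * cinv h + colsum h)"
    by (simp add: flec_def colsum_def cinv_def hook_fact_append_hook[OF d(1,3)] algebra_simps)
  ultimately show ?thesis
    unfolding hook_weight_def hook_fact_append_hook[OF d(1,3)] by (simp add: power_add algebra_simps)
qed

lemma sorted_list_of_set_strict: "sorted_wrt (<) xs \<Longrightarrow> sorted_list_of_set (set xs) = (xs :: nat list)"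
  by (simp add: strict_sorted_iff sorted_list_of_set.idem_if_sorted_distinct)

text \<open>This single word accounts for the term \<open>r ^ card S\<close> in the recurrence
  below.\<close>

lemma increasing_words:
  assumes "finite S" "l \<ge> 1"
  shows "{w \<in> colored_words l S. (\<forall>x \<in> set w. snd x = 0) \<and> sorted_wrt (<) (map fst w)}
      = {map (\<lambda>x. (x, 0)) (sorted_list_of_set S)}" (is "?L = {?m}")
proof -
  have m: "map fst ?m = sorted_list_of_set S" by (simp add: comp_def)
  have "?m \<in> ?L" using assms unfolding colored_words_def m by (auto simp: comp_def image_image)
  moreover have "w = ?m" if "w \<in> ?L" for w
  proof -
    have "map fst w = sorted_list_of_set S"
      using that sorted_list_of_set_strict[of "map fst w"] by (auto simp: colored_words_def)
    moreover have "w = map (\<lambda>x. (x, 0)) (map fst w)"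
      using that by (auto intro!: nth_equalityI prod_eqI)
    ultimately show ?thesis by simp
  qed
  ultimately show ?thesis by blast
qed

lemma sum_times_product:
  "(\<Sum>(u, h)\<in>C \<times> H. a * F u * G h) = a * sum F C * sum G (H :: 'b set)" for a :: real
proof -
  have "(\<Sum>(u, h)\<in>C \<times> H. a * F u * G h) = (\<Sum>u\<in>C. (a * F u) * sum G H)"
    by (simp add: sum.cartesian_product[symmetric] sum_distrib_left)
  also have "\<dots> = (\<Sum>u\<in>C. a * F u) * sum G H" by (rule sum_distrib_right[symmetric])
  finally show ?thesis by (simp only: sum_distrib_left)
qed

text \<open>A word is either increasing and uncolored, or it is \<open>u @ h\<close> for a unique
  last hook \<open>h\<close>; \<open>T\<close> is the set of letters of \<open>h\<close>.\<close>

lemma sum_hook_weight_rec: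
  assumes "finite S" "l \<ge> 1"
  shows "(\<Sum>w\<in>colored_words l S. hook_weight l t r q w) = r ^ card S +
    (\<Sum>T\<in>Pow S - {{}}. q ^ cross_inv (S - T) T * (\<Sum>u\<in>colored_words l (S - T). hook_weight l t r q u) *
        (\<Sum>h\<in>hooks l T. t ^ (l * cinv h + colsum h)))"
proof -
  let ?I = "{w \<in> colored_words l S. (\<forall>x \<in> set w. snd x = 0) \<and> sorted_wrt (<) (map fst w)}"
  let ?D = "SIGMA T : Pow S - {{}}. colored_words l (S - T) \<times> hooks l T"
  let ?F = "hook_weight l t r q"
  have fin: "finite (colored_words l A)" "finite (hooks l A)" if "A \<subseteq> S" for A
    using finite_colored_words[of A l] that assms(1) by (auto simp: hooks_def intro: finite_subset)
  have bij: "bij_betw (\<lambda>(T, u, h). u @ h) ?D (colored_words l S - ?I)"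
    unfolding bij_betw_def
  proof
    show "inj_on (\<lambda>(T, u, h). u @ h) ?D"
    proof (rule inj_onI)
      fix z z' assume z: "z \<in> ?D" "z' \<in> ?D" "(\<lambda>(T, u, h). u @ h) z = (\<lambda>(T, u, h). u @ h) z'"
      obtain T u h T' u' h' where e: "z = (T, u, h)" "z' = (T', u', h')" by (metis prod_cases3)
      have a: "h \<in> hooks l T" "h' \<in> hooks l T'" "u @ h = u' @ h'" using z e by auto
      then have "u = u'" "h = h'" using last_hook_unique[of h h' u u'] by (auto simp: hooks_def)
      with a show "z = z'" by (auto simp: hooks_def colored_words_def e)
    qed
    show "(\<lambda>(T, u, h). u @ h) ` ?D = colored_words l S - ?I"
    proof (intro equalityI subsetI)
      fix w assume "w \<in> (\<lambda>(T, u, h). u @ h) ` ?D"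
      then obtain T u h where w: "w = u @ h" and T: "T \<subseteq> S" "T \<noteq> {}"
        and u: "u \<in> colored_words l (S - T)" and h: "h \<in> hooks l T" by auto
      have "w \<in> colored_words l S" using w T u h by (auto simp: colored_words_def hooks_def)
      moreover have "hook_start w (length u)" using w h hook_start_head by (auto simp: hooks_def)
      then have "w \<notin> ?I" using not_hook_start_increasing by blast
      ultimately show "w \<in> colored_words l S - ?I" by blast
    next
      fix w assume "w \<in> colored_words l S - ?I"
      then have w: "w \<in> colored_words l S" "w \<notin> ?I" by auto
      then obtain u h where uh: "w = u @ h" "colored_hook h"
        using last_hook_exists[of w] by (auto simp: colored_words_def)
      have "h \<in> hooks l (fst ` set h)" "fst ` set h \<in> Pow S - {{}}"
        "u \<in> colored_words l (S - fst ` set h)"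
        using w(1) uh colored_hook_ne[of h] by (auto simp: colored_words_def hooks_def)
      then show "w \<in> (\<lambda>(T, u, h). u @ h) ` ?D"
        using uh by (intro image_eqI[of _ _ "(fst ` set h, u, h)"]) auto
    qed
  qed
  have "sum ?F (colored_words l S) = sum ?F ?I + sum ?F (colored_words l S - ?I)"
    by (rule sum.subset_diff[of ?I, THEN trans]) (use fin in \<open>auto simp: add.commute\<close>)
  also have "sum ?F ?I = r ^ card S"
  proof -
    let ?m = "map (\<lambda>x. (x, 0::nat)) (sorted_list_of_set S)"
    have m: "(\<forall>x \<in> set ?m. snd x = 0) \<and> sorted_wrt (<) (map fst ?m)" by (simp add: comp_def)
    have "colsum ?m = 0" by (simp add: colsum_def comp_def)
    then have "?F ?m = r ^ card S"
      using m hook_fact_increasing[of ?m] inv_word_increasing[of "map fst ?m"]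
      by (simp add: hook_weight_def flec_def cinv_def)
    then show ?thesis using increasing_words[OF assms] by simp
  qed
  also have "sum ?F (colored_words l S - ?I) = (\<Sum>(T, u, h)\<in>?D. ?F (u @ h))"
    by (subst sum.reindex_bij_betw[OF bij, symmetric]) (simp add: case_prod_unfold)
  also have "\<dots> = (\<Sum>(T, u, h)\<in>?D. q ^ cross_inv (S - T) T * ?F u * t ^ (l * cinv h + colsum h))"
    by (rule sum.cong) (auto simp: hook_weight_append)
  also have "\<dots> = (\<Sum>T\<in>Pow S - {{}}. \<Sum>(u, h)\<in>colored_words l (S - T) \<times> hooks l T.
      q ^ cross_inv (S - T) T * ?F u * t ^ (l * cinv h + colsum h))"
    by (subst sum.Sigma) (use assms fin in \<open>auto simp: case_prod_unfold\<close>)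
  also have "\<dots> = (\<Sum>T\<in>Pow S - {{}}. q ^ cross_inv (S - T) T * sum ?F (colored_words l (S - T)) *
        (\<Sum>h\<in>hooks l T. t ^ (l * cinv h + colsum h)))"
    by (simp only: sum_times_product)
  finally show ?thesis .
qed

text \<open>The ranks of the elements of \<open>T\<close> are \<open>0, ..., card T - 1\<close>,
  each taken once.\<close>

lemma sum_power_rank:
  assumes "finite T"
  shows "(\<Sum>x\<in>T. s ^ card {y \<in> T. y < (x::nat)}) = (\<Sum>k<card T. s ^ k)"
  using assms
proof (induction T rule: finite_linorder_max_induct)
  case empty
  then show ?case by simp
next
  case (insert m T)
  have m: "m \<notin> T" using insert by auto
  have "{y \<in> insert m T. y < x} = {y \<in> T. y < x}" if "x \<in> T" for x using insert that by auto
  then have "(\<Sum>x\<in>T. s ^ card {y \<in> insert m T. y < x}) = (\<Sum>x\<in>T. s ^ card {y \<in> T. y < x})"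
    by (intro sum.cong) auto
  moreover have "{y \<in> insert m T. y < m} = T" using insert by auto
  ultimately show ?case using insert m by (simp add: add.commute)
qed

text \<open>A hook is determined by its first letter and the color of that letter, since the rest is
  increasing and uncolored. A first letter of rank \<open>k\<close> and color \<open>a\<close> gives
  the exponent \<open>l * k + a\<close>, so the exponents are \<open>1, ..., l * card T - 1\<close>,
  each once.\<close>

lemma sum_hooks:
  fixes t :: real
  assumes "finite T" "T \<noteq> {}" "l \<ge> 1"
  shows "(1 - t) * (\<Sum>h\<in>hooks l T. t ^ (l * cinv h + colsum h)) = t - t ^ (l * card T)"
proof -
  define W where "W = (\<lambda>(x, a). (x, a::nat) # map (\<lambda>y. (y, 0::nat)) (sorted_list_of_set (T - {x})))"
  \<comment> \<open>The minimum with color 0 in front gives the increasing uncolored word, which is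
    not a hook.\<close>
  let ?D = "T \<times> {..<l} - {(Min T, 0)}"
  let ?f = "\<lambda>(x, a). t ^ (l * card {y \<in> T. y < x} + a)"
  have fstW: "map fst (W (x, a)) = x # sorted_list_of_set (T - {x})" for x a
    by (simp add: W_def comp_def)
  have bij: "bij_betw W ?D (hooks l T)"
    unfolding bij_betw_def
  proof
    show "inj_on W ?D" by (auto simp: inj_on_def W_def)
    show "W ` ?D = hooks l T"
    proof (intro equalityI subsetI)
      fix h assume "h \<in> W ` ?D"
      then obtain z where z: "h = W z" "z \<in> ?D" by blast
      obtain x a where xa: "z = (x, a)" by (cases z)
      have h: "h = W (x, a)" and x: "x \<in> T" "a < l" "(x, a) \<noteq> (Min T, 0)" using z unfolding xa by auto
      have "h \<in> colored_words l T"
      proof -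
        have "set (map fst h) = T" "distinct (map fst h)"
          unfolding h fstW using x(1) assms(1) by auto
        moreover have "\<forall>z\<in>set h. snd z < l" using x(2) assms(3) by (auto simp: h W_def)
        ultimately show ?thesis unfolding colored_words_def by blast
      qed
      moreover have "colored_hook h"
      proof (cases "x = Min T")
        case True
        then have a: "a > 0" using x by auto
        have "x < y" if "y \<in> T - {x}" for y
          using Min_le[OF assms(1), of y] that True by auto
        then have "sorted_wrt (<) (map fst h)"
          using assms unfolding h fstW by auto
        then show ?thesis using a by (auto simp: colored_hook_def h W_def)
      next
        case False
        have M: "Min T \<in> T - {x}" "Min T < x"
          using Min_le[OF assms(1) x(1)] Min_in[OF assms(1,2)] False by auto
        then obtain y ys where y: "sorted_list_of_set (T - {x}) = y # ys"
          using assms(1) by (cases "sorted_list_of_set (T - {x})") auto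
        have "set (y # ys) = T - {x}" using y assms(1)
          by (metis finite_Diff set_sorted_list_of_set)
        moreover have "sorted_wrt (<) (y # ys)" using y by (metis strict_sorted_list_of_set)
        ultimately have "y \<le> Min T" using M by (auto simp: less_imp_le)
        then have "is_hook (map fst h)"
          using M \<open>sorted_wrt (<) (y # ys)\<close> unfolding h fstW y is_hook_def by simp
        then show ?thesis using y by (auto simp: colored_hook_def h W_def)
      qed
      ultimately show "h \<in> hooks l T" by (simp add: hooks_def)
    next
      fix h assume h: "h \<in> hooks l T"
      then have ch: "colored_hook h" by (simp add: hooks_def)
      obtain x a g where hg: "h = (x, a) # g" using colored_hook_ne[OF ch] by (cases h) auto
      have g: "\<forall>z \<in> set g. snd z = 0" "sorted_wrt (<) (map fst g)"
        using colored_hook_tl[OF ch] by (simp_all add: hg)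
      have s: "set (map fst g) = T - {x}" "x \<in> T" "a < l"
        using h by (auto simp: hooks_def colored_words_def hg)
      then have "map fst g = sorted_list_of_set (T - {x})"
        using sorted_list_of_set_strict[OF g(2)] by simp
      moreover have "g = map (\<lambda>x. (x, 0)) (map fst g)"
        using g by (auto intro!: nth_equalityI prod_eqI)
      ultimately have "h = W (x, a)" by (simp add: W_def hg)
      moreover have "(x, a) \<noteq> (Min T, 0)"
      proof
        assume e: "(x, a) = (Min T, 0)"
        then have "is_hook (map fst h)" using ch by (auto simp: colored_hook_def hg)
        then obtain y where "y \<in> set (map fst g)" "y < x"
          by (cases g) (auto simp: is_hook_def hg)
        then show False using s e Min_le[OF assms(1), of y] by auto
      qed
      ultimately show "h \<in> W ` ?D" using s by (intro image_eqI[of _ _ "(x, a)"]) auto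
    qed
  qed
  have wt: "t ^ (l * cinv (W (x, a)) + colsum (W (x, a))) = t ^ (l * card {y \<in> T. y < x} + a)"
    if "x \<in> T" for x a
  proof -
    have "cinv (W (x, a)) = card {y \<in> T - {x}. y < x}"
      using assms(1) distinct_card[of "filter (\<lambda>y. y < x) (sorted_list_of_set (T - {x}))"]
      unfolding cinv_def fstW by (simp add: inv_word_Cons inv_word_increasing Collect_conj_eq Int_commute)
    moreover have "{y \<in> T - {x}. y < x} = {y \<in> T. y < x}" by auto
    moreover have "colsum (W (x, a)) = a" by (simp add: colsum_def W_def comp_def)
    ultimately show ?thesis by simp
  qed
  have "(\<Sum>h\<in>hooks l T. t ^ (l * cinv h + colsum h)) = (\<Sum>z\<in>?D. ?f z)"
    by (subst sum.reindex_bij_betw[OF bij, symmetric], rule sum.cong) (use wt in auto)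
  also have "\<dots> = (\<Sum>z\<in>T \<times> {..<l}. ?f z) - ?f (Min T, 0)"
    by (rule sum_diff1[THEN trans]) (use assms in auto)
  also have "?f (Min T, 0) = 1"
  proof -
    have "{y \<in> T. y < Min T} = {}" using assms by (auto simp: not_less)
    then have c0: "card {y \<in> T. y < Min T} = 0" by (simp only: card.empty)
    show ?thesis by (simp only: prod.case c0) simp
  qed
  also have "(\<Sum>z\<in>T \<times> {..<l}. ?f z) = (\<Sum>x\<in>T. (t ^ l) ^ card {y \<in> T. y < x}) * (\<Sum>a<l. t ^ a)"
    by (simp add: sum.cartesian_product[symmetric] sum_product power_add power_mult)
  also have "(\<Sum>x\<in>T. (t ^ l) ^ card {y \<in> T. y < x}) = (\<Sum>k<card T. (t ^ l) ^ k)"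
    by (rule sum_power_rank[OF assms(1)])
  finally have e: "(\<Sum>h\<in>hooks l T. t ^ (l * cinv h + colsum h)) =
      (\<Sum>k<card T. (t ^ l) ^ k) * (\<Sum>a<l. t ^ a) - 1" .
  have "(1 - t) * (\<Sum>h\<in>hooks l T. t ^ (l * cinv h + colsum h)) =
      (\<Sum>k<card T. (t ^ l) ^ k) * ((1 - t) * (\<Sum>a<l. t ^ a)) - (1 - t)"
    unfolding e by (simp only: right_diff_distrib mult.left_commute[of "1 - t"] mult_1_right)
  also have "(1 - t) * (\<Sum>a<l. t ^ a) = 1 - t ^ l" by (simp add: one_diff_power_eq)
  also have "(\<Sum>k<card T. (t ^ l) ^ k) * (1 - t ^ l) = 1 - (t ^ l) ^ card T"
    by (simp add: one_diff_power_eq mult.commute)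
  finally show ?thesis by (simp add: power_mult)
qed

section \<open>The factors \<open>1 / (q;q)_n\<close>, Gaussian binomials and the recurrence of the
  hook side\<close>

definition qexp :: "real \<Rightarrow> nat \<Rightarrow> real" where
  "qexp q n = (\<Prod>i<n. 1 / (1 - q ^ Suc i))"

lemma qexp_0 [simp]: "qexp q 0 = 1" by (simp add: qexp_def)
lemma qexp_Suc: "qexp q (Suc n) = qexp q n / (1 - q ^ Suc n)" by (simp add: qexp_def)

lemma one_minus_power_nz: "0 < q \<Longrightarrow> q < 1 \<Longrightarrow> 1 - q ^ Suc n \<noteq> (0::real)"
  using power_Suc_less_one[of q n] by auto

lemma qexp_nz: "0 < q \<Longrightarrow> q < 1 \<Longrightarrow> qexp q n \<noteq> 0"
  by (induction n) (use one_minus_power_nz in \<open>auto simp: qexp_Suc simp del: power_Suc\<close>)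

lemma cross_inv_insert_right:
  assumes "finite A" "finite T" "\<forall>x\<in>A. x < m"
  shows "cross_inv A (insert m T) = cross_inv A T"
  unfolding cross_inv_def using assms by (intro sum.cong arg_cong[of _ _ card]) auto

lemma cross_inv_insert_left:
  assumes "finite A" "finite T" "\<forall>x\<in>T. x < m" "m \<notin> A"
  shows "cross_inv (insert m A) T = card T + cross_inv A T"
proof -
  have "{y \<in> T. y < m} = T" using assms by auto
  then show ?thesis using assms by (simp add: cross_inv_def)
qed

text \<open>The right-hand side is the Gaussian binomial coefficient, and the induction is its
  Pascal rule: the maximum \<open>m\<close> lies either in \<open>T\<close> or in the
  complement.\<close>

lemma sum_cross_inv:
  assumes "finite S" "0 < q" "q < 1"
  shows "k \<le> card S \<Longrightarrow> (\<Sum>T | T \<subseteq> S \<and> card T = k. q ^ cross_inv (S - T) T)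
     = qexp q k * qexp q (card S - k) / qexp q (card S)"
  using assms(1)
proof (induction S arbitrary: k rule: finite_linorder_max_induct)
  case empty
  have "{T::nat set. T \<subseteq> {} \<and> card T = 0} = {{}}" by auto
  then show ?case using empty by (simp add: cross_inv_def)
next
  case (insert m S)
  let ?n = "card S"
  let ?P = "\<lambda>k. {T. T \<subseteq> S \<and> card T = k}"
  have m: "m \<notin> S" and lt: "\<forall>x\<in>S. x < m" using insert by auto
  have finT: "finite T" if "T \<subseteq> S" for T using that insert finite_subset by blast
  have card: "card (insert m S) = Suc ?n" using insert m by simp
  show ?case
  proof (cases k)
    case 0
    have "{T. T \<subseteq> insert m S \<and> card T = 0} = {{}}"
      using insert by (auto dest!: finite_subset)
    then show ?thesis using 0 qexp_nz[OF assms(2,3)] by (simp add: cross_inv_def)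
  next
    case (Suc j)
    \<comment> \<open>Here \<open>m\<close> is on the left and forms an inversion with each of the
      \<open>k\<close> letters of \<open>T\<close>.\<close>
    have A: "(\<Sum>T\<in>?P k. q ^ cross_inv (insert m S - T) T) = q ^ k * (\<Sum>T\<in>?P k. q ^ cross_inv (S - T) T)"
    proof -
      have "q ^ cross_inv (insert m S - T) T = q ^ k * q ^ cross_inv (S - T) T" if "T \<in> ?P k" for T
      proof -
        have "insert m S - T = insert m (S - T)" using that m by auto
        moreover have "cross_inv (insert m (S - T)) T = card T + cross_inv (S - T) T"
          by (rule cross_inv_insert_left) (use that m lt insert(1) finT[of T] in auto)
        ultimately show ?thesis using that by (simp add: power_add)
      qed
      then show ?thesis unfolding sum_distrib_left by (intro sum.cong) auto
    qed
    \<comment> \<open>Here \<open>m\<close> lies in the right block and is larger than every letter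
      on the left.\<close>
    have B: "(\<Sum>T\<in>insert m ` ?P j. q ^ cross_inv (insert m S - T) T) = (\<Sum>T\<in>?P j. q ^ cross_inv (S - T) T)"
    proof (subst sum.reindex)
      show "inj_on (insert m) (?P j)" using m by (auto simp: inj_on_def)
      show "sum ((\<lambda>T. q ^ cross_inv (insert m S - T) T) \<circ> insert m) (?P j) = (\<Sum>T\<in>?P j. q ^ cross_inv (S - T) T)"
      proof (rule sum.cong[OF refl])
        fix T assume T: "T \<in> ?P j"
        have "insert m S - insert m T = S - T" using m by auto
        then show "((\<lambda>T. q ^ cross_inv (insert m S - T) T) \<circ> insert m) T = q ^ cross_inv (S - T) T"
          using cross_inv_insert_right[of "S - T" T m] T finT insert(1) lt by auto
      qed
    qed
    have split: "{T. T \<subseteq> insert m S \<and> card T = k} = ?P k \<union> insert m ` ?P j" (is "?L = ?R")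
    proof (intro equalityI subsetI)
      fix T assume T: "T \<in> ?L"
      show "T \<in> ?R"
      proof (cases "m \<in> T")
        case True
        have "T - {m} \<in> ?P j" using T True Suc insert(1) by (auto simp: card_Diff_singleton)
        then show ?thesis using True by (auto intro!: image_eqI[of _ _ "T - {m}"])
      next
        case False
        then show ?thesis using T by auto
      qed
    next
      fix T assume "T \<in> ?R"
      then show "T \<in> ?L" using m Suc finT by (auto simp: card_insert_if)
    qed
    have "(\<Sum>T | T \<subseteq> insert m S \<and> card T = k. q ^ cross_inv (insert m S - T) T)
       = q ^ k * (\<Sum>T\<in>?P k. q ^ cross_inv (S - T) T) + (\<Sum>T\<in>?P j. q ^ cross_inv (S - T) T)"
      unfolding split A[symmetric] B[symmetric]
      by (rule sum.union_disjoint) (use insert(1) m in auto)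
    also have "\<dots> = qexp q k * qexp q (card (insert m S) - k) / qexp q (card (insert m S))"
    proof (cases "k \<le> ?n")
      case True
      then obtain i where i: "?n = k + i" by (metis le_iff_add)
      have e1: "qexp q k = qexp q j / (1 - q ^ k)" "qexp q (Suc i) = qexp q i / (1 - q ^ Suc i)"
         "qexp q (Suc ?n) = qexp q ?n / (1 - q ^ Suc ?n)"
        by (simp_all add: Suc qexp_Suc)
      have nz: "1 - q ^ k \<noteq> 0" "1 - q ^ Suc i \<noteq> 0" "1 - q ^ Suc ?n \<noteq> 0" "qexp q ?n \<noteq> 0"
        using one_minus_power_nz[OF assms(2,3)] qexp_nz[OF assms(2,3)] by (simp_all add: Suc del: power_Suc)
      have I1: "(\<Sum>T\<in>?P k. q ^ cross_inv (S - T) T) = qexp q k * qexp q i / qexp q ?n"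
        using insert.IH[of k] True i by simp
      have I2: "(\<Sum>T\<in>?P j. q ^ cross_inv (S - T) T) = qexp q j * qexp q (Suc i) / qexp q ?n"
        using insert.IH[of j] True i Suc by (simp add: Suc_diff_le)
      have sn: "Suc ?n - k = Suc i" using i by simp
      have qq: "q ^ Suc ?n = q ^ k * q ^ Suc i" by (simp add: i power_add)
      show ?thesis unfolding card I1 I2 sn e1 using nz unfolding qq
        by (simp add: divide_simps del: power_Suc) algebra
    next
      case False
      then have kn: "k = Suc ?n" "j = ?n" using insert.prems card Suc by auto
      have "card T \<noteq> k" if "T \<subseteq> S" for T using card_mono[OF insert(1) that] kn by simp
      then have z: "?P k = {}" by blast
      have "(\<Sum>T\<in>?P j. q ^ cross_inv (S - T) T) = 1"
        using insert.IH[of j] kn qexp_nz[OF assms(2,3)] by simp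
      then show ?thesis using kn qexp_nz[OF assms(2,3)] unfolding z card by simp
    qed
    finally show ?thesis .
  qed
qed

text \<open>This is the recurrence for words on \<open>S\<close>, multiplied by \<open>1 - t\<close>
  and grouped by the size \<open>m\<close> of the last hook. The grouping relies on the sum over
  words being a function of \<open>card S\<close>.\<close>

lemma hook_side_recurrence:
  fixes t r q :: real
  assumes "l \<ge> 1" "0 < q" "q < 1" and t: "t \<noteq> 1"
    and b: "\<And>n. b n = (\<Sum>w\<in>colored_words l {1..n}. hook_weight l t r q w)"
  shows "(\<Sum>m\<le>n. qexp q m * (t ^ (l * m) - t) * (qexp q (n - m) * b (n - m))) = (1 - t) * r ^ n * qexp q n"
    (is ?A)
proof -
  define B where "B S = (\<Sum>w\<in>colored_words l S. hook_weight l t r q w)" for S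
  note rec = sum_hook_weight_rec[OF _ assms(1), of _ t r q, folded B_def]
  \<comment> \<open>\<open>f\<close> stands for any function of the cardinality that describes
    \<open>B\<close> on the proper subsets of \<open>S\<close>. It is taken to be \<open>b\<close>,
    first inside the induction below and then once more for the result.\<close>
  have main: "(1 - t) * B S = (1 - t) * r ^ card S - (\<Sum>m=1..card S. (t ^ (l * m) - t) *
        (qexp q m * qexp q (card S - m) / qexp q (card S)) * f (card S - m))"
    if S: "finite S" and f: "\<And>T. T \<subset> S \<Longrightarrow> B T = f (card T)" for S f
  proof -
    have "(1 - t) * B S = (1 - t) * r ^ card S + (\<Sum>T\<in>Pow S - {{}}. q ^ cross_inv (S - T) T * B (S - T) *
       ((1 - t) * (\<Sum>h\<in>hooks l T. t ^ (l * cinv h + colsum h))))"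
      by (subst rec[OF S]) (simp add: algebra_simps sum_distrib_left)
    also have "(\<Sum>T\<in>Pow S - {{}}. q ^ cross_inv (S - T) T * B (S - T) *
       ((1 - t) * (\<Sum>h\<in>hooks l T. t ^ (l * cinv h + colsum h))))
       = (\<Sum>T\<in>Pow S - {{}}. q ^ cross_inv (S - T) T * (f (card S - card T) * (t - t ^ (l * card T))))"
    proof (rule sum.cong[OF refl])
      fix T assume T: "T \<in> Pow S - {{}}"
      have fT: "finite T" using T S finite_subset by blast
      have "S - T \<subset> S" using T by auto
      then have "B (S - T) = f (card S - card T)" using f[of "S - T"] T fT by (simp add: card_Diff_subset)
      moreover have "(1 - t) * (\<Sum>h\<in>hooks l T. t ^ (l * cinv h + colsum h)) = t - t ^ (l * card T)"
        using T fT by (intro sum_hooks) (use assms(1) in auto)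
      ultimately show "q ^ cross_inv (S - T) T * B (S - T) * ((1 - t) * (\<Sum>h\<in>hooks l T. t ^ (l * cinv h + colsum h)))
        = q ^ cross_inv (S - T) T * (f (card S - card T) * (t - t ^ (l * card T)))" by simp
    qed
    also have "\<dots> = (\<Sum>m=1..card S. \<Sum>T | T \<in> Pow S - {{}} \<and> card T = m.
         q ^ cross_inv (S - T) T * (f (card S - card T) * (t - t ^ (l * card T))))"
      by (rule sum.group[symmetric])
        (use S in \<open>auto simp: card_gt_0_iff card_mono Suc_le_eq dest: finite_subset\<close>)
    also have "\<dots> = (\<Sum>m=1..card S. - ((t ^ (l * m) - t) *
        (qexp q m * qexp q (card S - m) / qexp q (card S)) * f (card S - m)))"
    proof (rule sum.cong[OF refl])
      fix m assume m: "m \<in> {1..card S}"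
      have "{T. T \<in> Pow S - {{}} \<and> card T = m} = {T. T \<subseteq> S \<and> card T = m}" using m by auto
      then have "(\<Sum>T | T \<in> Pow S - {{}} \<and> card T = m. q ^ cross_inv (S - T) T * (f (card S - card T) * (t - t ^ (l * card T))))
        =  (\<Sum>T | T \<subseteq> S \<and> card T = m. q ^ cross_inv (S - T) T * (f (card S - m) * (t - t ^ (l * m))))"
        by (intro sum.cong) auto
      also have "\<dots> = (\<Sum>T | T \<subseteq> S \<and> card T = m. q ^ cross_inv (S - T) T) * (f (card S - m) * (t - t ^ (l * m)))"
        by (simp add: sum_distrib_right)
      also have "(\<Sum>T | T \<subseteq> S \<and> card T = m. q ^ cross_inv (S - T) T) = qexp q m * qexp q (card S - m) / qexp q (card S)"
        by (rule sum_cross_inv) (use S assms m in auto)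
      finally have e: "(\<Sum>T | T \<in> Pow S - {{}} \<and> card T = m. q ^ cross_inv (S - T) T * (f (card S - card T) * (t - t ^ (l * card T))))
         = qexp q m * qexp q (card S - m) / qexp q (card S) * (f (card S - m) * (t - t ^ (l * m)))" .
      show "(\<Sum>T | T \<in> Pow S - {{}} \<and> card T = m. q ^ cross_inv (S - T) T * (f (card S - card T) * (t - t ^ (l * card T))))
         = - ((t ^ (l * m) - t) * (qexp q m * qexp q (card S - m) / qexp q (card S)) * f (card S - m))"
      proof -
        have "X * (y * (a - b)) = - ((b - a) * X * y)" for X y a b :: real by (simp add: algebra_simps)
        then show ?thesis unfolding e .
      qed
    qed
    finally show ?thesis by (simp add: sum_negf)
  qed
  \<comment> \<open>By \<open>main\<close> the value on \<open>S\<close> is determined by values on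
    smaller sets, which by induction depend on the cardinality only, so \<open>S\<close> may be
    replaced by an initial segment. The factor \<open>1 - t\<close> cancels as \<open>t\<close> is
    not 1.\<close>
  have dep: "finite S \<Longrightarrow> B S = b (card S)" for S
  proof (induction "card S" arbitrary: S rule: less_induct)
    case less
    have *: "(1 - t) * B S' = (1 - t) * r ^ card S' - (\<Sum>m=1..card S'. (t ^ (l * m) - t) *
        (qexp q m * qexp q (card S' - m) / qexp q (card S')) * b (card S' - m))"
      if "finite S'" "card S' = card S" for S'
      by (rule main[OF that(1)]) (metis less.hyps that psubset_card_mono finite_subset psubset_imp_subset)
    have "(1 - t) * B S = (1 - t) * B {1..card S}"
      using *[of S] *[of "{1..card S}"] less.prems by simp
    then show ?case using t by (simp add: B_def b)
  qed
  have "(1 - t) * b n = (1 - t) * r ^ n - (\<Sum>m=1..n. (t ^ (l * m) - t) *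
        (qexp q m * qexp q (n - m) / qexp q n) * b (n - m))"
  proof -
    have "B T = b (card T)" if "T \<subset> {1..n}" for T
      by (rule dep) (use that finite_subset[of T "{1..n}"] in auto)
    moreover have "b n = B {1..n}" by (simp only: b B_def)
    ultimately show ?thesis using main[of "{1..n}" b] by simp
  qed
  then have "(1 - t) * b n * qexp q n = (1 - t) * r ^ n * qexp q n - (\<Sum>m=1..n. (t ^ (l * m) - t) *
        (qexp q m * qexp q (n - m) / qexp q n) * b (n - m)) * qexp q n"
    by (simp add: left_diff_distrib)
  also have "(\<Sum>m=1..n. (t ^ (l * m) - t) * (qexp q m * qexp q (n - m) / qexp q n) * b (n - m)) * qexp q n
     = (\<Sum>m=1..n. qexp q m * (t ^ (l * m) - t) * (qexp q (n - m) * b (n - m)))"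
    unfolding sum_distrib_right by (rule sum.cong) (use qexp_nz[OF assms(2,3)] in auto)
  finally have e: "(1 - t) * b n * qexp q n + (\<Sum>m=1..n. qexp q m * (t ^ (l * m) - t) * (qexp q (n - m) * b (n - m)))
      = (1 - t) * r ^ n * qexp q n" by linarith
  \<comment> \<open>The summand \<open>m = 0\<close> has the factor \<open>t ^ 0 - t\<close> and
    supplies the term with \<open>(1 - t) * b n\<close>.\<close>
  have "(\<Sum>m\<le>n. qexp q m * (t ^ (l * m) - t) * (qexp q (n - m) * b (n - m))) =
      (1 - t) * b n * qexp q n + (\<Sum>m=1..n. qexp q m * (t ^ (l * m) - t) * (qexp q (n - m) * b (n - m)))"
    by (simp add: atMost_atLeast0 sum.atLeast_Suc_atMost)
  then show ?A using e by (rule trans)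
qed

section \<open>Words counted by content\<close>

type_synonym mpoly = "nat multiset \<Rightarrow>\<^sub>0 real"

definition Cst :: "real \<Rightarrow> mpoly" where "Cst c = Poly_Mapping.single {#} c"
definition Mon :: "nat multiset \<Rightarrow> mpoly" where "Mon M = Poly_Mapping.single M 1"
abbreviation mcoeff :: "mpoly \<Rightarrow> nat multiset \<Rightarrow> real" where "mcoeff \<equiv> Poly_Mapping.lookup"
definition Var :: "nat \<Rightarrow> mpoly" where "Var x = Mon {#x#}"

lemma Cst_simps: "Cst 0 = 0" "Cst 1 = 1" "Cst (a + b) = Cst a + Cst b" "Cst (a - b) = Cst a - Cst b"
  "Cst (a * b) = Cst a * Cst b" "Cst (- a) = - Cst a"
  by (simp_all add: Cst_def single_add single_diff mult_single single_uminus flip: single_one)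

lemma Cst_power: "Cst (a ^ n) = Cst a ^ n"
  by (induction n) (simp_all add: Cst_simps)

lemma Cst_sum: "Cst (sum f A) = (\<Sum>x\<in>A. Cst (f x))"
  by (induction A rule: infinite_finite_induct) (simp_all add: Cst_simps)

lemma Cst_prod: "Cst (prod f A) = (\<Prod>x\<in>A. Cst (f x))"
  by (induction A rule: infinite_finite_induct) (simp_all add: Cst_simps)

lemma Mon_empty: "Mon {#} = 1" by (simp add: Mon_def flip: single_one zero_multiset_def)

lemma Mon_add: "Mon (K + M) = Mon K * Mon M" by (simp add: Mon_def mult_single)

lemma Mon_add_mset: "Mon (add_mset x K) = Var x * Mon K"
  using Mon_add[of "{#x#}" K] by (simp add: Var_def)

lemma Mon_replicate: "Mon (replicate_mset n x) = Var x ^ n"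
proof (induction n)
  case (Suc n)
  then show ?case using Mon_add_mset[of x "replicate_mset n x"] by simp
qed (simp add: Mon_empty)

lemma Mon_sum: "finite A \<Longrightarrow> Mon (\<Sum>x\<in>A. f x) = (\<Prod>x\<in>A. Mon (f x))"
  by (induction A rule: finite_induct) (simp_all add: Mon_empty Mon_add)

lemma single_eq: "Poly_Mapping.single M c = Cst c * Mon M"
  by (simp add: Cst_def Mon_def mult_single)

lemma lookup_single_times: "mcoeff (Poly_Mapping.single K c * p) (K + M) = c * mcoeff p M"
  for p :: mpoly
proof -
  have "mcoeff (Poly_Mapping.single K c * p) (K + M) =
     (\<Sum>l. (c * (\<Sum>q. mcoeff p q when K + M = l + q)) when l = K)"
    unfolding lookup_mult by (rule arg_cong[of _ _ Sum_any]) (auto simp: lookup_single when_def fun_eq_iff)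
  also have "\<dots> = c * mcoeff p M" by simp
  finally show ?thesis .
qed

lemma lookup_Cst_times: "mcoeff (Cst c * p) M = c * mcoeff p M"
  using lookup_single_times[of "{#}" c p M] by (simp add: Cst_def)

lemma lookup_Mon_times: "K \<subseteq># M \<Longrightarrow> mcoeff (Mon K * p) M = mcoeff p (M - K)"
  using lookup_single_times[of K 1 p "M - K"] by (simp add: Mon_def)

text \<open>Equality of polynomials after setting the variables outside \<open>B\<close> to zero.\<close>
definition agree :: "nat set \<Rightarrow> mpoly \<Rightarrow> mpoly \<Rightarrow> bool" where
  "agree B p p' \<longleftrightarrow> (\<forall>K. set_mset K \<subseteq> B \<longrightarrow> mcoeff p K = mcoeff p' K)"

lemma agree_refl: "agree B p p" by (simp add: agree_def)

text \<open>If a product of two monomials involves only variables in \<open>B\<close>, so do both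
  factors.\<close>

lemma agree_mult:
  assumes "agree B p p'" "agree B s s'"
  shows "agree B (p * s) (p' * s')"
  unfolding agree_def
proof (intro allI impI)
  fix K :: "nat multiset" assume K: "set_mset K \<subseteq> B"
  have "mcoeff p l * (\<Sum>q. mcoeff s q when K = l + q) = mcoeff p' l * (\<Sum>q. mcoeff s' q when K = l + q)" for l
  proof (cases "l \<subseteq># K")
    case True
    then have "set_mset l \<subseteq> B" using K set_mset_mono by blast
    moreover have "(mcoeff s q when K = l + q) = (mcoeff s' q when K = l + q)" for q
      using K assms(2) by (auto simp: agree_def when_def)
    ultimately show ?thesis using assms(1) by (simp add: agree_def)
  next
    case False
    then have "K \<noteq> l + q" for q by auto
    then show ?thesis by simp
  qed
  then show "mcoeff (p * s) K = mcoeff (p' * s') K" unfolding lookup_mult by simp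
qed

lemma agree_power: "agree B p p' \<Longrightarrow> agree B (p ^ n) (p' ^ n)"
  by (induction n) (simp_all add: agree_refl agree_mult)

lemma agree_prod: "(\<And>x. x \<in> A \<Longrightarrow> agree B (f x) (g x)) \<Longrightarrow> agree B (prod f A) (prod g A)"
  by (induction A rule: infinite_finite_induct) (simp_all add: agree_refl agree_mult)

section \<open>Multisets of bounded values and their generating functions\<close>

definition contents :: "nat \<Rightarrow> nat \<Rightarrow> nat multiset set" where
  "contents N n = {M. set_mset M \<subseteq> {..<N} \<and> size M = n}"

lemma contents_Suc: "contents (Suc N) n = (\<Union>i\<in>{..n}. (\<lambda>M. replicate_mset i N + M) ` contents N (n - i))"
proof (intro equalityI subsetI)
  fix M assume M: "M \<in> contents (Suc N) n"
  let ?i = "count M N"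
  define M' where "M' = filter_mset (\<lambda>x. x \<noteq> N) M"
  have dec: "M = replicate_mset ?i N + M'"
    by (rule multiset_eqI) (auto simp: M'_def)
  have "size M = ?i + size M'" by (subst dec) simp
  moreover have "set_mset M' \<subseteq> {..<N}" using M by (auto simp: contents_def M'_def less_Suc_eq)
  ultimately have "?i \<le> n" "M' \<in> contents N (n - ?i)" using M by (auto simp: contents_def)
  then show "M \<in> (\<Union>i\<in>{..n}. (\<lambda>M. replicate_mset i N + M) ` contents N (n - i))" using dec by blast
next
  fix M assume "M \<in> (\<Union>i\<in>{..n}. (\<lambda>M. replicate_mset i N + M) ` contents N (n - i))"
  then show "M \<in> contents (Suc N) n" by (auto simp: contents_def split: if_splits)
qed

lemma finite_contents: "finite (contents N n)"
proof (induction N arbitrary: n)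
  case 0
  have "contents 0 n \<subseteq> {{#}}" by (auto simp: contents_def)
  then show ?case by (rule finite_subset) simp
next
  case (Suc N)
  then show ?case by (simp add: contents_Suc)
qed

text \<open>The variable of value \<open>y\<close> is specialized to \<open>q^y\<close> times the
  formal variable. The bound \<open>N\<close> keeps the sums finite until a limit in
  \<open>N\<close> is taken.\<close>

definition content_gf :: "real \<Rightarrow> nat \<Rightarrow> (nat multiset \<Rightarrow> real) \<Rightarrow> real fps" where
  "content_gf q N f = Abs_fps (\<lambda>n. \<Sum>M\<in>contents N n. q ^ sum_mset M * f M)"

lemma finite_submultisets: "finite {I. I \<subseteq># (M :: 'a multiset)}"
proof -
  have "{I. I \<subseteq># M} \<subseteq> mset ` {xs. set xs \<subseteq> set_mset M \<and> length xs \<le> size M}"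
  proof
    fix I assume I: "I \<in> {I. I \<subseteq># M}"
    obtain xs where xs: "mset xs = I" using ex_mset by blast
    have "set xs = set_mset I" "length xs = size I" unfolding xs[symmetric] by simp_all
    then have "xs \<in> {xs. set xs \<subseteq> set_mset M \<and> length xs \<le> size M}"
      using I set_mset_mono[of I M] size_mset_mono[of I M] by simp
    then show "I \<in> mset ` {xs. set xs \<subseteq> set_mset M \<and> length xs \<le> size M}" using xs by blast
  qed
  then show ?thesis by (rule finite_subset) (intro finite_imageI finite_lists_length_le, simp)
qed

text \<open>Size and sum are additive in the multiset, so a sum over submultisets becomes a Cauchy
  product.\<close>

lemma content_gf_convolution:
  "content_gf q N (\<lambda>M. \<Sum>I | I \<subseteq># M. f I * g (M - I)) = content_gf q N f * content_gf q N g"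
proof (rule fps_ext)
  fix n
  let ?A = "SIGMA M : contents N n. {I. I \<subseteq># M}"
  let ?B = "SIGMA i : {0..n}. contents N i \<times> contents N (n - i)"
  have "fps_nth (content_gf q N (\<lambda>M. \<Sum>I | I \<subseteq># M. f I * g (M - I))) n =
     (\<Sum>(M, I)\<in>?A. q ^ sum_mset M * (f I * g (M - I)))"
    by (simp add: content_gf_def sum_distrib_left sum.Sigma finite_contents finite_submultisets)
  also have "\<dots> = (\<Sum>(i, I, K)\<in>?B. (q ^ sum_mset I * f I) * (q ^ sum_mset K * g K))"
  proof (rule sum.reindex_bij_witness[of _ "\<lambda>(i, I, K). (I + K, I)" "\<lambda>(M, I). (size I, I, M - I)"])
    fix z assume z: "z \<in> ?A"
    obtain M I where MI: "z = (M, I)" by (cases z)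
    have M: "M \<in> contents N n" "I \<subseteq># M" using z by (auto simp: MI)
    show "(case (case z of (M, I) \<Rightarrow> (size I, I, M - I)) of (i, I, K) \<Rightarrow> (I + K, I)) = z"
      using M by (simp add: MI)
    show "(case z of (M, I) \<Rightarrow> (size I, I, M - I)) \<in> ?B"
      using M size_mset_mono[of I M] set_mset_mono[of I M]
      by (auto simp: MI contents_def size_Diff_submset dest: in_diffD)
    have "sum_mset M = sum_mset I + sum_mset (M - I)"
      using M(2) by (metis subset_mset.add_diff_inverse sum_mset.union)
    then show "(case case z of (M, I) \<Rightarrow> (size I, I, M - I) of (i, I, K) \<Rightarrow> q ^ sum_mset I * f I * (q ^ sum_mset K * g K)) =
        (case z of (M, I) \<Rightarrow> q ^ sum_mset M * (f I * g (M - I)))"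
      by (simp add: MI power_add)
  next
    fix z assume z: "z \<in> ?B"
    then show "(case z of (i, I, K) \<Rightarrow> (I + K, I)) \<in> ?A" by (auto simp: contents_def)
    show "(case (case z of (i, I, K) \<Rightarrow> (I + K, I)) of (M, I) \<Rightarrow> (size I, I, M - I)) = z"
      using z by (auto simp: contents_def)
  qed
  also have "\<dots> = (\<Sum>i=0..n. \<Sum>(I, K)\<in>contents N i \<times> contents N (n - i). (q ^ sum_mset I * f I) * (q ^ sum_mset K * g K))"
    by (subst sum.Sigma) (simp_all add: finite_contents case_prod_unfold)
  also have "\<dots> = fps_nth (content_gf q N f * content_gf q N g) n"
    by (simp add: fps_mult_nth content_gf_def sum_product sum.cartesian_product)
  finally show "fps_nth (content_gf q N (\<lambda>M. \<Sum>I | I \<subseteq># M. f I * g (M - I))) n = fps_nth (content_gf q N f * content_gf q N g) n" .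
qed

text \<open>The series with coefficients \<open>e\<close>, evaluated at \<open>c\<close> times the
  formal variable.\<close>

definition scale :: "real \<Rightarrow> (nat \<Rightarrow> real) \<Rightarrow> real fps" where
  "scale c e = Abs_fps (\<lambda>n. c ^ n * e n)"

lemma scale_mult: "scale c e * scale c f = scale c (\<lambda>n. \<Sum>i=0..n. e i * f (n - i))"
proof (rule fps_ext)
  fix n
  have "c ^ i * e i * (c ^ (n - i) * f (n - i)) = c ^ n * (e i * f (n - i))" if "i \<le> n" for i
    using that power_add[of c i "n - i"] by (simp add: algebra_simps)
  then show "fps_nth (scale c e * scale c f) n = fps_nth (scale c (\<lambda>n. \<Sum>i=0..n. e i * f (n - i))) n"
    unfolding scale_def fps_mult_nth fps_nth_Abs_fps sum_distrib_left by (intro sum.cong) auto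
qed

text \<open>A coefficient that is a product over the values factors the generating function; the
  induction removes all copies of the largest value.\<close>

lemma content_gf_prod:
  "content_gf q N (\<lambda>M. \<Prod>y<N. e (count M y)) = (\<Prod>y<N. scale (q ^ y) e)"
proof (induction N)
  case 0
  have "contents 0 n = (if n = 0 then {{#}} else {})" for n by (auto simp: contents_def)
  then show ?case by (intro fps_ext) (simp add: content_gf_def)
next
  case (Suc N)
  have cnt: "count (replicate_mset i N + M) y = (if y = N then i else count M y)"
    if "M \<in> contents N k" "y \<le> N" for i y M k
  proof -
    have "N \<notin># M" using that by (auto simp: contents_def)
    then show ?thesis using that by (auto simp: not_in_iff)
  qed
  show ?case
  proof (rule fps_ext)
    fix n
    have "fps_nth (content_gf q (Suc N) (\<lambda>M. \<Prod>y<Suc N. e (count M y))) n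
      = (\<Sum>i\<le>n. \<Sum>M\<in>(\<lambda>M. replicate_mset i N + M) ` contents N (n - i). q ^ sum_mset M * (\<Prod>y<Suc N. e (count M y)))"
      unfolding content_gf_def fps_nth_Abs_fps contents_Suc
    proof (rule sum.UNION_disjoint)
      show "\<forall>i\<in>{..n}. \<forall>j\<in>{..n}. i \<noteq> j \<longrightarrow>
        (\<lambda>M. replicate_mset i N + M) ` contents N (n - i) \<inter> (\<lambda>M. replicate_mset j N + M) ` contents N (n - j) = {}"
      proof (intro ballI impI, rule ccontr)
        fix i j assume "i \<noteq> j" "(\<lambda>M. replicate_mset i N + M) ` contents N (n - i) \<inter> (\<lambda>M. replicate_mset j N + M) ` contents N (n - j) \<noteq> {}"
        then obtain M M' where "M \<in> contents N (n - i)" "M' \<in> contents N (n - j)"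
          "replicate_mset i N + M = replicate_mset j N + M'" by auto
        then show False using cnt[of M "n - i" N i] cnt[of M' "n - j" N j] \<open>i \<noteq> j\<close> by simp
      qed
    qed (simp_all add: finite_contents)
    also have "\<dots> = (\<Sum>i\<le>n. \<Sum>M\<in>contents N (n - i). (q ^ sum_mset M * (\<Prod>y<N. e (count M y))) * ((q ^ N) ^ i * e i))"
    proof (intro sum.cong[OF refl], subst sum.reindex)
      fix i assume "i \<in> {..n}"
      show "inj_on ((+) (replicate_mset i N)) (contents N (n - i))" by simp
      have "(\<Prod>y<N. e (count (replicate_mset i N + M) y)) = (\<Prod>y<N. e (count M y))" if "M \<in> contents N (n - i)" for M
        using cnt[OF that, of _ i] by (intro prod.cong) auto
      moreover have "count (replicate_mset i N + M) N = i" if "M \<in> contents N (n - i)" for M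
        using cnt[OF that, of N i] by simp
      moreover have "q ^ sum_mset (replicate_mset i N + M) = q ^ sum_mset M * (q ^ N) ^ i" for M
        by (simp add: power_add mult.commute flip: power_mult)
      ultimately show "sum ((\<lambda>M. q ^ sum_mset M * (\<Prod>y<Suc N. e (count M y))) \<circ> (+) (replicate_mset i N)) (contents N (n - i)) =
         (\<Sum>M\<in>contents N (n - i). (q ^ sum_mset M * (\<Prod>y<N. e (count M y))) * ((q ^ N) ^ i * e i))"
        by (intro sum.cong) (simp_all add: comp_def)
    qed
    also have "\<dots> = fps_nth (scale (q ^ N) e * content_gf q N (\<lambda>M. \<Prod>y<N. e (count M y))) n"
      by (simp add: fps_mult_nth content_gf_def scale_def sum_distrib_left sum_distrib_right mult_ac atLeast0AtMost)
    also have "\<dots> = fps_nth (\<Prod>y<Suc N. scale (q ^ y) e) n" by (simp add: Suc mult.commute)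
    finally show "fps_nth (content_gf q (Suc N) (\<lambda>M. \<Prod>y<Suc N. e (count M y))) n = fps_nth (\<Prod>y<Suc N. scale (q ^ y) e) n" .
  qed
qed

section \<open>Rows of letters over one value of the sorted word, and their polynomials\<close>

locale colors =
  fixes l :: nat and t r :: real
  assumes l_pos: "l \<ge> 1"
begin

text \<open>A letter \<open>z\<close> = (value, color) may stand at a position where the sorted word has value \<open>y\<close>. Sorted
  words are decreasing, so a letter of color \<open>l\<close>, which has to move to the right, needs \<open>y \<le> fst z\<close>.\<close>
definition letter_ok :: "nat \<Rightarrow> nat \<times> nat \<Rightarrow> bool" where
  "letter_ok y z \<longleftrightarrow> (snd z = l \<longrightarrow> y \<le> fst z) \<and> (snd z = 0 \<longrightarrow> fst z \<le> y)"

text \<open>A row lists the letters at the positions where the sorted word has value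
  \<open>y\<close>. A letter \<open>(y, l)\<close> has its sorted place in this same block, so it
  cannot have moved to the right if it stands first.\<close>

definition row_ok :: "nat \<Rightarrow> (nat \<times> nat) list \<Rightarrow> bool" where
  "row_ok y row \<longleftrightarrow> (\<forall>z\<in>set row. letter_ok y z) \<and> (row \<noteq> [] \<longrightarrow> hd row \<noteq> (y, l))"

text \<open>For admissible words the trailing letters \<open>(y, 0)\<close> will correspond to the
  fixed points in the block of \<open>y\<close>.\<close>

definition trail :: "nat \<Rightarrow> (nat \<times> nat) list \<Rightarrow> nat" where
  "trail y row = length (takeWhile (\<lambda>z. z = (y, 0)) (rev row))"

definition row_wt :: "nat \<Rightarrow> (nat \<times> nat) list \<Rightarrow> real" where
  "row_wt y row = (if row_ok y row then r ^ trail y row * t ^ sum_list (map snd row) else 0)"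

definition letters :: "nat \<Rightarrow> (nat \<times> nat) set" where
  "letters N = {..<N} \<times> {..l}"

definition words_over :: "nat \<Rightarrow> nat \<Rightarrow> (nat \<times> nat) list set" where
  "words_over N n = {V. set V \<subseteq> letters N \<and> length V = n}"

lemma finite_words_over: "finite (words_over N n)"
  unfolding words_over_def letters_def by (rule finite_lists_length_eq) simp

definition rowpoly :: "nat \<Rightarrow> nat \<Rightarrow> nat \<Rightarrow> mpoly" where
  "rowpoly N y m = (\<Sum>row\<in>words_over N m. Poly_Mapping.single (mset (map fst row)) (row_wt y row))"

definition letter_poly :: "nat \<Rightarrow> nat \<times> nat \<Rightarrow> mpoly" where
  "letter_poly y z = (if letter_ok y z then Cst (t ^ snd z) * Var (fst z) else 0)"

text \<open>The linear form \<open>L_y\<close>, restricted to the variables of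
  \<open>A\<close>.\<close>

definition row_form :: "nat set \<Rightarrow> nat \<Rightarrow> mpoly" where
  "row_form A y = (\<Sum>x\<in>A. \<Sum>c\<le>l. letter_poly y (x, c))"

lemma row_form_letters: "row_form {..<N} y = (\<Sum>z\<in>letters N. letter_poly y z)"
  by (simp add: row_form_def letters_def sum.cartesian_product)

lemma prod_letter_poly: "prod_list (map (letter_poly y) row) =
    (if \<forall>z\<in>set row. letter_ok y z then Cst (t ^ sum_list (map snd row)) * Mon (mset (map fst row)) else 0)"
  by (induction row) (auto simp: letter_poly_def Cst_simps Mon_empty Cst_power power_add Mon_add_mset mult_ac)

text \<open>Apart from the factor in front, which sees the first letter and the trail, the weight of
  a row is a product over its letters.\<close>

lemma single_row_wt: "Poly_Mapping.single (mset (map fst row)) (row_wt y row) =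
   Cst (if row \<noteq> [] \<and> hd row = (y, l) then 0 else r ^ trail y row) * prod_list (map (letter_poly y) row)"
  by (auto simp: prod_letter_poly row_wt_def row_ok_def single_eq Cst_simps)

lemma words_over_0: "words_over N 0 = {[]}" by (auto simp: words_over_def)

lemma words_over_Suc_Cons: "words_over N (Suc m) = (\<lambda>(z, row). z # row) ` (letters N \<times> words_over N m)"
proof (intro equalityI subsetI)
  fix V assume "V \<in> words_over N (Suc m)"
  then show "V \<in> (\<lambda>(z, row). z # row) ` (letters N \<times> words_over N m)"
    by (cases V) (auto simp: words_over_def)
qed (auto simp: words_over_def)

lemma words_over_Suc_snoc: "words_over N (Suc m) = (\<lambda>(row, z). row @ [z]) ` (words_over N m \<times> letters N)"
proof (intro equalityI subsetI)
  fix V assume "V \<in> words_over N (Suc m)"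
  then show "V \<in> (\<lambda>(row, z). row @ [z]) ` (words_over N m \<times> letters N)"
    by (cases V rule: rev_cases) (auto simp: words_over_def image_iff)
qed (auto simp: words_over_def)

lemma sum_words_over_Cons: "(\<Sum>V\<in>words_over N (Suc m). f V) = (\<Sum>z\<in>letters N. \<Sum>row\<in>words_over N m. f (z # row))"
  unfolding words_over_Suc_Cons by (subst sum.reindex) (auto simp: inj_on_def sum.cartesian_product case_prod_unfold)

lemma sum_words_over_snoc: "(\<Sum>V\<in>words_over N (Suc m). f V) = (\<Sum>row\<in>words_over N m. \<Sum>z\<in>letters N. f (row @ [z]))"
  unfolding words_over_Suc_snoc by (subst sum.reindex) (auto simp: inj_on_def sum.cartesian_product case_prod_unfold)

lemma sum_prod_letter_poly: "(\<Sum>row\<in>words_over N m. prod_list (map (letter_poly y) row)) = row_form {..<N} y ^ m"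
  by (induction m) (simp_all add: words_over_0 sum_words_over_Cons row_form_letters sum_distrib_left[symmetric] sum_distrib_right[symmetric])

lemma letter_poly_top: "letter_poly y (y, l) = Cst (t ^ l) * Var y"
  by (simp add: letter_poly_def letter_ok_def)
lemma letter_poly_bot: "letter_poly y (y, 0) = Var y"
  by (simp add: letter_poly_def letter_ok_def Cst_simps)

lemma finite_letters: "finite (letters N)" by (simp add: letters_def)

lemma sum_prod_letter_poly_hd:
  assumes "y < N"
  shows "(\<Sum>row\<in>words_over N (Suc m). Cst (if hd row = (y, l) then 0 else 1) * prod_list (map (letter_poly y) row))
     = (row_form {..<N} y - Cst (t ^ l) * Var y) * row_form {..<N} y ^ m"
proof -
  have yl: "(y, l) \<in> letters N" using assms by (simp add: letters_def)
  have "(\<Sum>row\<in>words_over N (Suc m). Cst (if hd row = (y, l) then 0 else 1) * prod_list (map (letter_poly y) row))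
    = (\<Sum>z\<in>letters N. Cst (if z = (y, l) then 0 else 1) * letter_poly y z) * row_form {..<N} y ^ m"
    by (simp add: sum_words_over_Cons mult.assoc[symmetric] sum_distrib_left[symmetric] sum_distrib_right[symmetric] sum_prod_letter_poly)
  also have "(\<Sum>z\<in>letters N. Cst (if z = (y, l) then 0 else 1) * letter_poly y z) = (\<Sum>z\<in>letters N - {(y, l)}. letter_poly y z)"
    by (rule sum.mono_neutral_cong_right) (auto simp: finite_letters Cst_simps)
  also have "\<dots> = row_form {..<N} y - Cst (t ^ l) * Var y"
    using yl by (simp add: sum_diff1 finite_letters row_form_letters letter_poly_top)
  finally show ?thesis .
qed

lemma trail_snoc: "trail y (row @ [z]) = (if z = (y, 0) then Suc (trail y row) else 0)"
  by (simp add: trail_def)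

lemma rowpoly_0: "rowpoly N y 0 = 1"
  by (simp add: rowpoly_def words_over_0 row_wt_def row_ok_def trail_def)

text \<open>If the last letter is \<open>(y, 0)\<close>, the trail grows by one and the condition on
  the first letter is unchanged. Otherwise the trail is empty; the first letter avoids
  \<open>(y, l)\<close> and the last one avoids \<open>(y, 0)\<close>. For \<open>m = 0\<close>
  these are the same letter.\<close>

lemma rowpoly_Suc:
  assumes "y < N"
  shows "rowpoly N y (Suc m) = Cst r * Var y * rowpoly N y m +
    (if m = 0 then row_form {..<N} y - Cst (t ^ l) * Var y - Var y
     else (row_form {..<N} y - Cst (t ^ l) * Var y) * row_form {..<N} y ^ (m - 1) * (row_form {..<N} y - Var y))"
proof -
  have y0: "(y, 0) \<in> letters N" using assms by (simp add: letters_def)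
  have yl: "(y, l) \<in> letters N" "(y, l) \<noteq> (y, 0)" using assms l_pos by (auto simp: letters_def)
  define h where "h V = Cst (if V \<noteq> [] \<and> hd V = (y, l) then 0 else 1)" for V :: "(nat \<times> nat) list"
  define P where "P V = prod_list (map (letter_poly y) V)" for V
  have s: "Poly_Mapping.single (mset (map fst V)) (row_wt y V) = h V * Cst r ^ trail y V * P V" for V
    unfolding single_row_wt P_def h_def by (auto simp: Cst_simps Cst_power)
  have hs: "h (V @ [z]) = (if V = [] then (if z = (y, l) then 0 else 1) else h V)" for V z
    by (auto simp: h_def Cst_simps)
  have Ps: "P (V @ [z]) = P V * letter_poly y z" for V z by (simp add: P_def)
  have h0: "h (V @ [(y, 0)]) = h V" for V using l_pos by (cases V) (auto simp: h_def Cst_simps)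
  have "rowpoly N y (Suc m) = (\<Sum>V\<in>words_over N m. \<Sum>z\<in>letters N. h (V @ [z]) * Cst r ^ trail y (V @ [z]) * P (V @ [z]))"
    by (simp only: rowpoly_def sum_words_over_snoc s)
  also have "\<dots> = (\<Sum>V\<in>words_over N m. h V * Cst r ^ Suc (trail y V) * (P V * Var y)
       + (\<Sum>z\<in>letters N - {(y, 0)}. h (V @ [z]) * (P V * letter_poly y z)))"
    by (rule sum.cong[OF refl], subst sum.remove[OF finite_letters y0])
      (rule arg_cong2[of _ _ _ _ "(+)"], simp add: trail_snoc Ps letter_poly_bot h0,
        rule sum.cong, auto simp: trail_snoc Ps mult.assoc)
  also have "\<dots> = Cst r * Var y * rowpoly N y m + (\<Sum>V\<in>words_over N m. \<Sum>z\<in>letters N - {(y, 0)}. h (V @ [z]) * (P V * letter_poly y z))"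
    unfolding rowpoly_def s by (simp add: sum.distrib sum_distrib_left mult_ac)
  also have "(\<Sum>V\<in>words_over N m. \<Sum>z\<in>letters N - {(y, 0)}. h (V @ [z]) * (P V * letter_poly y z)) =
    (if m = 0 then row_form {..<N} y - Cst (t ^ l) * Var y - Var y
     else (row_form {..<N} y - Cst (t ^ l) * Var y) * row_form {..<N} y ^ (m - 1) * (row_form {..<N} y - Var y))"
  proof (cases m)
    case 0
    have "(\<Sum>z\<in>letters N - {(y, 0)}. h ([] @ [z]) * (P [] * letter_poly y z)) = (\<Sum>z\<in>letters N - {(y, 0)} - {(y, l)}. letter_poly y z)"
      by (rule sum.mono_neutral_cong_right) (auto simp: finite_letters h_def P_def Cst_simps split: if_splits)
    also have "\<dots> = row_form {..<N} y - Cst (t ^ l) * Var y - Var y"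
      using yl y0 by (simp add: sum_diff1 finite_letters row_form_letters letter_poly_top letter_poly_bot)
    finally show ?thesis using 0 by (simp add: words_over_0)
  next
    case (Suc k)
    have "(\<Sum>z\<in>letters N - {(y, 0)}. letter_poly y z) = row_form {..<N} y - Var y"
      using y0 by (simp add: sum_diff1 finite_letters row_form_letters letter_poly_bot)
    moreover have "V \<noteq> []" if "V \<in> words_over N m" for V using that Suc by (auto simp: words_over_def)
    ultimately have "(\<Sum>V\<in>words_over N m. \<Sum>z\<in>letters N - {(y, 0)}. h (V @ [z]) * (P V * letter_poly y z)) =
       (\<Sum>V\<in>words_over N m. h V * P V) * (row_form {..<N} y - Var y)"
      unfolding sum_distrib_right
      by (intro sum.cong refl) (simp add: hs mult.assoc sum_distrib_left[symmetric])
    also have "(\<Sum>V\<in>words_over N m. h V * P V) = (row_form {..<N} y - Cst (t ^ l) * Var y) * row_form {..<N} y ^ k"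
      unfolding sum_prod_letter_poly_hd[OF assms, symmetric] Suc
      by (rule sum.cong) (auto simp: words_over_def h_def P_def)
    finally show ?thesis by (simp add: Suc)
  qed
  finally show ?thesis .
qed

text \<open>The coefficients of \<open>(1 - z)(1 - t^l z) / (1 - r z)\<close>.\<close>
fun row_coef :: "nat \<Rightarrow> real" where
  "row_coef 0 = 1"
| "row_coef (Suc 0) = r - 1 - t ^ l"
| "row_coef (Suc (Suc 0)) = r * (r - 1 - t ^ l) + t ^ l"
| "row_coef (Suc (Suc (Suc n))) = r * row_coef (Suc (Suc n))"

text \<open>With \<open>X = Var y\<close> and \<open>L\<close> the linear form, the recursion says
  that the series of the row polynomials by length is
  \<open>(1 - X x)(1 - t^l X x) / ((1 - r X x)(1 - L x))\<close>. The sum on the right is its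
  coefficient.\<close>

lemma rowpoly_eq:
  assumes "y < N"
  shows "rowpoly N y m = (\<Sum>i\<le>m. Cst (row_coef i) * Var y ^ i * row_form {..<N} y ^ (m - i))"
proof -
  let ?L = "row_form {..<N} y" and ?X = "Var y"
  define Q where "Q m = (\<Sum>i\<le>m. Cst (row_coef i) * ?X ^ i * ?L ^ (m - i))" for m
  have Q_L: "(\<Sum>i\<le>m. Cst (row_coef i) * ?X ^ i * ?L ^ (Suc m - i)) = ?L * Q m" for m
    by (simp add: Q_def sum_distrib_left Suc_diff_le mult_ac)
  have QS: "Q (Suc m) = ?L * Q m + Cst (row_coef (Suc m)) * ?X ^ Suc m" for m
    unfolding Q_L[symmetric] by (simp add: Q_def)
  have e: "Cst (row_coef (Suc (Suc (Suc n)))) = Cst r * Cst (row_coef (Suc (Suc n)))" for n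
    by (simp add: Cst_simps)
  have Q1: "Q 1 = ?L + (Cst r - 1 - Cst (t ^ l)) * ?X"
    by (simp add: Q_def Cst_simps)
  have Q0: "Q 0 = 1" by (simp add: Q_def Cst_simps)
  \<comment> \<open>The induction step uses that \<open>row_coef\<close> is geometric with ratio
    \<open>r\<close> from index 2 on.\<close>
  have Qrec: "Q (Suc (Suc k)) = Cst r * ?X * Q (Suc k) + (?L - Cst (t ^ l) * ?X) * ?L ^ k * (?L - ?X)" for k
  proof (induction k)
    case 0
    show ?case unfolding QS[of "Suc 0"] Q1[unfolded One_nat_def]
      by (simp add: Cst_simps algebra_simps power2_eq_square)
  next
    case (Suc k)
    have "Q (Suc (Suc (Suc k))) = ?L * Q (Suc (Suc k)) + Cst r * (Cst (row_coef (Suc (Suc k))) * ?X ^ Suc (Suc k)) * ?X"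
      unfolding QS[of "Suc (Suc k)"] e by (simp add: mult_ac)
    also have "Cst (row_coef (Suc (Suc k))) * ?X ^ Suc (Suc k) = Q (Suc (Suc k)) - ?L * Q (Suc k)"
      unfolding QS[of "Suc k"] by simp
    finally have "Q (Suc (Suc (Suc k))) = ?L * (Q (Suc (Suc k)) - Cst r * ?X * Q (Suc k)) + Cst r * ?X * Q (Suc (Suc k))"
      by (simp add: algebra_simps)
    also have "Q (Suc (Suc k)) - Cst r * ?X * Q (Suc k) = (?L - Cst (t ^ l) * ?X) * ?L ^ k * (?L - ?X)"
      using Suc by simp
    finally show ?case by (simp add: algebra_simps)
  qed
  have "rowpoly N y m = Q m"
  proof (induction m)
    case 0 then show ?case by (simp add: rowpoly_0 Q0)
  next
    case (Suc m)
    show ?case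
    proof (cases m)
      case 0
      then show ?thesis using Q1 by (simp add: rowpoly_Suc[OF assms] rowpoly_0 algebra_simps)
    next
      case (Suc k)
      then show ?thesis using Suc.IH Qrec[of k] by (simp add: rowpoly_Suc[OF assms])
    qed
  qed
  then show ?thesis by (simp add: Q_def)
qed

section \<open>MacMahon coefficients and their product identity\<close>

text \<open>The number of words of content \<open>M\<close> weighted as in the MacMahon master theorem.\<close>
definition phi :: "nat multiset \<Rightarrow> real" where
  "phi M = mcoeff (\<Prod>y\<in>set_mset M. row_form (set_mset M) y ^ count M y) M"

lemma agree_row_form:
  assumes "finite A" "B \<subseteq> A"
  shows "agree B (row_form A y) (row_form B y)"
  unfolding agree_def
proof (intro allI impI)
  fix K assume K: "set_mset K \<subseteq> B"
  have "mcoeff (letter_poly y (x, c)) K = 0" if "x \<in> A - B" for x c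
  proof -
    have "K \<noteq> {#x#}" using that K by auto
    then show ?thesis by (simp add: letter_poly_def lookup_Cst_times Var_def Mon_def lookup_single)
  qed
  then have "mcoeff (\<Sum>x\<in>A - B. \<Sum>c\<le>l. letter_poly y (x, c)) K = 0" by (simp add: lookup_sum)
  moreover have "row_form A y = (\<Sum>x\<in>A - B. \<Sum>c\<le>l. letter_poly y (x, c)) + row_form B y"
    unfolding row_form_def by (rule sum.subset_diff[OF assms(2,1)])
  ultimately show "mcoeff (row_form A y) K = mcoeff (row_form B y) K" by (simp add: lookup_add)
qed

text \<open>Variables outside \<open>M\<close> do not affect the coefficient of \<open>M\<close>,
  and values outside \<open>M\<close> contribute factors 1. So \<open>phi\<close> may be computed
  over any larger alphabet.\<close>

lemma phi_superset:
  assumes "finite A" "set_mset M \<subseteq> A" "set_mset M \<subseteq> Y" "finite Y"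
  shows "mcoeff (\<Prod>y\<in>Y. row_form A y ^ count M y) M = phi M"
proof -
  have "(\<Prod>y\<in>Y. row_form A y ^ count M y) = (\<Prod>y\<in>set_mset M. row_form A y ^ count M y)"
    by (rule prod.mono_neutral_right) (use assms in \<open>auto simp: not_in_iff\<close>)
  moreover have "agree (set_mset M) (\<Prod>y\<in>set_mset M. row_form A y ^ count M y) (\<Prod>y\<in>set_mset M. row_form (set_mset M) y ^ count M y)"
    by (intro agree_prod agree_power agree_row_form assms)
  ultimately show ?thesis by (simp add: phi_def agree_def)
qed

text \<open>Row \<open>y\<close> has as many letters as \<open>M\<close> has copies of
  \<open>y\<close>, and the extracted monomial is \<open>M\<close> again: the words counted are cut
  along their own sorted word.\<close>

definition alpha :: "nat \<Rightarrow> nat multiset \<Rightarrow> real" where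
  "alpha N M = mcoeff (\<Prod>y<N. rowpoly N y (count M y)) M"

text \<open>Expanding each row by \<open>rowpoly_eq\<close> chooses an exponent for every value.
  These exponents are the multiplicities of \<open>I\<close>, and what remains is the product that
  defines \<open>phi\<close> on \<open>M - I\<close>.\<close>

lemma alpha_convolution:
  assumes "set_mset M \<subseteq> {..<N}"
  shows "alpha N M = (\<Sum>I | I \<subseteq># M. (\<Prod>y<N. row_coef (count I y)) * phi (M - I))"
proof -
  let ?L = "row_form {..<N}"
  let ?F = "PiE {..<N} (\<lambda>y. {..count M y})"
  let ?m = "\<lambda>f. \<Sum>y<N. replicate_mset (f y) y"
  have cm: "count (?m f) y = (if y < N then f y else 0)" for f y
    by (simp add: count_sum)
  have sub: "?m f \<subseteq># M" if "f \<in> ?F" for f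
    using that unfolding subseteq_mset_def by (auto simp: cm PiE_def Pi_def)
  have "(\<Prod>y<N. rowpoly N y (count M y)) =
     (\<Prod>y<N. \<Sum>i\<in>{..count M y}. Cst (row_coef i) * Var y ^ i * ?L y ^ (count M y - i))"
    by (rule prod.cong) (simp_all add: rowpoly_eq)
  also have "\<dots> = (\<Sum>f\<in>?F. \<Prod>y<N. Cst (row_coef (f y)) * Var y ^ f y * ?L y ^ (count M y - f y))"
    by (rule prod_sum_PiE) auto
  also have "\<dots> = (\<Sum>f\<in>?F. Cst (\<Prod>y<N. row_coef (f y)) * (Mon (?m f) * (\<Prod>y<N. ?L y ^ count (M - ?m f) y)))"
    by (rule sum.cong[OF refl]) (simp add: prod.distrib Cst_prod Mon_sum Mon_replicate cm mult.assoc)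
  finally have "alpha N M = (\<Sum>f\<in>?F. (\<Prod>y<N. row_coef (f y)) * mcoeff (Mon (?m f) * (\<Prod>y<N. ?L y ^ count (M - ?m f) y)) M)"
    by (simp add: alpha_def lookup_sum lookup_Cst_times)
  also have "\<dots> = (\<Sum>f\<in>?F. (\<Prod>y<N. row_coef (f y)) * phi (M - ?m f))"
  proof (intro sum.cong[OF refl] arg_cong2[of _ _ _ _ "(*)"])
    fix f assume f: "f \<in> ?F"
    have "set_mset (M - ?m f) \<subseteq> {..<N}" using assms in_diffD by fast
    then show "mcoeff (Mon (?m f) * (\<Prod>y<N. ?L y ^ count (M - ?m f) y)) M = phi (M - ?m f)"
      by (subst lookup_Mon_times[OF sub[OF f]], intro phi_superset) auto
  qed simp
  also have "\<dots> = (\<Sum>I | I \<subseteq># M. (\<Prod>y<N. row_coef (count I y)) * phi (M - I))"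
  proof (rule sum.reindex_bij_witness[of _ "\<lambda>I. restrict (count I) {..<N}" ?m])
    fix f assume f: "f \<in> ?F"
    show "restrict (count (?m f)) {..<N} = f" using f by (auto simp: cm PiE_def extensional_def fun_eq_iff)
    show "?m f \<in> {I. I \<subseteq># M}" using sub[OF f] by simp
    show "(\<Prod>y<N. row_coef (count (?m f) y)) * phi (M - ?m f) = (\<Prod>y<N. row_coef (f y)) * phi (M - ?m f)"
      by (simp add: cm)
  next
    fix I assume I: "I \<in> {I. I \<subseteq># M}"
    show "restrict (count I) {..<N} \<in> ?F" using I by (auto simp: subseteq_mset_def)
    have "count I y = 0" if "\<not> y < N" for y
      using I that assms set_mset_mono[of I M] by (auto simp: not_in_iff[symmetric])
    then show "?m (restrict (count I) {..<N}) = I" by (intro multiset_eqI) (simp add: cm)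
  qed
  finally show ?thesis .
qed

text \<open>Expand the product on the right; \<open>S\<close> is the set of values whose factor
  contributes \<open>- g\<close> times its variable.\<close>

lemma phi_squarefree_convolution:
  "(\<Sum>S\<in>Pow (set_mset M). (- g) ^ card S * phi (M - mset_set S)) =
   mcoeff (\<Prod>y\<in>set_mset M. (row_form (set_mset M) y - Cst g * Var y) * row_form (set_mset M) y ^ (count M y - 1)) M"
proof -
  let ?A = "set_mset M" and ?L = "row_form (set_mset M)"
  have "(\<Prod>y\<in>?A. (?L y - Cst g * Var y) * ?L y ^ (count M y - 1)) =
     (\<Prod>y\<in>?A. Cst (- g) * Var y * ?L y ^ (count M y - 1) + ?L y ^ count M y)"
  proof (rule prod.cong[OF refl])
    fix y assume "y \<in> ?A"
    then have "?L y ^ count M y = ?L y * ?L y ^ (count M y - 1)"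
      by (cases "count M y") (auto simp: not_in_iff[symmetric])
    then show "(?L y - Cst g * Var y) * ?L y ^ (count M y - 1) = Cst (- g) * Var y * ?L y ^ (count M y - 1) + ?L y ^ count M y"
      by (simp add: algebra_simps Cst_simps)
  qed
  also have "\<dots> = (\<Sum>S\<in>Pow ?A. (\<Prod>y\<in>S. Cst (- g) * Var y * ?L y ^ (count M y - 1)) * (\<Prod>y\<in>?A - S. ?L y ^ count M y))"
    by (rule prod_add) simp
  also have "\<dots> = (\<Sum>S\<in>Pow ?A. Cst ((- g) ^ card S) * (Mon (mset_set S) * (\<Prod>y\<in>?A. ?L y ^ count (M - mset_set S) y)))"
  proof (rule sum.cong[OF refl])
    fix S assume S: "S \<in> Pow ?A"
    then have fin: "finite S" by (auto intro: finite_subset)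
    have "Mon (mset_set S) = (\<Prod>y\<in>S. Var y)"
      using fin by (induction S rule: finite_induct) (auto simp: Mon_empty Mon_add_mset)
    moreover have "(\<Prod>y\<in>?A. ?L y ^ count (M - mset_set S) y) = (\<Prod>y\<in>S. ?L y ^ (count M y - 1)) * (\<Prod>y\<in>?A - S. ?L y ^ count M y)"
      using S fin by (subst prod.subset_diff[of S]) (auto simp: mult.commute intro!: arg_cong2[of _ _ _ _ "(*)"] prod.cong)
    ultimately show "(\<Prod>y\<in>S. Cst (- g) * Var y * ?L y ^ (count M y - 1)) * (\<Prod>y\<in>?A - S. ?L y ^ count M y) =
       Cst ((- g) ^ card S) * (Mon (mset_set S) * (\<Prod>y\<in>?A. ?L y ^ count (M - mset_set S) y))"
      by (simp add: prod.distrib Cst_power mult_ac)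
  qed
  finally have "mcoeff (\<Prod>y\<in>?A. (?L y - Cst g * Var y) * ?L y ^ (count M y - 1)) M =
     (\<Sum>S\<in>Pow ?A. (- g) ^ card S * mcoeff (Mon (mset_set S) * (\<Prod>y\<in>?A. ?L y ^ count (M - mset_set S) y)) M)"
    by (simp add: lookup_sum lookup_Cst_times)
  also have "\<dots> = (\<Sum>S\<in>Pow ?A. (- g) ^ card S * phi (M - mset_set S))"
  proof (intro sum.cong[OF refl] arg_cong2[of _ _ _ _ "(*)"])
    fix S assume S: "S \<in> Pow ?A"
    then have fin: "finite S" by (auto intro: finite_subset)
    have sub: "mset_set S \<subseteq># M"
      unfolding subseteq_mset_def using S by (auto simp: count_mset_set' Suc_le_eq)
    have "set_mset (M - mset_set S) \<subseteq> ?A" using in_diffD by fast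
    then show "mcoeff (Mon (mset_set S) * (\<Prod>y\<in>?A. ?L y ^ count (M - mset_set S) y)) M = phi (M - mset_set S)"
      by (subst lookup_Mon_times[OF sub], intro phi_superset) auto
  qed simp
  finally show ?thesis by simp
qed

text \<open>The factor of \<open>y\<close> in the second product equals the factor of its successor
  in the first. Left over are the factor \<open>C\<close> of the minimum in the first product and
  the factor of the maximum in the second; naming the common part \<open>Q\<close> avoids a
  division.\<close>

lemma telescope:
  fixes C d :: "'b::comm_ring_1" and X :: "nat \<Rightarrow> 'b"
  assumes "finite B"
  shows "B \<noteq> {} \<Longrightarrow> \<exists>Q. (\<Prod>y\<in>B. C + d * (\<Sum>x | x \<in> B \<and> x < y. X x)) = C * Q \<and>
     (\<Prod>y\<in>B. C + d * (\<Sum>x | x \<in> B \<and> x \<le> y. X x)) = (C + d * (\<Sum>x\<in>B. X x)) * Q"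
  using assms
proof (induction B rule: finite_linorder_max_induct)
  case empty
  then show ?case by simp
next
  case (insert m B)
  have m: "m \<notin> B" using insert by auto
  have e1: "{x. x \<in> insert m B \<and> x < y} = {x. x \<in> B \<and> x < y}"
      "{x. x \<in> insert m B \<and> x \<le> y} = {x. x \<in> B \<and> x \<le> y}" if "y \<in> B" for y using insert(2) that by auto
  have e2: "{x. x \<in> insert m B \<and> x < m} = B" "{x. x \<in> insert m B \<and> x \<le> m} = insert m B"
    using insert(2) by auto
  let ?f = "\<Prod>y\<in>B. C + d * (\<Sum>x | x \<in> B \<and> x < y. X x)"
  let ?g = "\<Prod>y\<in>B. C + d * (\<Sum>x | x \<in> B \<and> x \<le> y. X x)"
  have f: "(\<Prod>y\<in>insert m B. C + d * (\<Sum>x | x \<in> insert m B \<and> x < y. X x)) = (C + d * sum X B) * ?f"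
    using insert(1) m by (simp add: e2 e1 del: insert_iff cong: prod.cong)
  have g: "(\<Prod>y\<in>insert m B. C + d * (\<Sum>x | x \<in> insert m B \<and> x \<le> y. X x)) = (C + d * sum X (insert m B)) * ?g"
    using insert(1) m by (simp add: e2 e1 del: insert_iff sum.insert cong: prod.cong)
  show ?case
  proof (cases "B = {}")
    case True
    show ?thesis unfolding f g by (intro exI[of _ 1]) (simp add: True)
  next
    case False
    then obtain Q where "?f = C * Q" "?g = (C + d * sum X B) * Q" using insert.IH by blast
    then show ?thesis unfolding f g by (intro exI[of _ "(C + d * sum X B) * Q"]) (simp add: mult_ac)
  qed
qed

text \<open>The colors allowed are \<open>0, ..., l - 1\<close> for \<open>x < y\<close>,
  \<open>1, ..., l\<close> for \<open>x > y\<close>, and all of \<open>0, ..., l\<close> for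
  \<open>x = y\<close>.\<close>

lemma sum_letter_poly:
  "(\<Sum>c\<le>l. letter_poly y (x, c)) = Cst (\<Sum>c<l. t ^ c) * (if x < y then 1 else Cst t) * Var x + (if x = y then Var x else 0)"
proof -
  let ?u = "\<Sum>c<l. t ^ c"
  have e: "(\<Sum>c\<le>l. letter_poly y (x, c)) = Cst (\<Sum>c | c \<le> l \<and> letter_ok y (x, c). t ^ c) * Var x"
  proof -
    have "(\<Sum>c\<le>l. letter_poly y (x, c)) = (\<Sum>c | c \<le> l \<and> letter_ok y (x, c). Cst (t ^ c) * Var x)"
      by (rule sum.mono_neutral_cong_right) (auto simp: letter_poly_def)
    then show ?thesis by (simp add: Cst_sum sum_distrib_right)
  qed
  have tu: "(\<Sum>c\<in>{1..l}. t ^ c) = t * ?u"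
    by (simp add: sum.atLeast1_atMost_eq sum_distrib_left)
  consider "x < y" | "x = y" | "y < x" by linarith
  then show ?thesis
  proof cases
    case 1
    then have "{c. c \<le> l \<and> letter_ok y (x, c)} = {..<l}" by (auto simp: letter_ok_def)
    then show ?thesis using 1 e by simp
  next
    case 2
    then have "{c. c \<le> l \<and> letter_ok y (x, c)} = insert 0 {1..l}" by (auto simp: letter_ok_def)
    then have "(\<Sum>c | c \<le> l \<and> letter_ok y (x, c). t ^ c) = 1 + t * ?u" using tu by simp
    then show ?thesis using 2 e by (simp add: Cst_simps algebra_simps)
  next
    case 3
    then have "{c. c \<le> l \<and> letter_ok y (x, c)} = {1..l}" by (auto simp: letter_ok_def)
    then show ?thesis using 3 e tu by (simp add: Cst_simps mult_ac)
  qed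
qed

lemma row_form_eq:
  assumes "finite A" "y \<in> A"
  shows "row_form A y = Cst (\<Sum>c<l. t ^ c) * (Cst t * (\<Sum>x\<in>A. Var x) + (1 - Cst t) * (\<Sum>x | x \<in> A \<and> x < y. Var x)) + Var y"
proof -
  let ?u = "Cst (\<Sum>c<l. t ^ c)"
  have "row_form A y = (\<Sum>x\<in>A. ?u * (Cst t * Var x + (if x < y then (1 - Cst t) * Var x else 0)) + (if x = y then Var x else 0))"
    unfolding row_form_def sum_letter_poly by (rule sum.cong) (auto simp: algebra_simps)
  also have "\<dots> = ?u * (Cst t * (\<Sum>x\<in>A. Var x) + (\<Sum>x\<in>A. if x < y then (1 - Cst t) * Var x else 0)) + Var y"
    using assms by (simp add: sum.distrib sum_distrib_left distrib_left)
  also have "(\<Sum>x\<in>A. if x < y then (1 - Cst t) * Var x else 0) = (1 - Cst t) * (\<Sum>x | x \<in> A \<and> x < y. Var x)"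
    unfolding sum_distrib_left using assms(1) by (rule sum.inter_filter[symmetric])
  finally show ?thesis .
qed

text \<open>The factor of \<open>y\<close> on the right is the factor of its successor in \<open>A\<close> on the left.\<close>
lemma prod_row_form_telescope:
  assumes "finite A" "A \<noteq> {}"
  shows "(\<Prod>y\<in>A. row_form A y - Var y) = Cst t * (\<Prod>y\<in>A. row_form A y - Cst (t ^ l) * Var y)"
proof -
  let ?u = "Cst (\<Sum>c<l. t ^ c)" and ?C = "Cst t * (\<Sum>x\<in>A. Var x)" and ?d = "1 - Cst t"
  obtain Q where Q: "(\<Prod>y\<in>A. ?C + ?d * (\<Sum>x | x \<in> A \<and> x < y. Var x)) = ?C * Q"
     "(\<Prod>y\<in>A. ?C + ?d * (\<Sum>x | x \<in> A \<and> x \<le> y. Var x)) = (?C + ?d * (\<Sum>x\<in>A. Var x)) * Q"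
    using telescope[OF assms] by blast
  have f: "(\<Prod>y\<in>A. row_form A y - Var y) = ?u ^ card A * (?C * Q)"
    unfolding Q(1)[symmetric] prod_constant[symmetric] prod.distrib[symmetric]
    by (rule prod.cong) (simp_all add: row_form_eq[OF assms(1)])
  \<comment> \<open>This relation writes \<open>Var y\<close> minus \<open>t^l\<close> times it as
    \<open>?u\<close> times \<open>1 - t\<close> times \<open>Var y\<close>, which completes the sum
    over \<open>x < y\<close> to one over \<open>x \<le> y\<close>.\<close>
  have ut: "(1 - t) * (\<Sum>c<l. t ^ c) = 1 - t ^ l" by (simp add: one_diff_power_eq)
  have "Cst ((1 - t) * (\<Sum>c<l. t ^ c)) = Cst (1 - t ^ l)" by (simp only: ut)
  then have ut': "?u - Cst t * ?u = 1 - Cst (t ^ l)"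
    by (simp add: Cst_simps left_diff_distrib)
  have g: "(\<Prod>y\<in>A. row_form A y - Cst (t ^ l) * Var y) = ?u ^ card A * ((?C + ?d * (\<Sum>x\<in>A. Var x)) * Q)"
    unfolding Q(2)[symmetric] prod_constant[symmetric] prod.distrib[symmetric]
  proof (rule prod.cong[OF refl])
    fix y assume y: "y \<in> A"
    have "{x. x \<in> A \<and> x \<le> y} = insert y {x. x \<in> A \<and> x < y}" using y by auto
    then have s: "(\<Sum>x | x \<in> A \<and> x \<le> y. Var x) = Var y + (\<Sum>x | x \<in> A \<and> x < y. Var x)"
      using assms(1) by simp
    have "Var y - Cst (t ^ l) * Var y = (?u - Cst t * ?u) * Var y" unfolding ut' by (simp add: algebra_simps)
    then show "row_form A y - Cst (t ^ l) * Var y = ?u * (?C + ?d * (\<Sum>x | x \<in> A \<and> x \<le> y. Var x))"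
      unfolding row_form_eq[OF assms(1) y] s by (simp add: algebra_simps)
  qed
  \<comment> \<open>With \<open>s\<close> the sum of all variables, \<open>?C + ?d * s\<close> is
    \<open>s\<close>, while \<open>?C\<close> is \<open>Cst t * s\<close>.\<close>
  show ?thesis unfolding f g by (simp add: algebra_simps)
qed

text \<open>By \<open>phi_squarefree_convolution\<close> both sums are coefficients of products,
  which share the powers of the linear forms; the remaining factors are compared by
  \<open>prod_row_form_telescope\<close>. For empty \<open>M\<close> both sums are 1.\<close>

lemma phi_identity:
  "(\<Sum>S\<in>Pow (set_mset M). (- 1) ^ card S * phi (M - mset_set S)) - t * (\<Sum>S\<in>Pow (set_mset M). (- (t ^ l)) ^ card S * phi (M - mset_set S))
    = (if M = {#} then 1 - t else 0)"
proof (cases "M = {#}")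
  case True
  then show ?thesis by (simp add: phi_def)
next
  case False
  have "(\<Prod>y\<in>set_mset M. row_form (set_mset M) y - Cst 1 * Var y) = Cst t * (\<Prod>y\<in>set_mset M. row_form (set_mset M) y - Cst (t ^ l) * Var y)"
    using prod_row_form_telescope[of "set_mset M"] False by (simp add: Cst_simps)
  then show ?thesis
    unfolding phi_squarefree_convolution prod.distrib using False
    by (simp add: mult.assoc lookup_Cst_times)
qed

section \<open>Evaluation of the generating function of \<open>alpha\<close>\<close>

definition elem_coef :: "real \<Rightarrow> nat \<Rightarrow> real" where
  "elem_coef s n = (if n = 0 then 1 else if n = 1 then - s else 0)"

text \<open>The second factor is the product of the polynomials \<open>1 - s q^y x\<close>. It is
  supported on submultisets without repetition, that is, on sets \<open>S\<close>.\<close>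

lemma content_gf_phi_elem_coef:
  "content_gf q N phi * (\<Prod>y<N. scale (q ^ y) (elem_coef s)) =
    content_gf q N (\<lambda>M. \<Sum>S\<in>Pow (set_mset M). (- s) ^ card S * phi (M - mset_set S))"
proof -
  have "content_gf q N phi * (\<Prod>y<N. scale (q ^ y) (elem_coef s)) = content_gf q N (\<lambda>M. \<Sum>I | I \<subseteq># M. (\<Prod>y<N. elem_coef s (count I y)) * phi (M - I))"
    unfolding content_gf_convolution[of q N "\<lambda>I. \<Prod>y<N. elem_coef s (count I y)" phi] content_gf_prod by (rule mult.commute)
  also have "\<dots> = content_gf q N (\<lambda>M. \<Sum>S\<in>Pow (set_mset M). (- s) ^ card S * phi (M - mset_set S))"
  proof (rule fps_ext, unfold content_gf_def fps_nth_Abs_fps, intro sum.cong[OF refl] arg_cong2[of _ _ _ _ "(*)"])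
    fix n M assume M: "M \<in> contents N n"
    have fS: "finite S" if "S \<subseteq> set_mset M" for S using that finite_subset by blast
    have p: "(\<Prod>y<N. elem_coef s (count (mset_set S) y)) = (- s) ^ card S" if S: "S \<subseteq> set_mset M" for S
    proof -
      have "(\<Prod>y<N. elem_coef s (count (mset_set S) y)) = (\<Prod>y\<in>S. - s)"
        by (rule prod.mono_neutral_cong_right) (use S M fS[OF S] in \<open>auto simp: elem_coef_def contents_def count_mset_set'\<close>)
      then show ?thesis by simp
    qed
    have inj: "inj_on mset_set (Pow (set_mset M))"
      by (rule inj_onI) (metis PowD fS finite_set_mset_mset_set)
    have im: "mset_set ` Pow (set_mset M) \<subseteq> {I. I \<subseteq># M}"
      by (auto simp: subseteq_mset_def count_mset_set' Suc_le_eq)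
    have z: "(\<Prod>y<N. elem_coef s (count I y)) = 0" if "I \<in> {I. I \<subseteq># M} - mset_set ` Pow (set_mset M)" for I
    proof -
      have "\<exists>y. count I y > 1"
      proof (rule ccontr)
        assume "\<nexists>y. count I y > 1"
        then have "count I y \<le> 1" for y by (simp add: not_less)
        then have "I = mset_set (set_mset I)"
          by (intro multiset_eqI) (auto simp: count_mset_set' not_in_iff intro!: antisym simp flip: Suc_le_eq)
        moreover have "set_mset I \<subseteq> set_mset M" using that set_mset_mono by blast
        ultimately show False using that by blast
      qed
      then obtain y where y: "count I y > 1" by blast
      then have "y \<in># I" by (metis count_greater_zero_iff gr_implies_not0 neq0_conv)
      have yN: "y < N" using \<open>y \<in># I\<close> that M set_mset_mono[of I M] by (auto simp: contents_def)
      have "elem_coef s (count I y) = 0" using y by (simp add: elem_coef_def)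
      then show ?thesis using yN by (meson finite_lessThan lessThan_iff prod_zero)
    qed
    have "(\<Sum>I | I \<subseteq># M. (\<Prod>y<N. elem_coef s (count I y)) * phi (M - I)) =
       (\<Sum>I\<in>mset_set ` Pow (set_mset M). (\<Prod>y<N. elem_coef s (count I y)) * phi (M - I))"
      by (rule sum.mono_neutral_right[OF finite_submultisets im]) (use z in auto)
    also have "\<dots> = (\<Sum>S\<in>Pow (set_mset M). (- s) ^ card S * phi (M - mset_set S))"
      by (subst sum.reindex[OF inj]) (auto simp: p)
    finally show "(\<Sum>I | I \<subseteq># M. (\<Prod>y<N. elem_coef s (count I y)) * phi (M - I)) =
       (\<Sum>S\<in>Pow (set_mset M). (- s) ^ card S * phi (M - mset_set S))" .
  qed simp
  finally show ?thesis .
qed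

text \<open>The product of the series \<open>1 / (1 - s q^y x)\<close>, which generates complete
  homogeneous symmetric polynomials.\<close>

definition complete_gf :: "real \<Rightarrow> nat \<Rightarrow> real \<Rightarrow> real fps" where
  "complete_gf q N s = (\<Prod>y<N. scale (q ^ y) (\<lambda>n. s ^ n))"

lemma complete_gf_nth: "fps_nth (complete_gf q N s) n = s ^ n * (\<Sum>M\<in>contents N n. q ^ sum_mset M)"
proof -
  have "(\<Prod>y<N. s ^ count M y) = s ^ n" if "M \<in> contents N n" for M
  proof -
    have "(\<Sum>y<N. count M y) = size M"
      unfolding size_multiset_overloaded_eq
      by (rule sum.mono_neutral_right) (use that in \<open>auto simp: contents_def not_in_iff\<close>)
    then show ?thesis using that by (simp add: contents_def flip: power_sum)
  qed
  then show ?thesis unfolding complete_gf_def content_gf_prod[symmetric] by (simp add: content_gf_def sum_distrib_left mult.commute)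
qed

lemma scale_elem_coef_geom: "scale c (elem_coef s) * scale c (\<lambda>n. s ^ n) = 1"
proof -
  have "(\<Sum>i=0..n. elem_coef s i * s ^ (n - i)) = (if n = 0 then 1 else 0)" for n
  proof (cases n)
    case (Suc k)
    have "(\<Sum>i=0..n. elem_coef s i * s ^ (n - i)) = (\<Sum>i\<in>{0,1}. elem_coef s i * s ^ (n - i))"
      by (rule sum.mono_neutral_right) (auto simp: elem_coef_def Suc)
    then show ?thesis by (simp add: elem_coef_def Suc)
  qed (simp add: elem_coef_def)
  then show ?thesis unfolding scale_mult by (intro fps_ext) (simp add: scale_def)
qed

lemma elem_complete_gf: "(\<Prod>y<N. scale (q ^ y) (elem_coef s)) * complete_gf q N s = 1"
  by (simp add: complete_gf_def scale_elem_coef_geom flip: prod.distrib)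

text \<open>The description of \<open>row_coef\<close> as a fraction, with the denominator
  multiplied out.\<close>

lemma scale_row_coef: "scale c row_coef * scale c (elem_coef r) = scale c (elem_coef 1) * scale c (elem_coef (t ^ l))"
proof -
  have e: "(\<Sum>i=0..n. f i * elem_coef s (n - i)) = f n - (if n = 0 then 0 else s * f (n - 1))" for n s and f :: "nat \<Rightarrow> real"
  proof (cases n)
    case (Suc k)
    have "(\<Sum>i=0..n. f i * elem_coef s (n - i)) = (\<Sum>i\<in>{n, k}. f i * elem_coef s (n - i))"
      by (rule sum.mono_neutral_right) (auto simp: elem_coef_def Suc)
    then show ?thesis by (simp add: elem_coef_def Suc)
  qed (simp add: elem_coef_def)
  have "row_coef n - (if n = 0 then 0 else r * row_coef (n - 1)) = elem_coef 1 n - (if n = 0 then 0 else t ^ l * elem_coef 1 (n - 1))" for n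
    by (cases n rule: row_coef.cases) (auto simp: elem_coef_def)
  then show ?thesis unfolding scale_mult e by simp
qed

text \<open>By \<open>alpha_convolution\<close> the series is \<open>?E * ?Phi\<close>, and
  \<open>?E\<close> is \<open>?P 1 * ?P (t ^ l)\<close> divided by \<open>?P r\<close>. Multiplying
  by the inverses \<open>?H\<close> of the products \<open>?P\<close> reduces the claim to
  \<open>phi_identity\<close>.\<close>

theorem content_gf_alpha:
  "content_gf q N (alpha N) * (complete_gf q N (t ^ l) - fps_const t * complete_gf q N 1) = fps_const (1 - t) * complete_gf q N r"
proof -
  let ?P = "\<lambda>s. \<Prod>y<N. scale (q ^ y) (elem_coef s)" and ?H = "complete_gf q N"
  let ?E = "\<Prod>y<N. scale (q ^ y) row_coef" and ?Phi = "content_gf q N phi"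
  have A: "content_gf q N (alpha N) = ?E * ?Phi"
    unfolding content_gf_prod[symmetric] content_gf_convolution[symmetric]
    by (intro fps_ext) (simp add: content_gf_def contents_def alpha_convolution)
  have E: "?E * ?P r = ?P 1 * ?P (t ^ l)"
    by (simp add: scale_row_coef flip: prod.distrib)
  then have E': "?E = ?P 1 * ?P (t ^ l) * ?H r"
    using elem_complete_gf[where N = N and q = q and s = r] by (metis mult.assoc mult.right_neutral)
  \<comment> \<open>This is \<open>phi_identity\<close>, summed over all contents.\<close>
  have id: "?Phi * ?P 1 - fps_const t * (?Phi * ?P (t ^ l)) = fps_const (1 - t)"
  proof (rule fps_ext)
    fix n
    let ?U = "\<lambda>s M. \<Sum>S\<in>Pow (set_mset M). (- s) ^ card S * phi (M - mset_set S)"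
    have "fps_nth (?Phi * ?P 1 - fps_const t * (?Phi * ?P (t ^ l))) n = (\<Sum>M\<in>contents N n. q ^ sum_mset M * (?U 1 M - t * ?U (t ^ l) M))"
      unfolding content_gf_phi_elem_coef
      by (simp add: content_gf_def sum_distrib_left right_diff_distrib sum_subtractf mult_ac)
    also have "\<dots> = (\<Sum>M\<in>contents N n. q ^ sum_mset M * (if M = {#} then 1 - t else 0))"
      by (simp only: phi_identity)
    also have "\<dots> = (\<Sum>M\<in>contents N n \<inter> {{#}}. 1 - t)"
      by (rule sum.mono_neutral_cong_right) (auto simp: finite_contents)
    also have "\<dots> = fps_nth (fps_const (1 - t)) n"
      by (auto simp: contents_def)
    finally show "fps_nth (?Phi * ?P 1 - fps_const t * (?Phi * ?P (t ^ l))) n = fps_nth (fps_const (1 - t)) n" .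
  qed
  have "content_gf q N (alpha N) * (?H (t ^ l) - fps_const t * ?H 1) =
     ?H r * (?Phi * ?P 1 * (?P (t ^ l) * ?H (t ^ l)) - fps_const t * (?Phi * ?P (t ^ l)) * (?P 1 * ?H 1))"
    unfolding A E' by (simp add: algebra_simps)
  also have "\<dots> = ?H r * fps_const (1 - t)" unfolding elem_complete_gf using id by simp
  finally show ?thesis by (simp add: mult.commute)
qed

section \<open>From products of rows to sums over words\<close>

fun rows_wt :: "(nat \<Rightarrow> nat) \<Rightarrow> nat list \<Rightarrow> (nat \<times> nat) list \<Rightarrow> real" where
  "rows_wt m [] V = 1"
| "rows_wt m (y # ys) V = row_wt y (take (m y) V) * rows_wt m ys (drop (m y) V)"

lemma prod_rowpoly:
  "prod_list (map (\<lambda>y. rowpoly N y (m y)) ys) =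
   (\<Sum>V\<in>words_over N (sum_list (map m ys)). Poly_Mapping.single (mset (map fst V)) (rows_wt m ys V))"
proof (induction ys)
  case Nil
  then show ?case by (simp add: words_over_0)
next
  case (Cons y ys)
  let ?k = "sum_list (map m ys)"
  have "prod_list (map (\<lambda>y. rowpoly N y (m y)) (y # ys)) =
     rowpoly N y (m y) * (\<Sum>V\<in>words_over N ?k. Poly_Mapping.single (mset (map fst V)) (rows_wt m ys V))"
    by (simp add: Cons)
  also have "\<dots> = (\<Sum>(U, V)\<in>words_over N (m y) \<times> words_over N ?k. Poly_Mapping.single (mset (map fst (U @ V))) (row_wt y U * rows_wt m ys V))"
    by (simp add: rowpoly_def sum_product sum.cartesian_product mult_single case_prod_unfold)
  also have "\<dots> = (\<Sum>V\<in>words_over N (m y + ?k). Poly_Mapping.single (mset (map fst V)) (rows_wt m (y # ys) V))"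
    by (rule sum.reindex_bij_witness[of _ "\<lambda>V. (take (m y) V, drop (m y) V)" "\<lambda>(U, V). U @ V"])
      (auto simp: words_over_def dest: in_set_takeD in_set_dropD simp flip: mset_append map_append)
  finally show ?case by simp
qed

text \<open>The row lengths are taken from the content of \<open>V\<close> itself, and the rows run
  from the largest value down, as in the sorted word.\<close>

definition word_wt :: "nat \<Rightarrow> (nat \<times> nat) list \<Rightarrow> real" where
  "word_wt N V = rows_wt (count (mset (map fst V))) (rev [0..<N]) V"

text \<open>Extracting the coefficient of \<open>M\<close> keeps the words of content
  \<open>M\<close>, and on those the row lengths \<open>count M\<close> are the ones used by
  \<open>word_wt\<close>.\<close>

lemma alpha_words:
  assumes "M \<in> contents N n"
  shows "alpha N M = (\<Sum>V | V \<in> words_over N n \<and> mset (map fst V) = M. word_wt N V)"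
proof -
  have len: "sum_list (map (count M) (rev [0..<N])) = n"
  proof -
    have "sum_list (map (count M) (rev [0..<N])) = (\<Sum>y<N. count M y)"
      by (simp add: sum_list_distinct_conv_sum_set atLeast0LessThan)
    also have "\<dots> = size M"
      unfolding size_multiset_overloaded_eq
      by (rule sum.mono_neutral_right) (use assms in \<open>auto simp: contents_def not_in_iff\<close>)
    finally show ?thesis using assms by (simp add: contents_def)
  qed
  have "(\<Prod>y<N. rowpoly N y (count M y)) = prod_list (map (\<lambda>y. rowpoly N y (count M y)) (rev [0..<N]))"
    by (simp add: prod.distinct_set_conv_list atLeast0LessThan[symmetric] flip: prod.distinct_set_conv_list)
  then have "alpha N M = (\<Sum>V\<in>words_over N n. mcoeff (Poly_Mapping.single (mset (map fst V)) (rows_wt (count M) (rev [0..<N]) V)) M)"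
    unfolding alpha_def prod_rowpoly len by (simp add: lookup_sum)
  also have "\<dots> = (\<Sum>V | V \<in> words_over N n \<and> mset (map fst V) = M. word_wt N V)"
    by (rule sum.mono_neutral_cong_right) (auto simp: finite_words_over lookup_single word_wt_def)
  finally show ?thesis .
qed

lemma content_gf_alpha_nth:
  "fps_nth (content_gf q N (alpha N)) n = (\<Sum>V\<in>words_over N n. q ^ sum_list (map fst V) * word_wt N V)"
proof -
  have "fps_nth (content_gf q N (alpha N)) n = (\<Sum>M\<in>contents N n. \<Sum>V | V \<in> words_over N n \<and> mset (map fst V) = M. q ^ sum_list (map fst V) * word_wt N V)"
    by (auto simp: content_gf_def alpha_words sum_distrib_left sum_mset_sum_list[symmetric] intro!: sum.cong)
  also have "\<dots> = (\<Sum>V\<in>words_over N n. q ^ sum_list (map fst V) * word_wt N V)"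
  proof (rule sum.group[OF finite_words_over finite_contents])
    show "(\<lambda>V. mset (map fst V)) ` words_over N n \<subseteq> contents N n" by (force simp: contents_def words_over_def letters_def)
  qed
  finally show ?thesis .
qed

text \<open>The coefficients of \<open>content_gf_alpha\<close>. In the limit of large
  \<open>N\<close> this takes the form of the recurrence shown for the hook side.\<close>

theorem word_recurrence:
  "(\<Sum>m\<le>n. (\<Sum>M\<in>contents N m. q ^ sum_mset M) * (t ^ (l * m) - t) * (\<Sum>V\<in>words_over N (n - m). q ^ sum_list (map fst V) * word_wt N V))
    = (1 - t) * r ^ n * (\<Sum>M\<in>contents N n. q ^ sum_mset M)"
proof -
  have "fps_nth ((complete_gf q N (t ^ l) - fps_const t * complete_gf q N 1) * content_gf q N (alpha N)) n = fps_nth (fps_const (1 - t) * complete_gf q N r) n"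
    using content_gf_alpha[of q N] by (simp add: mult.commute)
  moreover have "fps_nth (complete_gf q N (t ^ l) - fps_const t * complete_gf q N 1) m = (\<Sum>M\<in>contents N m. q ^ sum_mset M) * (t ^ (l * m) - t)" for m
    by (simp add: complete_gf_nth power_mult algebra_simps)
  moreover have "fps_nth (fps_const (1 - t) * complete_gf q N r) n = (1 - t) * r ^ n * (\<Sum>M\<in>contents N n. q ^ sum_mset M)"
    by (simp add: complete_gf_nth mult.assoc)
  ultimately show ?thesis by (simp only: fps_mult_nth content_gf_alpha_nth atLeast0AtMost)
qed

end

section \<open>Sequences with prescribed descents\<close>

definition descending :: "nat \<Rightarrow> nat \<Rightarrow> (nat \<Rightarrow> bool) \<Rightarrow> nat list set" where
  "descending N n D = {c. length c = n \<and> set c \<subseteq> {..<N} \<and>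
     (\<forall>j. Suc j < n \<longrightarrow> c ! Suc j \<le> c ! j \<and> (D j \<longrightarrow> c ! Suc j < c ! j))}"

lemma finite_descending: "finite (descending N n D)"
  by (rule finite_subset[OF _ finite_lists_length_eq[of "{..<N}" n]]) (auto simp: descending_def)

lemma descending_antimono:
  assumes "c \<in> descending N n D" "j \<le> k" "k < n"
  shows "c ! k \<le> c ! j"
  using assms(2,3)
proof (induction k rule: dec_induct)
  case (step k)
  then show ?case using assms(1) by (auto simp: descending_def intro: order_trans)
qed simp

lemma descending_0: "descending N 0 D = {[]}"
  by (auto simp: descending_def)

lemma descending_map_Suc:
  "map Suc ` descending N n D = {c \<in> descending (Suc N) n D. \<forall>x\<in>set c. 0 < x}"
proof (intro equalityI subsetI)
  fix c assume c: "c \<in> {c \<in> descending (Suc N) n D. \<forall>x\<in>set c. 0 < x}"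
  then have eq: "map Suc (map (\<lambda>x. x - 1) c) = c" by (auto simp: comp_def intro: map_idI)
  have "map (\<lambda>x. x - 1) c \<in> descending N n D"
  proof -
    have "c ! j > 0" if "j < n" for j using c that by (auto simp: descending_def)
    then show ?thesis using c unfolding descending_def
      by (fastforce simp: less_diff_conv2 Suc_le_eq)
  qed
  then show "c \<in> map Suc ` descending N n D" using eq by (metis imageI)
qed (auto simp: descending_def)

text \<open>If the last entry is positive, so are all others, and 1 is subtracted everywhere. If it
  is 0, it is removed; when a strict drop to it was imposed, the entries before it are all
  positive.\<close>

lemma descending_Suc:
  "descending (Suc N) (Suc n) D = map Suc ` descending N (Suc n) D \<union>
     (\<lambda>c. c @ [0]) ` (if 0 < n \<and> D (n - 1) then map Suc ` descending N n D else descending (Suc N) n D)"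
  (is "?L = ?R1 \<union> _ ` ?R2")
proof (intro equalityI subsetI)
  fix c assume c: "c \<in> ?L"
  show "c \<in> ?R1 \<union> (\<lambda>c. c @ [0]) ` ?R2"
  proof (cases "c ! n")
    case (Suc k)
    have "0 < x" if "x \<in> set c" for x
    proof -
      obtain j where "j < Suc n" "x = c ! j" using \<open>x \<in> set c\<close> c by (auto simp: in_set_conv_nth descending_def)
      then show ?thesis using descending_antimono[OF c, of j n] Suc by simp
    qed
    then show ?thesis using c unfolding descending_map_Suc by blast
  next
    case 0
    define b where "b = take n c"
    have len: "length c = Suc n" using c by (simp add: descending_def)
    then have cb: "c = b @ [0]"
      using 0 by (metis b_def lessI take_Suc_conv_app_nth take_all_iff order_refl)
    have bn: "b ! j = c ! j" if "j < n" for j using that by (simp add: b_def)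
    have b: "b \<in> descending (Suc N) n D"
      using c len bn by (auto simp: descending_def b_def dest: in_set_takeD)
    have "b \<in> ?R2"
    proof (cases "0 < n \<and> D (n - 1)")
      case True
      have "c ! Suc (n - 1) < c ! (n - 1)" using c True by (cases n) (auto simp: descending_def)
      then have pos: "b ! (n - 1) > 0" using True bn[of "n - 1"] by simp
      have "0 < x" if "x \<in> set b" for x
      proof -
        obtain j where "j < n" "x = b ! j" using \<open>x \<in> set b\<close> b by (auto simp: in_set_conv_nth descending_def)
        moreover from this have "j \<le> n - 1" by linarith
        ultimately show ?thesis using descending_antimono[OF b, of j "n - 1"] pos by simp
      qed
      then show ?thesis using b True unfolding descending_map_Suc by simp
    qed (use b in auto)
    then show ?thesis using cb by blast
  qed
next
  fix c assume "c \<in> ?R1 \<union> (\<lambda>c. c @ [0]) ` ?R2"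
  then show "c \<in> ?L"
  proof
    assume "c \<in> ?R1" then show ?thesis unfolding descending_map_Suc by blast
  next
    assume "c \<in> (\<lambda>c. c @ [0]) ` ?R2"
    then obtain b where cb: "c = b @ [0]" and b2: "b \<in> ?R2" by blast
    have b: "b \<in> descending (Suc N) n D" using b2 unfolding descending_map_Suc by (auto split: if_splits)
    have pos: "b ! j > 0" if "Suc j = n" "D j" for j
    proof -
      have "b \<in> {c \<in> descending (Suc N) n D. \<forall>x\<in>set c. 0 < x}"
        using b2 that unfolding descending_map_Suc by auto
      then show ?thesis using that by (auto simp: descending_def)
    qed
    have lb: "length b = n" using b by (simp add: descending_def)
    have "c ! Suc j \<le> c ! j \<and> (D j \<longrightarrow> c ! Suc j < c ! j)" if "Suc j < Suc n" for j
      using that b lb pos[of j] unfolding cb by (cases "Suc j = n") (auto simp: nth_append descending_def)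
    then show ?thesis using b unfolding cb by (simp add: descending_def)
  qed
qed

definition descending_sum :: "real \<Rightarrow> nat \<Rightarrow> nat \<Rightarrow> (nat \<Rightarrow> bool) \<Rightarrow> real" where
  "descending_sum q N n D = (\<Sum>c\<in>descending N n D. q ^ sum_list c)"

lemma descending_sum_map_Suc: "(\<Sum>c\<in>map Suc ` descending N n D. q ^ sum_list c) = q ^ n * descending_sum q N n D"
proof -
  have "sum_list (map Suc c) = n + sum_list c" if "length c = n" for c
    using that by (induction c arbitrary: n) auto
  then have "(\<Sum>c\<in>descending N n D. q ^ sum_list (map Suc c)) = q ^ n * descending_sum q N n D"
    unfolding descending_sum_def sum_distrib_left by (intro sum.cong) (auto simp: descending_def power_add)
  then show ?thesis by (subst sum.reindex) (auto simp: inj_on_def)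
qed

text \<open>A recursion in \<open>N\<close> for fixed length, whose inhomogeneous term comes from
  sequences shorter by one; \<open>affine_recursion_limit\<close> will solve it.\<close>

lemma descending_sum_Suc:
  "descending_sum q (Suc N) (Suc n) D = q ^ Suc n * descending_sum q N (Suc n) D +
     (if 0 < n \<and> D (n - 1) then q ^ n * descending_sum q N n D else descending_sum q (Suc N) n D)"
proof -
  let ?R2 = "if 0 < n \<and> D (n - 1) then map Suc ` descending N n D else descending (Suc N) n D"
  have "descending_sum q (Suc N) (Suc n) D = (\<Sum>c\<in>map Suc ` descending N (Suc n) D. q ^ sum_list c) +
     (\<Sum>c\<in>(\<lambda>c. c @ [0]) ` ?R2. q ^ sum_list c)"
    unfolding descending_sum_def descending_Suc
  proof (rule sum.union_disjoint)
    show "map Suc ` descending N (Suc n) D \<inter> (\<lambda>c. c @ [0]) ` ?R2 = {}"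
      unfolding descending_map_Suc by auto
  qed (auto simp: finite_descending)
  also have "(\<Sum>c\<in>(\<lambda>c. c @ [0]) ` ?R2. q ^ sum_list c) = (\<Sum>c\<in>?R2. q ^ sum_list c)"
    by (subst sum.reindex) (auto simp: inj_on_def)
  also have "\<dots> = (if 0 < n \<and> D (n - 1) then q ^ n * descending_sum q N n D else descending_sum q (Suc N) n D)"
    using descending_sum_map_Suc by (auto simp: descending_sum_def)
  finally show ?thesis by (simp only: descending_sum_map_Suc)
qed

text \<open>The limit is the fixed point of the map \<open>p * x + Y\<close>. The deviation from it
  is contracted by \<open>p\<close> in each step, up to a disturbance that tends to 0.\<close>

lemma affine_recursion_limit:
  fixes x y :: "nat \<Rightarrow> real"
  assumes rec: "\<And>N. x (Suc N) = p * x N + y N" and p: "0 \<le> p" "p < 1" and y: "y \<longlonglongrightarrow> Y"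
  shows "x \<longlonglongrightarrow> Y / (1 - p)"
proof -
  define e where "e N = x N - Y / (1 - p)" for N
  define d where "d N = y N - Y" for N
  have Y: "Y / (1 - p) = p * (Y / (1 - p)) + Y" using p by (simp add: field_simps)
  have e: "e (Suc N) = p * e N + d N" for N
    unfolding e_def d_def rec by (subst (1) Y) (simp add: algebra_simps)
  have d: "d \<longlonglongrightarrow> 0" unfolding d_def using y by (simp add: LIM_zero)
  have "e \<longlonglongrightarrow> 0"
  proof (rule LIMSEQ_I)
    fix \<epsilon> :: real assume eps: "0 < \<epsilon>"
    have "0 < \<epsilon> * (1 - p) / 2" using eps p by simp
    then obtain M where M: "\<And>N. N \<ge> M \<Longrightarrow> \<bar>d N\<bar> < \<epsilon> * (1 - p) / 2"
      using LIMSEQ_D[OF d] by fastforce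
    \<comment> \<open>By the geometric series with ratio \<open>p\<close>, disturbances below
      \<open>\<epsilon> * (1 - p) / 2\<close> add up to at most
      \<open>\<epsilon> / 2\<close>.\<close>
    have bd: "\<bar>e (M + k)\<bar> \<le> p ^ k * \<bar>e M\<bar> + \<epsilon> / 2" for k
    proof (induction k)
      case 0 then show ?case using eps by simp
    next
      case (Suc k)
      have "\<bar>e (M + Suc k)\<bar> \<le> p * \<bar>e (M + k)\<bar> + \<bar>d (M + k)\<bar>"
        using e[of "M + k"] p abs_triangle_ineq[of "p * e (M + k)" "d (M + k)"] by (simp add: abs_mult)
      also have "\<dots> \<le> p * (p ^ k * \<bar>e M\<bar> + \<epsilon> / 2) + \<epsilon> * (1 - p) / 2"
        using Suc M[of "M + k"] p by (intro add_mono mult_left_mono) auto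
      also have "\<dots> = p ^ Suc k * \<bar>e M\<bar> + \<epsilon> / 2" by (simp add: field_simps)
      finally show ?case .
    qed
    have "(\<lambda>k. p ^ k * \<bar>e M\<bar>) \<longlonglongrightarrow> 0 * \<bar>e M\<bar>"
      using p by (intro tendsto_mult LIMSEQ_realpow_zero tendsto_const) auto
    then obtain K where K: "\<And>k. k \<ge> K \<Longrightarrow> \<bar>p ^ k * \<bar>e M\<bar>\<bar> < \<epsilon> / 2"
      using LIMSEQ_D[of "\<lambda>k. p ^ k * \<bar>e M\<bar>" 0 "\<epsilon> / 2"] eps by auto
    have "norm (e N - 0) < \<epsilon>" if "N \<ge> M + K" for N
    proof -
      have N: "K \<le> N - M" "M + (N - M) = N" using that by auto
      show ?thesis using bd[of "N - M"] K[OF N(1)] unfolding N(2) by simp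
    qed
    then show "\<exists>no. \<forall>n\<ge>no. norm (e n - 0) < \<epsilon>" by blast
  qed
  then show ?thesis unfolding e_def by (simp add: LIM_zero_iff)
qed

text \<open>A strict drop after the first \<open>Suc j\<close> entries raises each of them by one,
  which produces the major index in the exponent. The proof goes by induction on the length and
  solves the recursion in \<open>N\<close> in the limit.\<close>

lemma descending_sum_limit:
  assumes "0 < q" "q < 1"
  shows "(\<lambda>N. descending_sum q N n D) \<longlonglongrightarrow> q ^ (\<Sum>j | Suc j < n \<and> D j. Suc j) * qexp q n"
proof (induction n)
  case 0
  then show ?case by (simp add: descending_sum_def descending_0)
next
  case (Suc n)
  let ?e = "\<lambda>n. \<Sum>j | Suc j < n \<and> D j. Suc j"
  let ?y = "\<lambda>N. if 0 < n \<and> D (n - 1) then q ^ n * descending_sum q N n D else descending_sum q (Suc N) n D"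
  have lim: "?y \<longlonglongrightarrow> q ^ ?e (Suc n) * qexp q n"
  proof (cases "0 < n \<and> D (n - 1)")
    case True
    have "{j. Suc j < Suc n \<and> D j} = insert (n - 1) {j. Suc j < n \<and> D j}" using True by auto
    moreover have "finite {j. Suc j < n \<and> D j}" by (rule finite_subset[of _ "{..<n}"]) auto
    ultimately have "?e (Suc n) = n + ?e n" using True by simp
    then show ?thesis using tendsto_mult_left[OF Suc, of "q ^ n"] True by (simp add: power_add mult.assoc)
  next
    case False
    then have "Suc j < Suc n \<and> D j \<longleftrightarrow> Suc j < n \<and> D j" for j by (cases "Suc j = n") auto
    then have "?e (Suc n) = ?e n" by simp
    moreover have "?y = (\<lambda>N. descending_sum q (Suc N) n D)" using False by auto
    ultimately show ?thesis using LIMSEQ_Suc[OF Suc] by simp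
  qed
  have "(\<lambda>N. descending_sum q N (Suc n) D) \<longlonglongrightarrow> q ^ ?e (Suc n) * qexp q n / (1 - q ^ Suc n)"
    by (rule affine_recursion_limit[OF descending_sum_Suc _ _ lim]) (use assms in \<open>auto simp: power_Suc_less_one simp del: power_Suc\<close>)
  then show ?case by (simp add: qexp_Suc del: power_Suc)
qed

lemma sorted_mset_unique:
  fixes xs ys :: "'b::linorder list"
  assumes "sorted xs" "sorted ys" "mset xs = mset ys"
  shows "xs = ys"
proof -
  have "sort xs = xs" by (rule properties_for_sort[OF refl assms(1)])
  moreover have "sort xs = ys" by (rule properties_for_sort[OF assms(3)[symmetric] assms(2)])
  ultimately show ?thesis by simp
qed

lemma descending_unique:
  assumes "c \<in> descending N n D" "c' \<in> descending N' n' D'" "mset c = mset c'"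
  shows "c = c'"
proof -
  have s: "sorted (rev c)" if "c \<in> descending N n D" for c N n D
    using that by (auto simp: sorted_rev_iff_nth_mono descending_def intro: descending_antimono[OF that])
  have "rev c = rev c'"
    by (rule sorted_mset_unique) (use s[OF assms(1)] s[OF assms(2)] assms(3) in simp_all)
  then show ?thesis by simp
qed

text \<open>Without prescribed drops the sequences are just weakly decreasing, and these correspond
  to multisets.\<close>

lemma descending_sum_contents: "descending_sum q N n (\<lambda>_. False) = (\<Sum>M\<in>contents N n. q ^ sum_mset M)"
  unfolding descending_sum_def
proof (rule sum.reindex_bij_betw[THEN trans[rotated]])
  show "bij_betw mset (descending N n (\<lambda>_. False)) (contents N n)"
    unfolding bij_betw_def
  proof
    show "inj_on mset (descending N n (\<lambda>_. False))"
      by (auto intro!: inj_onI descending_unique)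
    show "mset ` descending N n (\<lambda>_. False) = contents N n"
    proof (intro equalityI subsetI)
      fix M assume M: "M \<in> contents N n"
      let ?c = "rev (sorted_list_of_multiset M)"
      have m: "mset ?c = M" by simp
      have "length ?c = n" using M m by (metis (mono_tags, lifting) contents_def mem_Collect_eq size_mset)
      moreover have "set ?c \<subseteq> {..<N}" using M by (auto simp: contents_def)
      moreover have "sorted (rev ?c)" by simp
      ultimately have "?c \<in> descending N n (\<lambda>_. False)"
        by (auto simp: descending_def sorted_rev_iff_nth_Suc simp del: rev_rev_ident)
      then show "M \<in> mset ` descending N n (\<lambda>_. False)" using m by (metis imageI)
    qed (auto simp: descending_def contents_def)
  qed
qed (simp add: sum_mset_sum_list)


section \<open>Barred excedances\<close>

text \<open>Color \<open>l\<close> marks the excedances among the letters that used to have color \<open>0\<close>.\<close>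
definition barred :: "nat \<Rightarrow> nat \<Rightarrow> (nat \<times> nat) list set" where
  "barred l n = {w \<in> colored_perms (Suc l) n. \<forall>j<n.
     (snd (w ! j) = l \<longrightarrow> Suc j < fst (w ! j)) \<and> (snd (w ! j) = 0 \<longrightarrow> fst (w ! j) \<le> Suc j)}"

definition bar :: "nat \<Rightarrow> (nat \<times> nat) list \<Rightarrow> (nat \<times> nat) list" where
  "bar l w = map (\<lambda>j. (fst (w ! j), if snd (w ! j) = 0 \<and> Suc j < fst (w ! j) then l else snd (w ! j))) [0..<length w]"

lemma length_bar [simp]: "length (bar l w) = length w" by (simp add: bar_def)

lemma nth_bar: "j < length w \<Longrightarrow> bar l w ! j =
    (fst (w ! j), if snd (w ! j) = 0 \<and> Suc j < fst (w ! j) then l else snd (w ! j))"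
  by (simp add: bar_def)

lemma map_fst_bar: "map fst (bar l w) = map fst w"
  by (rule nth_equalityI) (simp_all add: nth_bar)

text \<open>The inverse recolors \<open>l\<close> as 0. The color \<open>l\<close> does not occur in
  the original words, and the conditions in \<open>barred\<close> guarantee that barring again
  restores exactly the letters of color \<open>l\<close>.\<close>

lemma bij_bar:
  assumes "l \<ge> 1"
  shows "bij_betw (bar l) (colored_perms l n) (barred l n)"
proof (rule bij_betw_byWitness[where f' = "map (\<lambda>z. (fst z, if snd z = l then 0 else snd z))"])
  have col: "snd (w ! j) < l" if "w \<in> colored_perms l n" "j < length w" for w j
    using that by (auto simp: colored_perms_def)
  show "\<forall>w\<in>colored_perms l n. map (\<lambda>z. (fst z, if snd z = l then 0 else snd z)) (bar l w) = w"
  proof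
    fix w assume "w \<in> colored_perms l n"
    then show "map (\<lambda>z. (fst z, if snd z = l then 0 else snd z)) (bar l w) = w"
      using col[of w] by (intro nth_equalityI) (auto simp: nth_bar prod_eq_iff)
  qed
  show "\<forall>w\<in>barred l n. bar l (map (\<lambda>z. (fst z, if snd z = l then 0 else snd z)) w) = w"
  proof
    fix w assume w: "w \<in> barred l n"
    then have "length w = n" by (simp add: barred_def colored_perms_def)
    then show "bar l (map (\<lambda>z. (fst z, if snd z = l then 0 else snd z)) w) = w"
      using w by (intro nth_equalityI) (auto simp: nth_bar barred_def prod_eq_iff)
  qed
  show "bar l ` colored_perms l n \<subseteq> barred l n"
  proof
    fix b assume "b \<in> bar l ` colored_perms l n"
    then obtain w where w: "w \<in> colored_perms l n" and b: "b = bar l w" by blast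
    have n: "length w = n" using w by (simp add: colored_perms_def)
    have "snd (b ! j) < Suc l" if "j < n" for j using col[OF w, of j] that n by (simp add: b nth_bar)
    then have "\<forall>x\<in>set b. snd x < Suc l" using n by (metis b in_set_conv_nth length_bar)
    then have "b \<in> colored_perms (Suc l) n"
      using w by (simp only: colored_perms_def b map_fst_bar length_bar mem_Collect_eq)
    then show "b \<in> barred l n"
      using col[OF w] n assms by (fastforce simp: barred_def b nth_bar)
  qed
  show "map (\<lambda>z. (fst z, if snd z = l then 0 else snd z)) ` barred l n \<subseteq> colored_perms l n"
  proof
    let ?u = "map (\<lambda>z. (fst z, if snd z = l then 0 else snd z))"
    fix b assume "b \<in> ?u ` barred l n"
    then obtain w where w: "w \<in> colored_perms (Suc l) n" and b: "b = ?u w" by (auto simp: barred_def)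
    have "map fst b = map fst w" "length b = length w" by (simp_all add: b)
    moreover have "snd x < l" if "x \<in> set b" for x
    proof -
      obtain z where z: "z \<in> set w" "x = (fst z, if snd z = l then 0 else snd z)" using \<open>x \<in> set b\<close> by (auto simp: b)
      then have "snd z < Suc l" using w by (auto simp: colored_perms_def)
      then show ?thesis using z assms by auto
    qed
    ultimately show "b \<in> colored_perms l n" using w by (simp only: colored_perms_def mem_Collect_eq) blast
  qed
qed

lemma cexc_eq: "cexc w = card {j. j < length w \<and> snd (w ! j) = 0 \<and> Suc j < fst (w ! j)}"
proof -
  have "{i. 1 \<le> i \<and> i \<le> length w \<and> snd (w ! (i - 1)) = 0 \<and> fst (w ! (i - 1)) > i} =
     Suc ` {j. j < length w \<and> snd (w ! j) = 0 \<and> Suc j < fst (w ! j)}" (is "?L = _ ` ?R")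
  proof (intro equalityI subsetI)
    fix i assume "i \<in> ?L"
    then show "i \<in> Suc ` ?R" by (intro image_eqI[of _ _ "i - 1"]) auto
  qed auto
  then show ?thesis by (simp add: cexc_def card_image)
qed

lemma cfix_eq: "cfix w = card {j. j < length w \<and> w ! j = (Suc j, 0)}"
proof -
  have "{i. 1 \<le> i \<and> i \<le> length w \<and> w ! (i - 1) = (i, 0)} =
     Suc ` {j. j < length w \<and> w ! j = (Suc j, 0)}" (is "?L = _ ` ?R")
  proof (intro equalityI subsetI)
    fix i assume "i \<in> ?L"
    then show "i \<in> Suc ` ?R" by (intro image_eqI[of _ _ "i - 1"]) auto
  qed auto
  then show ?thesis by (simp add: cfix_def card_image)
qed

lemma cmaj_eq: "cmaj w = (\<Sum>j | Suc j < length w \<and> cless (w ! Suc j) (w ! j). Suc j)"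
  unfolding cmaj_def
  by (rule sum.reindex_bij_witness[of _ Suc "\<lambda>i. i - 1"]) auto

text \<open>Each excedance gains color \<open>l\<close>, which is its contribution to
  \<open>fexc\<close>.\<close>

lemma colsum_bar: "colsum (bar l w) = fexc l w"
proof -
  have "colsum (bar l w) = (\<Sum>j<length w. (if snd (w ! j) = 0 \<and> Suc j < fst (w ! j) then l else 0) + snd (w ! j))"
    unfolding colsum_def sum_list_sum_nth by (auto simp: nth_bar atLeast0LessThan intro!: sum.cong)
  also have "\<dots> = l * cexc w + colsum w"
    unfolding sum.distrib colsum_def sum_list_sum_nth cexc_eq
    by (simp add: sum.If_cases atLeast0LessThan Collect_conj_eq lessThan_def)
  finally show ?thesis by (simp add: fexc_def)
qed

lemma cfix_bar: "l \<ge> 1 \<Longrightarrow> cfix (bar l w) = cfix w"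
  unfolding cfix_eq length_bar
  by (rule arg_cong[of _ _ card]) (auto simp: nth_bar prod_eq_iff)

text \<open>Summation by parts.\<close>

lemma sum_index_difference:
  "(\<Sum>j<n. int (Suc j) * (e j - e (Suc j))) = (\<Sum>j<n. e j) - int n * e n"
  by (induction n) (simp_all add: algebra_simps)

text \<open>Barring an excedance moves it below every other letter. Along each maximal run of
  excedances this trades the descent that ends the run for one just before it.\<close>
lemma cmaj_bar:
  assumes "l \<ge> 1" and w: "w \<in> colored_perms l n"
  shows "cmaj w = cmaj (bar l w) + cexc w"
proof -
  define E where "E j \<longleftrightarrow> j < length w \<and> snd (w ! j) = 0 \<and> Suc j < fst (w ! j)" for j
  define e where "e j = (if E j then 1 else 0 :: int)" for j
  have n: "length w = n" and dist: "distinct (map fst w)" and col: "\<And>j. j < n \<Longrightarrow> snd (w ! j) < l"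
    and le: "\<And>j. j < n \<Longrightarrow> fst (w ! j) \<le> n"
    using w by (force simp: colored_perms_def dest: nth_mem)+
  \<comment> \<open>If only \<open>j\<close> is an excedance, there is a descent at \<open>j\<close>
    before barring and none after; for two uncolored letters this needs that they differ. If only
    \<open>Suc j\<close> is one, it is the other way round, and in the remaining cases nothing
    changes.\<close>
  have step: "(if cless (w ! Suc j) (w ! j) then 1 else 0) - (if cless (bar l w ! Suc j) (bar l w ! j) then 1 else 0)
      = e j - e (Suc j)" if "Suc j < n" for j
  proof -
    have "fst (w ! j) \<noteq> fst (w ! Suc j)"
      using nth_eq_iff_index_eq[OF dist, of j "Suc j"] that n by simp
    then show ?thesis using that n col[of j] col[of "Suc j"]
      by (auto simp: e_def E_def nth_bar cless_def)
  qed
  have maj: "int (cmaj v) = (\<Sum>j<n - 1. int (Suc j) * (if cless (v ! Suc j) (v ! j) then 1 else 0))"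
    if "length v = n" for v
  proof -
    have eq: "{j. Suc j < n \<and> cless (v ! Suc j) (v ! j)} = {j \<in> {..<n - 1}. cless (v ! Suc j) (v ! j)}" by auto
    have "int (cmaj v) = (\<Sum>j \<in> {j \<in> {..<n - 1}. cless (v ! Suc j) (v ! j)}. int (Suc j))"
      unfolding cmaj_eq that eq by (rule of_nat_sum)
    also have "\<dots> = (\<Sum>j<n - 1. if cless (v ! Suc j) (v ! j) then int (Suc j) else 0)"
      by (rule sum.inter_filter) simp
    also have "\<dots> = (\<Sum>j<n - 1. int (Suc j) * (if cless (v ! Suc j) (v ! j) then 1 else 0))"
      by (rule sum.cong) auto
    finally show ?thesis .
  qed
  have "int (cmaj w) - int (cmaj (bar l w)) = (\<Sum>j<n - 1. int (Suc j) * (e j - e (Suc j)))"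
    unfolding maj[OF n] maj[of "bar l w", unfolded length_bar, OF n] sum_subtractf[symmetric] right_diff_distrib[symmetric]
    by (rule sum.cong[OF refl]) (use step in auto)
  also have "\<dots> = (\<Sum>j<n - 1. e j) - int (n - 1) * e (n - 1)" by (rule sum_index_difference)
  also have "\<dots> = (\<Sum>j<n. e j)"
  proof (cases n)
    case (Suc k)
    \<comment> \<open>No letter exceeds \<open>n\<close>, so the last position is not an excedance
      and the boundary term vanishes.\<close>
    have "e k = 0" using le[of k] Suc by (auto simp: e_def E_def)
    then show ?thesis by (simp add: Suc)
  qed simp
  also have "\<dots> = int (card {j \<in> {..<n}. E j})" by (simp add: e_def sum.If_cases Int_def)
  also have "{j \<in> {..<n}. E j} = {j. j < length w \<and> snd (w ! j) = 0 \<and> Suc j < fst (w ! j)}"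
    by (auto simp: E_def n)
  finally show ?thesis by (simp add: cexc_eq)
qed


section \<open>Standardization\<close>

context colors
begin

text \<open>\<open>row_ok\<close> read at a single position: the last condition keeps a letter
  \<open>(c ! p, l)\<close> away from the first position of its block.\<close>

definition pos_ok :: "nat list \<Rightarrow> (nat \<times> nat) list \<Rightarrow> nat \<Rightarrow> bool" where
  "pos_ok c V p \<longleftrightarrow> letter_ok (c ! p) (V ! p) \<and> (V ! p = (c ! p, l) \<longrightarrow> 0 < p \<and> c ! (p - 1) = c ! p)"

text \<open>Membership of \<open>p\<close> in the trail of its block, expressed without rows; equal
  entries of \<open>c\<close> are contiguous where this is used.\<close>

definition fix_run :: "nat list \<Rightarrow> (nat \<times> nat) list \<Rightarrow> nat \<Rightarrow> bool" where
  "fix_run c V p \<longleftrightarrow> (\<forall>k. p \<le> k \<and> k < length c \<and> c ! k = c ! p \<longrightarrow> V ! k = (c ! k, 0))"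

lemma trail_eq_card: "trail y U = card {p. p < length U \<and> (\<forall>k. p \<le> k \<and> k < length U \<longrightarrow> U ! k = (y, 0))}"
proof (induction U rule: rev_induct)
  case Nil
  then show ?case by (simp add: trail_def)
next
  case (snoc z U)
  let ?S = "\<lambda>U. {p. p < length U \<and> (\<forall>k. p \<le> k \<and> k < length U \<longrightarrow> U ! k = (y, 0))}"
  show ?case
  proof (cases "z = (y, 0)")
    case True
    have "?S (U @ [z]) = insert (length U) (?S U)"
      using True by (auto simp: nth_append less_Suc_eq)
    moreover have "finite (?S U)" by simp
    ultimately show ?thesis using True snoc by (simp add: trail_snoc)
  next
    case False
    have "z = (y, 0)" if "p \<in> ?S (U @ [z])" for p
    proof -
      have "p < length (U @ [z])" "\<forall>k. p \<le> k \<and> k < length (U @ [z]) \<longrightarrow> (U @ [z]) ! k = (y, 0)"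
        using that by blast+
      from this(2)[rule_format, of "length U"] this(1) show ?thesis by simp
    qed
    then have e: "?S (U @ [z]) = {}" using False by blast
    show ?thesis unfolding e using False by (simp add: trail_snoc)
  qed
qed

text \<open>Distinct \<open>ys\<close> give different values to different blocks, so neither
  \<open>pos_ok\<close> nor \<open>fix_run\<close> looks across a block boundary, and the first
  block can be split off.\<close>

lemma rows_wt_eq:
  assumes "distinct ys" "length V = length c" "c = concat (map (\<lambda>y. replicate (m y) y) ys)"
  shows "rows_wt m ys V = (if \<forall>p<length c. pos_ok c V p
     then r ^ card {p. p < length c \<and> fix_run c V p} * t ^ sum_list (map snd V) else 0)"
  using assms
proof (induction ys arbitrary: V c)
  case Nil
  then show ?case by simp
next
  case (Cons y ys)
  define U where "U = take (m y) V"
  define V' where "V' = drop (m y) V"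
  define c' where "c' = concat (map (\<lambda>y. replicate (m y) y) ys)"
  let ?m = "m y"
  have V: "V = U @ V'" by (simp add: U_def V'_def)
  have c: "c = replicate ?m y @ c'" using Cons.prems by (simp add: c'_def)
  have len: "length U = ?m" "length V' = length c'" "length c = ?m + length c'"
    using Cons.prems(2) by (simp_all add: U_def V'_def c)
  have IH: "rows_wt m ys V' = (if \<forall>p<length c'. pos_ok c' V' p
     then r ^ card {p. p < length c' \<and> fix_run c' V' p} * t ^ sum_list (map snd V') else 0)"
    using Cons.prems len by (intro Cons.IH) (auto simp: c'_def)
  have y: "c' ! k \<noteq> y" if "k < length c'" for k
  proof -
    have "c' ! k \<in> set c'" using that by simp
    then show ?thesis using Cons.prems(1) by (auto simp: c'_def)
  qed
  have c1: "c ! p = y" if "p < ?m" for p using that by (simp add: c nth_append)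
  have c2: "c ! (?m + p) = c' ! p" for p by (simp add: c nth_append)
  have V1: "V ! p = U ! p" if "p < ?m" for p using that len by (simp add: V nth_append)
  have V2: "V ! (?m + p) = V' ! p" for p using len by (simp add: V nth_append)
  have split: "p < length c \<longleftrightarrow> p < ?m \<or> (\<exists>k<length c'. p = ?m + k)" for p
    unfolding len by presburger
  have ok1: "pos_ok c V p \<longleftrightarrow> letter_ok y (U ! p) \<and> (U ! p = (y, l) \<longrightarrow> 0 < p)" if "p < ?m" for p
    using that c1[OF that] c1[of "p - 1"] V1[OF that] by (auto simp: pos_ok_def)
  have ok2: "pos_ok c V (?m + k) \<longleftrightarrow> pos_ok c' V' k" if "k < length c'" for k
  proof (cases k)
    \<comment> \<open>The entry of \<open>c\<close> before the rest \<open>c'\<close>, if there is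
      one, is \<open>y\<close>, so the first position of \<open>c'\<close> starts a block in
      \<open>c\<close> as well.\<close>
    case 0
    have "\<not> (0 < ?m \<and> c ! (?m - 1) = c' ! 0)" using y[of 0] c1[of "?m - 1"] that 0 by auto
    then show ?thesis using c2[of 0] V2[of 0] 0 by (auto simp: pos_ok_def)
  next
    case (Suc i)
    then show ?thesis using c2[of k] c2[of i] V2[of k] by (simp add: pos_ok_def)
  qed
  have row: "row_ok y U \<longleftrightarrow> (\<forall>p<?m. pos_ok c V p)"
  proof -
    have "(\<forall>p<?m. pos_ok c V p) \<longleftrightarrow> (\<forall>p<?m. letter_ok y (U ! p)) \<and> (\<forall>p<?m. U ! p = (y, l) \<longrightarrow> 0 < p)"
      using ok1 by blast
    also have "(\<forall>p<?m. letter_ok y (U ! p)) \<longleftrightarrow> (\<forall>z\<in>set U. letter_ok y z)"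
      using all_set_conv_all_nth[of U "letter_ok y"] len(1) by simp
    also have "(\<forall>p<?m. U ! p = (y, l) \<longrightarrow> 0 < p) \<longleftrightarrow> (U \<noteq> [] \<longrightarrow> hd U \<noteq> (y, l))"
    proof -
      have "(\<forall>p<?m. U ! p = (y, l) \<longrightarrow> 0 < p) \<longleftrightarrow> (0 < ?m \<longrightarrow> U ! 0 \<noteq> (y, l))" by (metis neq0_conv)
      then show ?thesis using len(1) by (cases U) auto
    qed
    finally show ?thesis by (simp add: row_ok_def)
  qed
  have all: "(\<forall>p<length c. pos_ok c V p) \<longleftrightarrow> row_ok y U \<and> (\<forall>k<length c'. pos_ok c' V' k)"
    unfolding row using ok2 split by auto
  have run1: "fix_run c V p \<longleftrightarrow> (\<forall>k. p \<le> k \<and> k < length U \<longrightarrow> U ! k = (y, 0))" if p: "p < ?m" for p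
  proof
    assume f: "fix_run c V p"
    show "\<forall>k. p \<le> k \<and> k < length U \<longrightarrow> U ! k = (y, 0)"
    proof (intro allI impI)
      fix k assume k: "p \<le> k \<and> k < length U"
      then show "U ! k = (y, 0)" using f c1[of k] c1[OF p] V1[of k] len by (auto simp: fix_run_def)
    qed
  next
    assume f: "\<forall>k. p \<le> k \<and> k < length U \<longrightarrow> U ! k = (y, 0)"
    show "fix_run c V p" unfolding fix_run_def
    proof (intro allI impI)
      fix k assume k: "p \<le> k \<and> k < length c \<and> c ! k = c ! p"
      then have "k < ?m" using split[of k] y c2 c1[OF p] by auto
      then show "V ! k = (c ! k, 0)" using f k c1[of k] V1[of k] len by auto
    qed
  qed
  have run2: "fix_run c V (?m + i) \<longleftrightarrow> fix_run c' V' i" for i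
  proof
    assume f: "fix_run c V (?m + i)"
    show "fix_run c' V' i" unfolding fix_run_def
    proof (intro allI impI)
      fix k assume "i \<le> k \<and> k < length c' \<and> c' ! k = c' ! i"
      then show "V' ! k = (c' ! k, 0)" using f[unfolded fix_run_def, rule_format, of "?m + k"] by (simp add: c2 V2 len)
    qed
  next
    assume f: "fix_run c' V' i"
    show "fix_run c V (?m + i)" unfolding fix_run_def
    proof (intro allI impI)
      fix k assume k: "?m + i \<le> k \<and> k < length c \<and> c ! k = c ! (?m + i)"
      then obtain k' where "k = ?m + k'" by (metis add_leE le_iff_add)
      then show "V ! k = (c ! k, 0)" using f[unfolded fix_run_def, rule_format, of k'] k by (simp add: c2 V2 len)
    qed
  qed
  have "{p. p < length c \<and> fix_run c V p} =
     {p. p < length U \<and> (\<forall>k. p \<le> k \<and> k < length U \<longrightarrow> U ! k = (y, 0))} \<union>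
     (+) ?m ` {k. k < length c' \<and> fix_run c' V' k}" (is "_ = ?A \<union> ?B")
    using run1 run2 split len(1) by auto
  moreover have "card (?A \<union> ?B) = card ?A + card ?B"
    by (rule card_Un_disjoint) (auto simp: len(1))
  moreover have "card ?B = card {k. k < length c' \<and> fix_run c' V' k}" by (rule card_image) simp
  ultimately have crd: "card {p. p < length c \<and> fix_run c V p} = trail y U + card {k. k < length c' \<and> fix_run c' V' k}"
    by (simp add: trail_eq_card)
  have "rows_wt m (y # ys) V = row_wt y U * rows_wt m ys V'" by (simp add: U_def V'_def)
  also have "\<dots> = (if \<forall>p<length c. pos_ok c V p
     then r ^ card {p. p < length c \<and> fix_run c V p} * t ^ sum_list (map snd V) else 0)"
    unfolding IH all crd row_wt_def by (auto simp: V power_add)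
  finally show ?case .
qed

text \<open>Positions sorted by decreasing value, then decreasing color, then from left to right;
  the differences in the key reverse the order of values and colors.\<close>

definition order_of :: "nat \<Rightarrow> (nat \<times> nat) list \<Rightarrow> nat list" where
  "order_of N V = sort_key (\<lambda>p. (N - fst (V ! p), l - snd (V ! p), p)) [0..<length V]"

text \<open>Entry \<open>j\<close> names the position in \<open>V\<close>, counted from 1, of the
  letter whose sorted place is \<open>j\<close>. An entry exceeding its index thus means a letter of
  \<open>V\<close> that stands to the right of its sorted place.\<close>

definition perm_of :: "nat \<Rightarrow> (nat \<times> nat) list \<Rightarrow> (nat \<times> nat) list" where
  "perm_of N V = map (\<lambda>p. (Suc p, snd (V ! p))) (order_of N V)"

definition seq_of :: "nat \<Rightarrow> (nat \<times> nat) list \<Rightarrow> nat list" where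
  "seq_of N V = map (\<lambda>p. fst (V ! p)) (order_of N V)"

lemma order_of:
  shows "mset (order_of N V) = mset [0..<length V]" "set (order_of N V) = {0..<length V}"
    "distinct (order_of N V)" "length (order_of N V) = length V"
  by (simp_all add: order_of_def)

abbreviation cdesc :: "(nat \<times> nat) list \<Rightarrow> nat \<Rightarrow> bool" where
  "cdesc w j \<equiv> cless (w ! Suc j) (w ! j)"

definition perm_seq_pairs :: "nat \<Rightarrow> nat \<Rightarrow> ((nat \<times> nat) list \<times> nat list) set" where
  "perm_seq_pairs N n = (SIGMA w : colored_perms (Suc l) n. descending N n (cdesc w))"

lemma word_bounds:
  assumes "V \<in> words_over N n" "p < n"
  shows "fst (V ! p) < N" "snd (V ! p) \<le> l"
proof -
  have "V ! p \<in> letters N" using assms by (auto simp: words_over_def)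
  then show "fst (V ! p) < N" "snd (V ! p) \<le> l" by (auto simp: letters_def)
qed

lemma order_of_less:
  assumes V: "V \<in> words_over N n" and jk: "j < k" "k < n"
  defines "U \<equiv> order_of N V"
  shows "fst (V ! (U ! k)) < fst (V ! (U ! j)) \<or> fst (V ! (U ! k)) = fst (V ! (U ! j)) \<and>
     (snd (V ! (U ! k)) < snd (V ! (U ! j)) \<or> snd (V ! (U ! k)) = snd (V ! (U ! j)) \<and> U ! j < U ! k)"
proof -
  let ?key = "\<lambda>p. (N - fst (V ! p), l - snd (V ! p), p)"
  have n: "length V = n" using V by (simp add: words_over_def)
  have "sorted (map ?key U)" by (simp add: U_def order_of_def)
  then have "?key (U ! j) \<le> ?key (U ! k)"
    using sorted_nth_mono[of "map ?key U" j k] jk order_of(4)[of N V] n by (simp add: U_def)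
  moreover have "U ! j \<noteq> U ! k"
    using order_of(3)[of N V] order_of(4)[of N V] jk n by (simp add: U_def nth_eq_iff_index_eq)
  moreover have "U ! j < n" "U ! k < n"
    using order_of(2,4)[of N V] jk n nth_mem[of j U] nth_mem[of k U] by (auto simp: U_def)
  \<comment> \<open>These bounds make the truncated differences in the key strictly
    decreasing.\<close>
  then have "fst (V ! (U ! j)) < N" "fst (V ! (U ! k)) < N" "snd (V ! (U ! j)) \<le> l" "snd (V ! (U ! k)) \<le> l"
    using word_bounds[OF V] by auto
  ultimately show ?thesis by (auto simp: less_eq_prod_def less_prod_def)
qed

text \<open>For equal values the colors decrease weakly and, for equal colors, the positions
  increase; this is an ascent for \<open>cless\<close>. So at a descent of the permutation the value
  must drop.\<close>

lemma perm_seq_in_pairs: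
  assumes V: "V \<in> words_over N n"
  shows "(perm_of N V, seq_of N V) \<in> perm_seq_pairs N n"
proof -
  have n: "length V = n" using V by (simp add: words_over_def)
  note U = order_of[of N V, unfolded n]
  have Ult: "order_of N V ! j < n" if "j < n" for j using U nth_mem[of j "order_of N V"] that by auto
  have m: "map fst (perm_of N V) = map Suc (order_of N V)" by (simp add: perm_of_def)
  have "perm_of N V \<in> colored_perms (Suc l) n"
    unfolding colored_perms_def mem_Collect_eq m
    using U word_bounds[OF V] by (auto simp: distinct_map perm_of_def image_Suc_lessThan atLeast0LessThan less_Suc_eq_le)
  moreover have "seq_of N V \<in> descending N n (cdesc (perm_of N V))"
    unfolding descending_def
  proof (intro CollectI conjI allI impI)
    show "length (seq_of N V) = n" using U by (simp add: seq_of_def)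
    show "set (seq_of N V) \<subseteq> {..<N}" using U word_bounds[OF V] by (auto simp: seq_of_def)
    fix j assume j: "Suc j < n"
    note lt = order_of_less[OF V, of j "Suc j"]
    show "seq_of N V ! Suc j \<le> seq_of N V ! j" using lt j U by (auto simp: seq_of_def)
    show "seq_of N V ! Suc j < seq_of N V ! j" if "cdesc (perm_of N V) j"
      using lt j U that by (auto simp: seq_of_def perm_of_def cless_def)
  qed
  ultimately show ?thesis by (simp add: perm_seq_pairs_def)
qed

text \<open>The inverse puts the letter with value \<open>c ! j\<close> and the color of
  \<open>w ! j\<close> at the position named by \<open>w ! j\<close>. Since \<open>c\<close> drops
  at the descents of \<open>w\<close>, sorting this word returns the positions in the order of
  \<open>w\<close>.\<close>

lemma bij_perm_seq_pairs: "bij_betw (\<lambda>V. (perm_of N V, seq_of N V)) (words_over N n) (perm_seq_pairs N n)"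
  unfolding bij_betw_def
proof
  show "inj_on (\<lambda>V. (perm_of N V, seq_of N V)) (words_over N n)"
  proof (rule inj_onI)
    fix V V' assume V: "V \<in> words_over N n" "V' \<in> words_over N n" and eq: "(perm_of N V, seq_of N V) = (perm_of N V', seq_of N V')"
    have n: "length V = n" "length V' = n" using V by (simp_all add: words_over_def)
    have "map (\<lambda>z. fst z - 1) (perm_of N V) = order_of N V" for V by (simp add: perm_of_def comp_def)
    then have o: "order_of N V = order_of N V'" using eq by (metis prod.inject)
    have "V ! p = V' ! p" if "p < n" for p
    proof -
      have "p \<in> set (order_of N V)" using that n order_of(2)[of N V] by simp
      then show ?thesis using eq o by (auto simp: perm_of_def seq_of_def intro: prod_eqI)
    qed
    then show "V = V'" using n by (intro nth_equalityI) auto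
  qed
  show "(\<lambda>V. (perm_of N V, seq_of N V)) ` words_over N n = perm_seq_pairs N n"
  proof (intro equalityI subsetI)
    fix z assume z: "z \<in> perm_seq_pairs N n"
    obtain w c where wc: "z = (w, c)" by (cases z)
    have w: "w \<in> colored_perms (Suc l) n" and c: "c \<in> descending N n (cdesc w)"
      using z by (auto simp: wc perm_seq_pairs_def)
    have lw: "length w = n" and lc: "length c = n" and cN: "set c \<subseteq> {..<N}"
      using w c by (auto simp: colored_perms_def descending_def)
    define U where "U = map (\<lambda>z. fst z - 1) w"
    have fw: "fst (w ! j) \<in> {1..n}" if "j < n" for j
      using w that lw by (metis (mono_tags, lifting) colored_perms_def length_map mem_Collect_eq nth_map nth_mem)
    have fU: "fst (w ! j) = Suc (U ! j)" if "j < n" for j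
      using fw[OF that] that lw by (simp add: U_def)
    have U: "length U = n" using lw by (simp add: U_def)
    have mU: "map Suc U = map fst w" by (rule nth_equalityI) (use fU U lw in auto)
    have dU: "distinct U" using w mU by (metis (mono_tags, lifting) colored_perms_def distinct_map mem_Collect_eq)
    have "Suc ` set U = {1..n}" using w mU by (metis (mono_tags, lifting) colored_perms_def list.set_map mem_Collect_eq)
    then have sU: "set U = {0..<n}"
      by (metis atLeastLessThanSuc_atLeastAtMost image_Suc_atLeastLessThan inj_Suc inj_image_eq_iff One_nat_def)
    \<comment> \<open>\<open>idx\<close> inverts \<open>U\<close>: it turns positions of
      \<open>V\<close> into sorted places.\<close>
    define idx where "idx p = (SOME j. j < n \<and> U ! j = p)" for p
    have idx: "idx (U ! j) = j" if "j < n" for j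
    proof -
      have "idx (U ! j) < n \<and> U ! idx (U ! j) = U ! j" unfolding idx_def by (rule someI) (use that in auto)
      then show ?thesis using that dU U by (auto simp: nth_eq_iff_index_eq)
    qed
    define V where "V = map (\<lambda>p. (c ! idx p, snd (w ! idx p))) [0..<n]"
    have UV: "V ! (U ! j) = (c ! j, snd (w ! j))" if "j < n" for j
    proof -
      have "U ! j \<in> {0..<n}" using sU U that nth_mem by blast
      then show ?thesis using idx[OF that] by (simp add: V_def)
    qed
    have inU: "\<exists>j<n. p = U ! j" if "p < n" for p using sU U that by (metis atLeastLessThan_iff in_set_conv_nth zero_le)
    have lV: "length V = n" by (simp add: V_def)
    have col: "snd (w ! j) \<le> l" if "j < n" for j
      using w that lw by (auto simp: colored_perms_def less_Suc_eq_le)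
    have cj: "c ! j < N" if "j < n" for j using cN lc that by (metis lessThan_iff nth_mem subsetD)
    have V: "V \<in> words_over N n"
    proof -
      have "V ! p \<in> letters N" if "p < n" for p
        using inU[OF that] UV cj col by (auto simp: letters_def)
      then have "set V \<subseteq> letters N" using lV by (metis in_set_conv_nth subsetI)
      then show ?thesis using lV by (simp add: words_over_def)
    qed
    let ?key = "\<lambda>p. (N - fst (V ! p), l - snd (V ! p), p)"
    have "sorted (map ?key U)"
      unfolding sorted_iff_nth_Suc
    proof (intro allI impI)
      fix j assume "Suc j < length (map ?key U)"
      then have j: "Suc j < n" using U by simp
      have d: "c ! Suc j \<le> c ! j" "cdesc w j \<longrightarrow> c ! Suc j < c ! j"
        using c j by (auto simp: descending_def)
      have "?key (U ! j) \<le> ?key (U ! Suc j)"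
        using d j UV[of j] UV[of "Suc j"] cj[of j] col[of j] fU[of j] fU[of "Suc j"]
        by (auto simp: less_eq_prod_def less_prod_def cless_def)
      then show "map ?key U ! j \<le> map ?key U ! Suc j" using j U by simp
    qed
    moreover have "sorted (map ?key (order_of N V))" by (simp add: order_of_def)
    moreover have "mset U = mset (order_of N V)"
      unfolding order_of lV using dU sU set_eq_iff_mset_eq_distinct[of U "[0..<n]"] by simp
    ultimately have "map ?key U = map ?key (order_of N V)"
      by (intro sorted_mset_unique) simp_all
    \<comment> \<open>The key contains the position itself, so a list of positions is recovered from
      its keys.\<close>
    moreover have "inj ?key" by (auto simp: inj_on_def)
    ultimately have o: "order_of N V = U" using inj_map_eq_map[of ?key U "order_of N V"] by blast
    have "perm_of N V = w"
      unfolding perm_of_def o by (rule nth_equalityI) (use U lw UV fU in \<open>auto intro: prod_eqI\<close>)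
    moreover have "seq_of N V = c"
      unfolding seq_of_def o by (rule nth_equalityI) (use U lc UV in auto)
    ultimately show "z \<in> (\<lambda>V. (perm_of N V, seq_of N V)) ` words_over N n" using V wc by blast
  qed (use perm_seq_in_pairs in auto)
qed

lemma sum_seq_of: "sum_list (seq_of N V) = sum_list (map fst V)"
  and colsum_perm_of: "colsum (perm_of N V) = sum_list (map snd V)"
  and mset_seq_of: "mset (seq_of N V) = mset (map fst V)"
proof -
  have *: "mset (map (\<lambda>p. f (V ! p)) (order_of N V)) = mset (map f V)" for f :: "nat \<times> nat \<Rightarrow> nat"
  proof -
    have "mset (map (\<lambda>p. f (V ! p)) (order_of N V)) = mset (map (\<lambda>p. f (V ! p)) [0..<length V])"
      by (simp add: order_of(1) del: mset_upt)
    also have "map (\<lambda>p. f (V ! p)) [0..<length V] = map f V" by (rule nth_equalityI) auto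
    finally show ?thesis .
  qed
  show m: "mset (seq_of N V) = mset (map fst V)" using *[of fst] by (simp add: seq_of_def)
  show "sum_list (seq_of N V) = sum_list (map fst V)" using m by (metis sum_mset_sum_list)
  have "colsum (perm_of N V) = sum_list (map (\<lambda>p. snd (V ! p)) (order_of N V))"
    by (simp add: colsum_def perm_of_def comp_def)
  then show "colsum (perm_of N V) = sum_list (map snd V)" using *[of snd] by (metis sum_mset_sum_list)
qed

text \<open>The letter at position \<open>U ! j\<close> has sorted place \<open>j\<close>, and since
  \<open>c\<close> decreases, comparing values at these two places compares the places themselves,
  except inside a block. In a sorted block the letters of color \<open>l\<close> come first and
  those of color 0 last, so the comparison spreads from the ends of the block.\<close>

lemma word_wt_eq:
  assumes V: "V \<in> words_over N n"
  shows "word_wt N V = (if perm_of N V \<in> barred l n then t ^ colsum (perm_of N V) * r ^ cfix (perm_of N V) else 0)"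
proof -
  define U where "U = order_of N V"
  define c where "c = seq_of N V"
  define w where "w = perm_of N V"
  define x where "x j = snd (w ! j)" for j
  have n: "length V = n" using V by (simp add: words_over_def)
  note U = order_of[of N V, folded U_def, unfolded n]
  have wP: "w \<in> colored_perms (Suc l) n" and cD: "c \<in> descending N n (cdesc w)"
    using perm_seq_in_pairs[OF V] by (auto simp: perm_seq_pairs_def w_def c_def)
  have lw: "length w = n" and lc: "length c = n" using U by (simp_all add: w_def c_def perm_of_def seq_of_def U_def)
  have wj: "w ! j = (Suc (U ! j), x j)" if "j < n" for j
    using that U by (simp add: x_def w_def perm_of_def U_def)
  have VU: "V ! (U ! j) = (c ! j, x j)" if "j < n" for j
    using that U by (simp add: x_def w_def c_def perm_of_def seq_of_def U_def)
  have Ult: "U ! j < n" if "j < n" for j using U nth_mem[of j U] that by auto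
  have inU: "\<exists>j<n. p = U ! j" if "p < n" for p using U that by (metis atLeastLessThan_iff in_set_conv_nth zero_le)
  have xl: "x j \<le> l" if "j < n" for j using word_bounds(2)[OF V Ult[OF that]] VU[OF that] by simp
  have mono: "c ! k \<le> c ! j" if "j \<le> k" "k < n" for j k using descending_antimono[OF cD that] .
  have ord: "x k \<le> x j \<and> (x k = x j \<longrightarrow> U ! j < U ! k)" if "j < k" "k < n" "c ! k = c ! j" for j k
    using order_of_less[OF V that(1,2), folded U_def] VU[of j] VU[of k] that by auto
  \<comment> \<open>Sorting identifies \<open>c\<close> with the concatenated constant blocks along
    which \<open>word_wt\<close> cuts \<open>V\<close>.\<close>
  have ceq: "c = concat (map (\<lambda>y. replicate (count (mset (map fst V)) y) y) (rev [0..<N]))" (is "c = ?c")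
  proof -
    have cnt: "count (mset (concat (map (\<lambda>y. replicate (m y) y) ys))) z = (if z \<in> set ys then m z else 0)"
      if "distinct ys" for ys m and z :: nat using that by (induction ys) auto
    have "mset ?c = mset c"
    proof (rule multiset_eqI)
      fix z
      have "count (mset (map fst V)) z = 0" if "\<not> z < N"
      proof -
        have "z \<notin># mset (map fst V)" using V that by (auto simp: words_over_def letters_def)
        then show ?thesis by (simp only: not_in_iff)
      qed
      then show "count (mset ?c) z = count (mset c) z"
        using mset_seq_of[of N V] by (simp add: cnt c_def)
    qed
    moreover have "sorted (rev ?c)"
    proof -
      have "sorted (concat (map (\<lambda>y. replicate (m y) y) [0..<N]))" for m :: "nat \<Rightarrow> nat"
        by (induction N) (auto simp: sorted_append)
      moreover have "rev ?c = concat (map (\<lambda>y. replicate (count (mset (map fst V)) y) y) [0..<N])"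
        by (simp add: rev_concat rev_map comp_def)
      ultimately show ?thesis by simp
    qed
    moreover have "sorted (rev c)" using mono lc by (simp add: sorted_rev_iff_nth_mono)
    ultimately have "rev ?c = rev c" by (intro sorted_mset_unique) simp_all
    then show ?thesis by simp
  qed
  have wt: "word_wt N V = (if \<forall>p<n. pos_ok c V p then r ^ card {p. p < n \<and> fix_run c V p} * t ^ sum_list (map snd V) else 0)"
    unfolding word_wt_def lc[symmetric] by (rule rows_wt_eq[OF _ _ ceq]) (simp_all add: n lc)
  have bar_iff: "w \<in> barred l n \<longleftrightarrow> (\<forall>j<n. (x j = l \<longrightarrow> j < U ! j) \<and> (x j = 0 \<longrightarrow> U ! j \<le> j))"
    using wP by (simp add: barred_def wj)
  have valid: "(\<forall>p<n. pos_ok c V p) \<longleftrightarrow> w \<in> barred l n"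
  proof
    assume b: "w \<in> barred l n"
    show "\<forall>p<n. pos_ok c V p"
    proof (intro allI impI)
      fix p assume p: "p < n"
      obtain j where j: "j < n" "p = U ! j" using inU[OF p] by blast
      have Vp: "V ! p = (c ! j, x j)" using VU j by simp
      have b1: "x j = l \<Longrightarrow> j < p" "x j = 0 \<Longrightarrow> p \<le> j" using b j unfolding bar_iff by auto
      have "letter_ok (c ! p) (V ! p)"
        using b1 mono[of j p] mono[of p j] p j(1) by (auto simp: Vp letter_ok_def)
      moreover have "0 < p \<and> c ! (p - 1) = c ! p" if "V ! p = (c ! p, l)"
      proof -
        \<comment> \<open>The sorted place \<open>j\<close> lies in the block of \<open>p\<close>
          and before \<open>p\<close>, so \<open>p - 1\<close> is in that block too.\<close>
        have "c ! j = c ! p" "j < p" using that Vp b1 by auto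
        then show ?thesis using mono[of j "p - 1"] mono[of "p - 1" p] p by fastforce
      qed
      ultimately show "pos_ok c V p" by (simp add: pos_ok_def)
    qed
  next
    assume ok: "\<forall>p<n. pos_ok c V p"
    have pj: "letter_ok (c ! (U ! j)) (c ! j, x j) \<and>
        (c ! j = c ! (U ! j) \<and> x j = l \<longrightarrow> 0 < U ! j \<and> c ! (U ! j - 1) = c ! (U ! j))" if "j < n" for j
      using ok[rule_format, OF Ult[OF that]] VU[OF that] by (auto simp: pos_ok_def)
    \<comment> \<open>Induction from the start of each block. At its first place the weak comparison
      rules out \<open>U ! j < j\<close>, and the condition on the first letter of a block rules out
      \<open>U ! j = j\<close>; from there on the positions of the letters of color \<open>l\<close>
      increase strictly.\<close>
    have "x j = l \<longrightarrow> j < U ! j" if "j < n" for j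
      using that
    proof (induction j rule: less_induct)
      case (less j)
      show ?case
      proof
        assume xj: "x j = l"
        show "j < U ! j"
        proof (cases "0 < j \<and> c ! (j - 1) = c ! j")
          case True
          then have "x j \<le> x (j - 1) \<and> (x j = x (j - 1) \<longrightarrow> U ! (j - 1) < U ! j)"
            using ord[of "j - 1" j] less.prems by auto
          moreover have "x (j - 1) \<le> l" using xl less.prems by simp
          ultimately have "x (j - 1) = l" "U ! (j - 1) < U ! j" using xj by auto
          moreover from this have "j - 1 < U ! (j - 1)" using less.IH[of "j - 1"] True less.prems by auto
          ultimately show ?thesis by linarith
        next
          case False
          have le: "c ! (U ! j) \<le> c ! j" using pj[OF less.prems] xj by (simp add: letter_ok_def)
          have "\<not> U ! j < j"
          proof
            assume lt: "U ! j < j"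
            then have "c ! (j - 1) \<le> c ! (U ! j)" "c ! j \<le> c ! (j - 1)"
              using mono[of "U ! j" "j - 1"] mono[of "j - 1" j] less.prems by auto
            then show False using le False lt by auto
          qed
          moreover have "U ! j \<noteq> j" using pj[OF less.prems] xj False by auto
          ultimately show ?thesis by simp
        qed
      qed
    qed
    \<comment> \<open>For color 0 the induction runs backwards from the end of each block, where the
      weak comparison suffices because equality is allowed.\<close>
    moreover have "x j = 0 \<longrightarrow> U ! j \<le> j" if "j < n" for j
      using that
    proof (induction "n - j" arbitrary: j rule: less_induct)
      case (less j)
      show ?case
      proof
        assume xj: "x j = 0"
        show "U ! j \<le> j"
        proof (cases "Suc j < n \<and> c ! Suc j = c ! j")
          case True
          then have "x (Suc j) = 0" "U ! j < U ! Suc j" using ord[of j "Suc j"] xj by auto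
          moreover from this have "U ! Suc j \<le> Suc j"
          proof -
            have "n - Suc j < n - j" using True by linarith
            then show ?thesis using less.hyps[of "Suc j"] True \<open>x (Suc j) = 0\<close> by blast
          qed
          ultimately show ?thesis by linarith
        next
          case False
          have le: "c ! j \<le> c ! (U ! j)" using pj[OF less.prems] xj by (simp add: letter_ok_def)
          show ?thesis
          proof (rule ccontr)
            assume "\<not> U ! j \<le> j"
            then have lt: "Suc j \<le> U ! j" by simp
            then have "c ! (U ! j) \<le> c ! Suc j" "c ! Suc j \<le> c ! j" "Suc j < n"
              using mono[of "Suc j" "U ! j"] mono[of j "Suc j"] Ult[OF less.prems] by auto
            then show False using le False by auto
          qed
        qed
      qed
    qed
    ultimately show "w \<in> barred l n" unfolding bar_iff by blast
  qed
  have fixes_eq: "card {p. p < n \<and> fix_run c V p} = cfix w" if b: "w \<in> barred l n"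
  proof -
    have run: "fix_run c V p \<longleftrightarrow> w ! p = (Suc p, 0)" if "p < n" for p
    proof
      assume "fix_run c V p"
      then show "w ! p = (Suc p, 0)" using that
      proof (induction "n - p" arbitrary: p rule: less_induct)
        case (less p)
        obtain j where j: "j < n" "p = U ! j" using inU less.prems by blast
        have "V ! p = (c ! p, 0)" using less.prems lc by (auto simp: fix_run_def)
        then have cj: "c ! j = c ! p" "x j = 0" using VU j by auto
        \<comment> \<open>The sorted place \<open>j\<close> of the letter at \<open>p\<close> lies
          in the same block, at or behind \<open>p\<close>. If it were behind, the induction would
          make \<open>j\<close> a fixed point, against \<open>U ! j = p\<close>.\<close>
        then have pj: "p \<le> j" using b j unfolding bar_iff by auto
        show ?case
        proof (cases "j = p")
          case True
          then show ?thesis using wj j cj by simp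
        next
          case False
          have "fix_run c V j" using less.prems(1) pj cj unfolding fix_run_def by auto
          moreover have "n - j < n - p" using j pj False by linarith
          ultimately have "w ! j = (Suc j, 0)" using less.hyps[of j] j by blast
          then show ?thesis using wj[of j] j False by simp
        qed
      qed
    next
      assume wp: "w ! p = (Suc p, 0)"
      \<comment> \<open>In the block behind a fixed point of color 0 all colors are 0, so the
        positions \<open>U ! k\<close> increase strictly without exceeding \<open>k\<close>.\<close>
      have "U ! k = k \<and> x k = 0" if "p \<le> k" "k < n" "c ! k = c ! p" for k
        using that
      proof (induction k rule: dec_induct)
        case base
        then show ?case using wp wj[OF \<open>p < n\<close>] by simp
      next
        case (step k)
        have ck: "c ! k = c ! p" using mono[of p k] mono[of k "Suc k"] step by simp
        have IH: "U ! k = k" "x k = 0" using step ck by auto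
        have "x (Suc k) = 0" "U ! k < U ! Suc k" using ord[of k "Suc k"] IH step ck by auto
        moreover have "U ! Suc k \<le> Suc k" using b step calculation(1) unfolding bar_iff by auto
        ultimately show ?case using IH by simp
      qed
      then show "fix_run c V p" unfolding fix_run_def lc using VU by metis
    qed
    then have "{p. p < n \<and> fix_run c V p} = {p. p < length w \<and> w ! p = (Suc p, 0)}" using lw by auto
    then show ?thesis by (simp add: cfix_eq)
  qed
  show ?thesis
    unfolding wt valid w_def[symmetric] using fixes_eq colsum_perm_of[of N V]
    by (simp add: w_def[symmetric] mult.commute)
qed

text \<open>Words become pairs \<open>(w, c)\<close>; the weight depends on \<open>c\<close> only
  through its sum, so the sequences for a fixed \<open>w\<close> add up to
  \<open>descending_sum\<close>.\<close>

lemma sum_words: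
  "(\<Sum>V\<in>words_over N n. q ^ sum_list (map fst V) * word_wt N V) =
     (\<Sum>w\<in>barred l n. t ^ colsum w * r ^ cfix w * descending_sum q N n (cdesc w))"
proof -
  have fin: "finite (colored_perms (Suc l) n)" by (simp add: colored_perms_eq_words finite_colored_words)
  let ?f = "\<lambda>(w, c). if w \<in> barred l n then t ^ colsum w * r ^ cfix w * q ^ sum_list c else 0"
  have "(\<Sum>V\<in>words_over N n. q ^ sum_list (map fst V) * word_wt N V) = (\<Sum>V\<in>words_over N n. ?f (perm_of N V, seq_of N V))"
    by (rule sum.cong) (auto simp: word_wt_eq sum_seq_of)
  also have "\<dots> = (\<Sum>z\<in>perm_seq_pairs N n. ?f z)" by (rule sum.reindex_bij_betw[OF bij_perm_seq_pairs])
  also have "\<dots> = (\<Sum>w\<in>colored_perms (Suc l) n. \<Sum>c\<in>descending N n (cdesc w). ?f (w, c))"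
    unfolding perm_seq_pairs_def by (subst sum.Sigma) (use fin finite_descending in auto)
  also have "\<dots> = (\<Sum>w\<in>barred l n. t ^ colsum w * r ^ cfix w * descending_sum q N n (cdesc w))"
  proof (rule sum.mono_neutral_cong_right[OF fin])
    show "barred l n \<subseteq> colored_perms (Suc l) n" by (auto simp: barred_def)
  qed (auto simp: descending_sum_def sum_distrib_left)
  finally show ?thesis .
qed

text \<open>The limit of \<open>word_recurrence\<close> for large \<open>N\<close>, taken term by
  term with \<open>descending_sum_limit\<close>.\<close>

lemma barred_recurrence:
  assumes q: "0 < q" "q < 1"
  defines "a \<equiv> \<lambda>n. \<Sum>w\<in>barred l n. t ^ colsum w * r ^ cfix w * q ^ cmaj w"
  shows "(\<Sum>m\<le>n. qexp q m * (t ^ (l * m) - t) * (qexp q (n - m) * a (n - m))) = (1 - t) * r ^ n * qexp q n"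
proof -
  have g: "(\<lambda>N. \<Sum>M\<in>contents N m. q ^ sum_mset M) \<longlonglongrightarrow> qexp q m" for m
    using descending_sum_limit[OF q, of m "\<lambda>_. False"] by (simp add: descending_sum_contents)
  have w: "(\<lambda>N. \<Sum>V\<in>words_over N m. q ^ sum_list (map fst V) * word_wt N V) \<longlonglongrightarrow> qexp q m * a m" for m
  proof -
    have "(\<lambda>N. \<Sum>w\<in>barred l m. t ^ colsum w * r ^ cfix w * descending_sum q N m (cdesc w)) \<longlonglongrightarrow>
       (\<Sum>w\<in>barred l m. t ^ colsum w * r ^ cfix w * (q ^ cmaj w * qexp q m))"
    proof (intro tendsto_sum tendsto_mult tendsto_const)
      fix w assume "w \<in> barred l m"
      then have "length w = m" by (simp add: barred_def colored_perms_def)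
      then show "(\<lambda>N. descending_sum q N m (cdesc w)) \<longlonglongrightarrow> q ^ cmaj w * qexp q m"
        using descending_sum_limit[OF q, of m "cdesc w"] by (simp add: cmaj_eq)
    qed
    moreover have "(\<Sum>w\<in>barred l m. t ^ colsum w * r ^ cfix w * (q ^ cmaj w * qexp q m)) = qexp q m * a m"
      by (simp add: a_def sum_distrib_left mult_ac)
    ultimately show ?thesis by (simp only: sum_words)
  qed
  have "(\<lambda>N. \<Sum>m\<le>n. (\<Sum>M\<in>contents N m. q ^ sum_mset M) * (t ^ (l * m) - t) *
      (\<Sum>V\<in>words_over N (n - m). q ^ sum_list (map fst V) * word_wt N V)) \<longlonglongrightarrow>
     (\<Sum>m\<le>n. qexp q m * (t ^ (l * m) - t) * (qexp q (n - m) * a (n - m)))"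
    by (intro tendsto_sum tendsto_mult tendsto_const g w)
  moreover have "(\<lambda>N. (1 - t) * r ^ n * (\<Sum>M\<in>contents N n. q ^ sum_mset M)) \<longlonglongrightarrow> (1 - t) * r ^ n * qexp q n"
    by (intro tendsto_mult tendsto_const g)
  ultimately show ?thesis unfolding word_recurrence by (rule LIMSEQ_unique)
qed

end


section \<open>Comparison of the two sides\<close>

text \<open>The value at \<open>n\<close> occurs only in the summand \<open>m = 0\<close>, with the
  nonzero factor \<open>G 0 * d 0 * G n\<close>.\<close>

lemma recurrence_unique:
  fixes a b G d :: "nat \<Rightarrow> real"
  assumes a: "\<And>n. (\<Sum>m\<le>n. G m * d m * (G (n - m) * a (n - m))) = R n"
    and b: "\<And>n. (\<Sum>m\<le>n. G m * d m * (G (n - m) * b (n - m))) = R n"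
    and nz: "\<And>n. G n \<noteq> 0" "d 0 \<noteq> 0"
  shows "a n = b n"
proof (induction n rule: less_induct)
  case (less n)
  have split: "(\<Sum>m\<le>n. G m * d m * (G (n - m) * f (n - m))) =
     G 0 * d 0 * (G n * f n) + (\<Sum>m\<in>{1..n}. G m * d m * (G (n - m) * f (n - m)))" for f
    by (simp add: atMost_atLeast0 sum.atLeast_Suc_atMost)
  have "(\<Sum>m\<in>{1..n}. G m * d m * (G (n - m) * a (n - m))) = (\<Sum>m\<in>{1..n}. G m * d m * (G (n - m) * b (n - m)))"
    by (rule sum.cong) (use less in auto)
  then have "G 0 * d 0 * (G n * a n) = G 0 * d 0 * (G n * b n)"
    using a[of n] b[of n] unfolding split by linarith
  then show ?case using nz by simp
qed

text \<open>Both sides satisfy the same recurrence. Its coefficient at \<open>m = 0\<close> is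
  \<open>1 - t\<close>, hence the condition on \<open>t\<close>.\<close>

theorem real_identity:
  fixes t r q :: real
  assumes "l \<ge> 1" "0 < q" "q < 1" "t \<noteq> 1"
  shows "(\<Sum>w\<in>colored_perms l n. t ^ fexc l w * r ^ cfix w * q ^ (cmaj w - cexc w)) =
     (\<Sum>w\<in>colored_perms l n. t ^ flec l w * r ^ pix w * q ^ (cinv w - lec w))"
proof -
  interpret colors l t r by unfold_locales (rule assms)
  define a where "a n = (\<Sum>w\<in>barred l n. t ^ colsum w * r ^ cfix w * q ^ cmaj w)" for n
  define b where "b n = (\<Sum>w\<in>colored_words l {1..n}. hook_weight l t r q w)" for n
  have "a n = b n"
  proof (rule recurrence_unique[of "qexp q" "\<lambda>m. t ^ (l * m) - t"])
    show "(\<Sum>m\<le>n. qexp q m * (t ^ (l * m) - t) * (qexp q (n - m) * a (n - m))) = (1 - t) * r ^ n * qexp q n" for n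
      unfolding a_def by (rule barred_recurrence) (use assms in auto)
    show "(\<Sum>m\<le>n. qexp q m * (t ^ (l * m) - t) * (qexp q (n - m) * b (n - m))) = (1 - t) * r ^ n * qexp q n" for n
      by (rule hook_side_recurrence) (use assms b_def in auto)
  qed (use assms qexp_nz in auto)
  moreover have "a n = (\<Sum>w\<in>colored_perms l n. t ^ fexc l w * r ^ cfix w * q ^ (cmaj w - cexc w))"
    unfolding a_def sum.reindex_bij_betw[OF bij_bar[OF assms(1)], symmetric]
    by (rule sum.cong) (use cmaj_bar[OF assms(1)] cfix_bar[OF assms(1)] in \<open>auto simp: colsum_bar\<close>)
  ultimately show ?thesis by (simp add: b_def colored_perms_eq_words hook_weight_def)
qed

text \<open>The difference of the two sides is a polynomial with infinitely many roots.\<close>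

lemma coefficients_eq:
  fixes f :: "'b \<Rightarrow> real" and g :: "'c \<Rightarrow> real"
  assumes fin: "finite A" "finite B" and inf: "infinite I"
    and eq: "\<And>x. x \<in> I \<Longrightarrow> (\<Sum>w\<in>A. f w * x ^ e w) = (\<Sum>w\<in>B. g w * x ^ d w)"
  shows "(\<Sum>w | w \<in> A \<and> e w = k. f w) = (\<Sum>w | w \<in> B \<and> d w = k. g w)"
proof -
  define p where "p = (\<Sum>w\<in>A. monom (f w) (e w)) - (\<Sum>w\<in>B. monom (g w) (d w))"
  have "I \<subseteq> {x. poly p x = 0}" using eq by (auto simp: p_def poly_sum poly_monom)
  then have "p = 0" using inf poly_roots_finite[of p] finite_subset by blast
  then have "coeff (\<Sum>w\<in>A. monom (f w) (e w)) k = coeff (\<Sum>w\<in>B. monom (g w) (d w)) k" by (simp add: p_def)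
  then have "(\<Sum>w\<in>A. if e w = k then f w else 0) = (\<Sum>w\<in>B. if d w = k then g w else 0)"
    by (simp add: coeff_sum)
  then show ?thesis using fin by (simp only: sum.inter_filter)
qed

text \<open>Coefficients are compared in \<open>q\<close>, then in \<open>r\<close>, then in
  \<open>t\<close>, the variables still to come being fixed. The values of \<open>t\<close> are
  taken in the open unit interval, which avoids \<open>t = 1\<close>.\<close>

lemma equidistribution:
  assumes "l \<ge> 1"
  shows "card {w \<in> colored_perms l n. cmaj w - cexc w = k \<and> cfix w = j \<and> fexc l w = i} =
     card {w \<in> colored_perms l n. cinv w - lec w = k \<and> pix w = j \<and> flec l w = i}"
proof -
  let ?C = "colored_perms l n"
  have fin: "finite {w \<in> ?C. P w}" for P by (simp add: colored_perms_eq_words finite_colored_words)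
  have infq: "infinite {0<..<1::real}" by (rule infinite_Ioo) simp
  let ?A = "{w \<in> ?C. cmaj w - cexc w = k}" and ?B = "{w \<in> ?C. cinv w - lec w = k}"
  have q: "(\<Sum>w\<in>?A. t ^ fexc l w * r ^ cfix w) = (\<Sum>w\<in>?B. t ^ flec l w * r ^ pix w)"
    if t: "t \<noteq> 1" for t r :: real
  proof (rule coefficients_eq[OF _ _ infq])
    fix x :: real assume "x \<in> {0<..<1}"
    then show "(\<Sum>w\<in>?C. t ^ fexc l w * r ^ cfix w * x ^ (cmaj w - cexc w)) =
        (\<Sum>w\<in>?C. t ^ flec l w * r ^ pix w * x ^ (cinv w - lec w))"
      by (intro real_identity assms t) auto
  qed (use fin[of "\<lambda>_. True"] in simp_all)
  have r: "(\<Sum>w | w \<in> ?A \<and> cfix w = j. t ^ fexc l w) = (\<Sum>w | w \<in> ?B \<and> pix w = j. t ^ flec l w)"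
    if t: "t \<noteq> 1" for t :: real
    by (rule coefficients_eq[OF fin fin infinite_UNIV_char_0]) (rule q[OF t])
  have "(\<Sum>w | w \<in> {w. w \<in> ?A \<and> cfix w = j} \<and> fexc l w = i. 1::real) =
      (\<Sum>w | w \<in> {w. w \<in> ?B \<and> pix w = j} \<and> flec l w = i. 1)"
  proof (rule coefficients_eq[OF _ _ infq])
    fix t :: real assume "t \<in> {0<..<1}"
    then show "(\<Sum>w | w \<in> ?A \<and> cfix w = j. 1 * t ^ fexc l w) = (\<Sum>w | w \<in> ?B \<and> pix w = j. 1 * t ^ flec l w)"
      using r[of t] by simp
  qed (use fin[of "\<lambda>_. True"] in simp_all)
  then show ?thesis by (simp add: conj_assoc)
qed

text \<open>Both sums are regrouped by the value of the statistic; the multiplicities are natural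
  numbers and agree in any semiring.\<close>

lemma sum_eq_if_equidistributed:
  fixes F :: "'c \<Rightarrow> 'a::comm_semiring_1"
  assumes fin: "finite A" and card: "\<And>z. card {w \<in> A. s w = z} = card {w \<in> A. s' w = z}"
  shows "(\<Sum>w\<in>A. F (s w)) = (\<Sum>w\<in>A. F (s' w))"
proof -
  let ?T = "s ` A \<union> s' ` A"
  have eq: "(\<Sum>w\<in>A. F (u w)) = (\<Sum>z\<in>?T. of_nat (card {w \<in> A. u w = z}) * F z)" if "u ` A \<subseteq> ?T" for u
  proof -
    have "(\<Sum>w\<in>A. F (u w)) = (\<Sum>z\<in>?T. \<Sum>w | w \<in> A \<and> u w = z. F (u w))"
      by (rule sum.group[symmetric]) (use fin that in auto)
    also have "\<dots> = (\<Sum>z\<in>?T. of_nat (card {w \<in> A. u w = z}) * F z)"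
      by (rule sum.cong) auto
    finally show ?thesis .
  qed
  show ?thesis using eq[of s] eq[of s'] card by simp
qed

text \<open>Both differences in the exponents are nonnegative on colored permutations, so the
  integer powers are ordinary ones, also for \<open>q = 0\<close>, and the equidistribution of the
  triples of statistics applies in every field.\<close>

theorem theorem4p21:
  fixes l n :: nat and t r q :: "'a :: field"
  assumes "l \<ge> 1" and "n \<ge> 1"
  shows "(\<Sum>w \<in> colored_perms l n.
            t ^ fexc l w * r ^ cfix w * q powi (int (cmaj w) - int (cexc w)))
       = (\<Sum>w \<in> colored_perms l n.
            t ^ flec l w * r ^ pix w * q powi (int (cinv w) - int (lec w)))"
proof -
  let ?F = "\<lambda>(k, j, i). t ^ i * r ^ j * q ^ k"
  have "(\<Sum>w \<in> colored_perms l n. t ^ fexc l w * r ^ cfix w * q powi (int (cmaj w) - int (cexc w)))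
      = (\<Sum>w \<in> colored_perms l n. ?F (cmaj w - cexc w, cfix w, fexc l w))"
  proof (rule sum.cong[OF refl])
    fix w assume "w \<in> colored_perms l n"
    then have "int (cmaj w) - int (cexc w) = int (cmaj w - cexc w)"
      using cmaj_bar[OF assms(1)] by simp
    then show "t ^ fexc l w * r ^ cfix w * q powi (int (cmaj w) - int (cexc w)) = ?F (cmaj w - cexc w, cfix w, fexc l w)"
      by (simp only: power_int_of_nat prod.case)
  qed
  also have "\<dots> = (\<Sum>w \<in> colored_perms l n. ?F (cinv w - lec w, pix w, flec l w))"
  proof (rule sum_eq_if_equidistributed[where F = ?F and s = "\<lambda>w. (cmaj w - cexc w, cfix w, fexc l w)"
        and s' = "\<lambda>w. (cinv w - lec w, pix w, flec l w)"])
    show "finite (colored_perms l n)" by (simp add: colored_perms_eq_words finite_colored_words)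
    show "card {w \<in> colored_perms l n. (cmaj w - cexc w, cfix w, fexc l w) = z} =
        card {w \<in> colored_perms l n. (cinv w - lec w, pix w, flec l w) = z}" for z
      using equidistribution[OF assms(1), of n "fst z" "fst (snd z)" "snd (snd z)"] by (cases z) simp
  qed
  also have "\<dots> = (\<Sum>w \<in> colored_perms l n. t ^ flec l w * r ^ pix w * q powi (int (cinv w) - int (lec w)))"
  proof (rule sum.cong[OF refl])
    fix w assume "w \<in> colored_perms l n"
    then have "int (cinv w) - int (lec w) = int (cinv w - lec w)"
      using lec_le_cinv[of w] by (simp add: colored_perms_def)
    then show "?F (cinv w - lec w, pix w, flec l w) = t ^ flec l w * r ^ pix w * q powi (int (cinv w) - int (lec w))"
      by (simp only: power_int_of_nat prod.case)
  qed
  finally show ?thesis .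
qed

end
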